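(* Let $k$ be a field of characteristic zero and $L$ a Lie $k$-algebra whose universal enveloping algebra $U(L)$ is an Ore domain, with Ore division ring of fractions $\mathfrak D(L)$. Let $u,v\in L$ be such that the Lie subalgebra generated by $u$ and $v$ has dimension at least three. Let $w=[v,u]$, $V=\tfrac12 w(uv+vu)w$, and $$S=(V-\tfrac13w^3)(V+\tfrac13w^3)^{-1}+(V-\tfrac13w^3)^{-1}(V+\tfrac13w^3),\qquad T=(w+v^2)^{-1}(w-v^2)\,S\,(w+v^2)(w-v^2)^{-1}.$$ Then (1) the $k$-subalgebra of $\mathfrak D(L)$ generated by $S$ and $T$ is the free $k$-algebra on $\{S,T\}$, and (2) $S$ and $T$ are symmetric with respect to the principal involution on $\mathfrak D(L)$.
   Context: The principal involution of $L$ is $a\mapsto -a$; it extends uniquely to a $k$-involution (an order-two $k$-linear anti-automorphism) of $U(L)$, and then uniquely to the Ore division ring of fractions $\mathfrak D(L)$ via $(f^{-1})^*=(f^* )^{-1}$. The free $k$-algebra on $X$ is the noncommutative polynomial algebra on $X$. *)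

theory Defs
  imports Complex_Main
begin

definition lie_algebra :: "('k::field \<Rightarrow> 'l::ab_group_add \<Rightarrow> 'l) \<Rightarrow> ('l \<Rightarrow> 'l \<Rightarrow> 'l) \<Rightarrow> bool" where
  "lie_algebra scale br \<longleftrightarrow>
     vector_space scale \<and>
     (\<forall>a b x y z. br (scale a x + scale b y) z = scale a (br x z) + scale b (br y z)) \<and>
     (\<forall>a b x y z. br z (scale a x + scale b y) = scale a (br z x) + scale b (br z y)) \<and>
     (\<forall>x. br x x = 0) \<and>
     (\<forall>x y z. br x (br y z) + br y (br z x) + br z (br x y) = 0)"

inductive_set lie_gen :: "('k::field \<Rightarrow> 'l::ab_group_add \<Rightarrow> 'l) \<Rightarrow> ('l \<Rightarrow> 'l \<Rightarrow> 'l) \<Rightarrow> 'l set \<Rightarrow> 'l set"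
  for scale br X where
  base: "x \<in> X \<Longrightarrow> x \<in> lie_gen scale br X"
| zero: "0 \<in> lie_gen scale br X"
| add: "x \<in> lie_gen scale br X \<Longrightarrow> y \<in> lie_gen scale br X \<Longrightarrow> x + y \<in> lie_gen scale br X"
| smult: "x \<in> lie_gen scale br X \<Longrightarrow> scale a x \<in> lie_gen scale br X"
| bracket: "x \<in> lie_gen scale br X \<Longrightarrow> y \<in> lie_gen scale br X \<Longrightarrow> br x y \<in> lie_gen scale br X"

definition dim_ge3 :: "('k::field \<Rightarrow> 'l::ab_group_add \<Rightarrow> 'l) \<Rightarrow> 'l set \<Rightarrow> bool" where
  "dim_ge3 scale S \<longleftrightarrow> (\<exists>B. B \<subseteq> S \<and> finite B \<and> card B = 3 \<and> \<not> module.dependent scale B)"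

definition free_alg :: "('x list \<Rightarrow> 'k::field) set" where
  "free_alg = {c. finite {w. c w \<noteq> 0}}"

definition fa_word :: "'x list \<Rightarrow> ('x list \<Rightarrow> 'k::field)" where
  "fa_word w = (\<lambda>u. if u = w then 1 else 0)"

definition fa_lmul :: "'x list \<Rightarrow> ('x list \<Rightarrow> 'k::field) \<Rightarrow> ('x list \<Rightarrow> 'k)" where
  "fa_lmul w c = (\<lambda>u. if take (length w) u = w then c (drop (length w) u) else 0)"

definition fa_rmul :: "('x list \<Rightarrow> 'k::field) \<Rightarrow> 'x list \<Rightarrow> ('x list \<Rightarrow> 'k)" where
  "fa_rmul c w = (\<lambda>u. if drop (length u - length w) u = w \<and> length w \<le> length u
                        then c (take (length u - length w) u) else 0)"

inductive_set fa_ideal :: "('x list \<Rightarrow> 'k::field) set \<Rightarrow> ('x list \<Rightarrow> 'k) set" for G where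
  gen: "g \<in> G \<Longrightarrow> g \<in> fa_ideal G"
| zero: "(\<lambda>_. 0) \<in> fa_ideal G"
| add: "p \<in> fa_ideal G \<Longrightarrow> q \<in> fa_ideal G \<Longrightarrow> (\<lambda>u. p u + q u) \<in> fa_ideal G"
| smult: "p \<in> fa_ideal G \<Longrightarrow> (\<lambda>u. a * p u) \<in> fa_ideal G"
| lmul: "p \<in> fa_ideal G \<Longrightarrow> fa_lmul w p \<in> fa_ideal G"
| rmul: "p \<in> fa_ideal G \<Longrightarrow> fa_rmul p w \<in> fa_ideal G"

definition fa_eval :: "('k::field \<Rightarrow> 'd::ring_1) \<Rightarrow> ('x \<Rightarrow> 'd) \<Rightarrow> ('x list \<Rightarrow> 'k) \<Rightarrow> 'd" where
  "fa_eval eps f c = (\<Sum>w\<in>{w. c w \<noteq> 0}. eps (c w) * prod_list (map f w))"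

text \<open>U(L) = k<L> / I, where I is the ideal generated by the linearity relations
  (which give the tensor algebra T(L)) and the relations x y - y x - [x,y].\<close>
definition uea_relations :: "('k::field \<Rightarrow> 'l::ab_group_add \<Rightarrow> 'l) \<Rightarrow> ('l \<Rightarrow> 'l \<Rightarrow> 'l) \<Rightarrow> ('l list \<Rightarrow> 'k) set" where
  "uea_relations scale br =
     {(\<lambda>u. fa_word [scale a x + scale b y] u - a * fa_word [x] u - b * fa_word [y] u) | a b x y. True}
   \<union> {(\<lambda>u. fa_word [x, y] u - fa_word [y, x] u - fa_word [br x y] u) | x y. True}"

definition uea_ideal :: "('k::field \<Rightarrow> 'l::ab_group_add \<Rightarrow> 'l) \<Rightarrow> ('l \<Rightarrow> 'l \<Rightarrow> 'l) \<Rightarrow> ('l list \<Rightarrow> 'k) set" where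
  "uea_ideal scale br = fa_ideal (uea_relations scale br)"

definition central_alg_map :: "('k::field \<Rightarrow> 'd::division_ring) \<Rightarrow> bool" where
  "central_alg_map eps \<longleftrightarrow> eps 0 = 0 \<and> eps 1 = 1 \<and>
     (\<forall>a b. eps (a + b) = eps a + eps b) \<and> (\<forall>a b. eps (a * b) = eps a * eps b) \<and>
     (\<forall>a d. eps a * d = d * eps a)"

text \<open>(D, eps, f) is an Ore division ring of fractions of U(L): the map k<L> \<rightarrow> D induced
  by f : L \<rightarrow> D has kernel exactly the defining ideal of U(L) (so U(L) embeds in D via the
  induced map) and every element of D is a fraction a b^{-1} of elements of U(L).\<close>
definition is_ore_fraction_ring_uea ::
  "('k::field \<Rightarrow> 'l::ab_group_add \<Rightarrow> 'l) \<Rightarrow> ('l \<Rightarrow> 'l \<Rightarrow> 'l) \<Rightarrow> ('k \<Rightarrow> 'd::division_ring) \<Rightarrow> ('l \<Rightarrow> 'd) \<Rightarrow> bool" where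
  "is_ore_fraction_ring_uea scale br eps f \<longleftrightarrow>
     central_alg_map eps \<and>
     (\<forall>c\<in>free_alg. fa_eval eps f c = 0 \<longleftrightarrow> c \<in> uea_ideal scale br) \<and>
     (\<forall>d. \<exists>a\<in>free_alg. \<exists>b\<in>free_alg. fa_eval eps f b \<noteq> 0 \<and> d = fa_eval eps f a * inverse (fa_eval eps f b))"

definition principal_involution ::
  "('k::field \<Rightarrow> 'd::division_ring) \<Rightarrow> ('l \<Rightarrow> 'd) \<Rightarrow> ('d \<Rightarrow> 'd) \<Rightarrow> bool" where
  "principal_involution eps f star \<longleftrightarrow>
     (\<forall>x y. star (x + y) = star x + star y) \<and>
     (\<forall>x y. star (x * y) = star y * star x) \<and>
     (\<forall>a x. star (eps a * x) = eps a * star x) \<and>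
     (\<forall>x. star (star x) = x) \<and>
     (\<forall>l. star (f l) = - f l)"

definition free_on_pair :: "('k::field \<Rightarrow> 'd::division_ring) \<Rightarrow> 'd \<Rightarrow> 'd \<Rightarrow> bool" where
  "free_on_pair eps S T \<longleftrightarrow>
     (\<forall>c \<in> (free_alg :: (bool list \<Rightarrow> 'k) set).
        fa_eval eps (\<lambda>b. if b then S else T) c = 0 \<longrightarrow> c = (\<lambda>_. 0))"

end

theory Submission
  imports Defs "HOL-Library.Poly_Mapping" "HOL-Library.Multiset_Order"
    "HOL-Computational_Algebra.Polynomial" "HOL-Computational_Algebra.Fraction_Field"
begin

text \<open>Give \<open>u\<close> and \<open>v\<close> weight 1 and every other element of a basis of \<open>L\<close> through
  \<open>u, v, w\<close> weight 2. By the Poincare-Birkhoff-Witt theorem the weight is a degree function on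
  \<open>U(L)\<close> that is additive on products, and the Ore condition extends it to a valuation of the
  division ring of fractions. In the residue division ring, \<open>w\<close> commutes with
  \<open>q = (uv + vu) w\<^sup>-\<^sup>1 / 2\<close> and \<open>z = v\<^sup>2 w\<^sup>-\<^sup>1\<close>, the relation \<open>zq = (q + 2)z\<close> holds, and \<open>S\<close>, \<open>T\<close> become
  \<open>s = r + r\<^sup>-\<^sup>1\<close> with \<open>r = (q - 1/3) (q + 1/3)\<^sup>-\<^sup>1\<close>, and its conjugate by \<open>(1 + z)\<^sup>-\<^sup>1 (1 - z)\<close>.

  Expanding in the resolvents \<open>(1 + z)\<^sup>-\<^sup>1\<close> and \<open>(1 - z)\<^sup>-\<^sup>1\<close>, a relation between \<open>S\<close> and \<open>T\<close> becomes
  a left \<open>k(q)\<close>-linear relation between words in resolvents and powers of \<open>s\<close>. Multiplying a shortest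
  one by \<open>z\<close> forces its leading coefficients to be constants and exhibits a combination of positive
  powers of \<open>s\<close> as \<open>g(q + 2) - g(q)\<close> or \<open>g(q + 2) + g(q)\<close>. This is impossible: such a function never has just one
  pole on an orbit of the shift, whereas \<open>s\<close> has a single pole on \<open>1/3 + 2\<int>\<close>.\<close>

section \<open>Linear extensions\<close>

text \<open>The weights are chosen so that exactly one commutator survives to leading order. The
  bracket \<open>w\<close> of \<open>v\<close> and \<open>u\<close> has degree 2, the full degree of
  vu, whereas the brackets of \<open>w\<close> with \<open>u\<close> and \<open>v\<close> lie in
  \<open>L\<close> and so have degree at most 2 in place of 3. Hence \<open>w\<close> is central to
  leading order, and with h = (uv + vu)/2 one gets [v, h] = vw and [v^2, h] = 2 v^2 w up to lower
  degree; dividing by powers of \<open>w\<close> moves everything to degree 0 and gives the shift by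
  2. Dimension at least three makes u, v, w independent, without which \<open>w\<close> could not
  have degree 2. The constant 1/3 is such that the poles 1/3 and -1/3 of \<open>s\<close> lie on
  different orbits of the shift: their distance 2/3 is not an even integer. Additivity of the degree
  rests on the linear independence of ordered monomials, while \<open>U(L)\<close> is given only as
  a quotient by an ideal. Independence is therefore obtained by letting \<open>U(L)\<close> act on
  the space spanned by the ordered monomials.\<close>

abbreviation "lookup \<equiv> Poly_Mapping.lookup"
abbreviation "keys \<equiv> Poly_Mapping.keys"
abbreviation "single \<equiv> Poly_Mapping.single"

definition pscale :: "'k::field \<Rightarrow> ('a \<Rightarrow>\<^sub>0 'k) \<Rightarrow> ('a \<Rightarrow>\<^sub>0 'k)" where
  "pscale c m = Poly_Mapping.map ((*) c) m"

lemma lookup_pscale [simp]: "lookup (pscale c m) a = c * lookup m a"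
  by (auto simp: pscale_def map.rep_eq when_def)

lemma keys_pscale: "keys (pscale c m) \<subseteq> keys m"
  by (auto simp: in_keys_iff)

interpretation pm: module "pscale :: 'k::field \<Rightarrow> ('a \<Rightarrow>\<^sub>0 'k) \<Rightarrow> ('a \<Rightarrow>\<^sub>0 'k)"
  by standard (auto intro!: poly_mapping_eqI simp: lookup_add algebra_simps)

lemmas pm_module = pm.module_axioms

definition lin_ext :: "('k::field \<Rightarrow> 'v \<Rightarrow> 'v::ab_group_add) \<Rightarrow> ('a \<Rightarrow> 'v) \<Rightarrow> ('a \<Rightarrow>\<^sub>0 'k) \<Rightarrow> 'v" where
  "lin_ext scl g m = (\<Sum>a\<in>keys m. scl (lookup m a) (g a))"

lemma lin_ext_cong:
  "(\<And>a. a \<in> keys m \<Longrightarrow> g a = h a) \<Longrightarrow> lin_ext scl g m = lin_ext scl h m"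
  by (simp add: lin_ext_def)

context
  fixes scl :: "'k::field \<Rightarrow> 'v \<Rightarrow> 'v::ab_group_add"
  assumes mod: "module scl"
begin

interpretation module scl by (fact mod)

lemma lin_ext_superset:
  assumes "finite A" "keys m \<subseteq> A"
  shows "lin_ext scl g m = (\<Sum>a\<in>A. scl (lookup m a) (g a))"
  unfolding lin_ext_def
  by (rule sum.mono_neutral_left[OF assms]) (auto simp: in_keys_iff)

lemma lin_ext_zero: "lin_ext scl g 0 = 0"
  by (simp add: lin_ext_def)

lemma lin_ext_add: "lin_ext scl g (m + n) = lin_ext scl g m + lin_ext scl g n"
proof -
  let ?A = "keys m \<union> keys n"
  have "keys (m + n) \<subseteq> ?A" by (rule keys_add)
  then show ?thesis
    by (simp add: lin_ext_superset[of ?A] lookup_add scale_left_distrib sum.distrib)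
qed

lemma lin_ext_scale: "lin_ext scl g (pscale c m) = scl c (lin_ext scl g m)"
  by (simp add: lin_ext_superset[of "keys m" "pscale c m"] lin_ext_superset[of "keys m" m]
      keys_pscale scale_sum_right)

lemma lin_ext_uminus: "lin_ext scl g (- m) = - lin_ext scl g m"
proof -
  have "lin_ext scl g (- m) + lin_ext scl g m = 0"
    using lin_ext_add[of g "- m" m] by (simp add: lin_ext_zero)
  then show ?thesis by (simp add: eq_neg_iff_add_eq_0)
qed

lemma lin_ext_diff: "lin_ext scl g (m - n) = lin_ext scl g m - lin_ext scl g n"
  using lin_ext_add[of g m "- n"] by (simp add: lin_ext_uminus)

lemma lin_ext_single: "lin_ext scl g (single a c) = scl c (g a)"
  by (simp add: lin_ext_superset[of "{a}"])

lemma lin_ext_sum: "lin_ext scl g (\<Sum>i\<in>I. h i) = (\<Sum>i\<in>I. lin_ext scl g (h i))"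
  by (induction I rule: infinite_finite_induct) (simp_all add: lin_ext_zero lin_ext_add)

lemma lin_ext_fun_add: "lin_ext scl (\<lambda>a. g a + h a) m = lin_ext scl g m + lin_ext scl h m"
  by (simp add: lin_ext_def scale_right_distrib sum.distrib)

lemma lin_ext_fun_diff: "lin_ext scl (\<lambda>a. g a - h a) m = lin_ext scl g m - lin_ext scl h m"
  by (simp add: lin_ext_def scale_right_diff_distrib sum_subtractf)

lemma lin_ext_fun_scale: "lin_ext scl (\<lambda>a. scl c (g a)) m = scl c (lin_ext scl g m)"
  by (simp add: lin_ext_def scale_sum_right mult.commute)

lemma lin_ext_fun_zero: "lin_ext scl (\<lambda>a. 0) m = 0"
  by (simp add: lin_ext_def)

lemma lin_ext_lin_ext:
  "lin_ext scl g (lin_ext pscale h m) = lin_ext scl (\<lambda>a. lin_ext scl g (h a)) m"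
  by (simp add: lin_ext_def[of pscale] lin_ext_sum lin_ext_scale)
     (simp add: lin_ext_def)

lemma lin_ext_swap:
  "lin_ext scl (\<lambda>a. lin_ext scl (g a) n) m = lin_ext scl (\<lambda>b. lin_ext scl (\<lambda>a. g a b) m) n"
  unfolding lin_ext_def
  by (simp add: scale_sum_right) (subst sum.swap, simp add: mult.commute)

end

lemma lin_ext_single_id: "lin_ext pscale (\<lambda>a. single a 1) m = m"
proof (rule poly_mapping_eqI)
  fix b
  show "lookup (lin_ext pscale (\<lambda>a. single a 1) m) b = lookup m b"
    by (auto simp: lin_ext_def lookup_sum lookup_single when_def in_keys_iff
        if_distrib[where f = "\<lambda>x. _ * x"] cong: if_cong)
qed

lemma keys_lin_extE:
  assumes "b \<in> keys (lin_ext pscale g m)"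
  obtains a where "a \<in> keys m" "b \<in> keys (g a)"
proof -
  from assms have "(\<Sum>a\<in>keys m. lookup m a * lookup (g a) b) \<noteq> 0"
    by (simp add: in_keys_iff lin_ext_def lookup_sum)
  then obtain a where "a \<in> keys m" "lookup m a * lookup (g a) b \<noteq> 0"
    by (meson sum.neutral)
  then show thesis by (auto simp: in_keys_iff intro: that)
qed

lemmas pm_lin = lin_ext_zero[OF pm_module] lin_ext_add[OF pm_module]
  lin_ext_scale[OF pm_module] lin_ext_uminus[OF pm_module]
  lin_ext_diff[OF pm_module] lin_ext_single[OF pm_module]
lemmas pm_lin_fun = lin_ext_fun_zero[OF pm_module] lin_ext_fun_add[OF pm_module]
  lin_ext_fun_scale[OF pm_module] lin_ext_fun_diff[OF pm_module]

section \<open>The Poincare-Birkhoff-Witt module\<close>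

text \<open>Otherwise the simplifier turns the empty monomial \<open>single {#} 1\<close>, on which
  the words act, into \<open>1\<close>.\<close>

declare Poly_Mapping.single_one [simp del]

text \<open>\<open>pbw_approx sc n b M\<close> is the action of the basis element \<open>b\<close> on the ordered monomial \<open>M\<close>,
  provided that \<open>size M \<le> n\<close>. If \<open>c = min M < b\<close> and \<open>M = c N\<close>, it is forced by
  \<open>b \<cdot> M = c \<cdot> (b \<cdot> N) + [b, c] \<cdot> N\<close>, where \<open>b \<cdot> N - b N\<close> and \<open>N\<close> are shorter than \<open>M\<close>.\<close>

primrec pbw_approx :: "('b::linorder \<Rightarrow> 'b \<Rightarrow> ('b \<Rightarrow>\<^sub>0 'k::field)) \<Rightarrow> nat \<Rightarrow> 'b \<Rightarrow> 'b multiset \<Rightarrow> ('b multiset \<Rightarrow>\<^sub>0 'k)" where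
  "pbw_approx sc 0 b M = single (add_mset b M) 1"
| "pbw_approx sc (Suc n) b M =
    (if \<forall>x\<in>#M. b \<le> x then single (add_mset b M) 1
     else let c = Min (set_mset M); N = M - {#c#} in
       single (add_mset b M) 1
       + lin_ext pscale (pbw_approx sc n c) (pbw_approx sc n b N - single (add_mset b N) 1)
       + lin_ext pscale (\<lambda>d. pbw_approx sc n d N) (sc b c))"

definition pbw_act :: "('b::linorder \<Rightarrow> 'b \<Rightarrow> ('b \<Rightarrow>\<^sub>0 'k::field)) \<Rightarrow> 'b \<Rightarrow> ('b multiset \<Rightarrow>\<^sub>0 'k) \<Rightarrow> ('b multiset \<Rightarrow>\<^sub>0 'k)" where
  "pbw_act sc b = lin_ext pscale (\<lambda>M. pbw_approx sc (size M) b M)"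

definition pbw_lact :: "('b::linorder \<Rightarrow> 'b \<Rightarrow> ('b \<Rightarrow>\<^sub>0 'k::field)) \<Rightarrow> ('b \<Rightarrow>\<^sub>0 'k) \<Rightarrow> ('b multiset \<Rightarrow>\<^sub>0 'k) \<Rightarrow> ('b multiset \<Rightarrow>\<^sub>0 'k)" where
  "pbw_lact sc x m = lin_ext pscale (\<lambda>b. pbw_act sc b m) x"

lemma Min_mset_split:
  fixes M :: "'b::linorder multiset"
  assumes "\<not> (\<forall>x\<in>#M. b \<le> x)"
  obtains c N where "M = add_mset c N" "Min (set_mset M) = c" "M - {#c#} = N" "c < b" "\<forall>x\<in>#N. c \<le> x"
proof -
  have ne: "set_mset M \<noteq> {}" using assms by auto
  define c where "c = Min (set_mset M)"
  have cM: "c \<in># M" unfolding c_def using ne by (simp add: Min_in)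
  have le: "\<forall>x\<in>#M. c \<le> x" unfolding c_def by simp
  from assms le have "c < b" by force
  show thesis
    by (rule that[of c "M - {#c#}"]) (use cM c_def le \<open>c < b\<close> in \<open>auto dest: in_diffD\<close>)
qed

text \<open>Both claims need one joint induction: the recursion applies
  \<open>pbw_approx sc n c\<close> to the correction
  \<open>pbw_approx sc n b N - single (add_mset b N) 1\<close>, and the fuel \<open>n\<close>
  suffices there only because the second claim bounds the size of its monomials by
  \<open>size N\<close>.\<close>

lemma pbw_approx_stable_keys:
  assumes "size M \<le> n"
  shows "pbw_approx sc (Suc n) b M = pbw_approx sc n b M
    \<and> keys (pbw_approx sc n b M - single (add_mset b M) 1) \<subseteq> {P. size P \<le> size M}"
  using assms
proof (induction n arbitrary: b M)
  case 0
  then show ?case by simp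
next
  case (Suc n)
  show ?case
  proof (cases "\<forall>x\<in>#M. b \<le> x")
    case True
    then show ?thesis by simp
  next
    case False
    then obtain c N where M: "M = add_mset c N" "Min (set_mset M) = c" "M - {#c#} = N"
      "c < b" "\<forall>x\<in>#N. c \<le> x" by (rule Min_mset_split)
    let ?A = "pbw_approx sc n" and ?A' = "pbw_approx sc (Suc n)"
    have sN: "size N \<le> n" using Suc.prems M(1) by simp
    have eq: "?A' d N = ?A d N" for d using Suc.IH[OF sN] by blast
    let ?r = "?A b N - single (add_mset b N) 1"
    have kr: "size P \<le> size N" if "P \<in> keys ?r" for P
      using Suc.IH[OF sN] that by blast
    have unf: "pbw_approx sc (Suc n') b M = single (add_mset b M) 1
       + lin_ext pscale (pbw_approx sc n' c) (pbw_approx sc n' b N - single (add_mset b N) 1)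
       + lin_ext pscale (\<lambda>d. pbw_approx sc n' d N) (sc b c)" for n'
      by (simp only: pbw_approx.simps False if_False Let_def M(2,3))
    have 1: "lin_ext pscale (?A' c) ?r = lin_ext pscale (?A c) ?r"
      by (rule lin_ext_cong) (use kr sN Suc.IH in \<open>meson le_trans\<close>)
    have "pbw_approx sc (Suc (Suc n)) b M = pbw_approx sc (Suc n) b M"
      unfolding unf eq 1 by (rule refl)
    moreover have "keys (pbw_approx sc (Suc n) b M - single (add_mset b M) 1) \<subseteq> {P. size P \<le> size M}"
    proof -
      have sz: "size P \<le> Suc (size N')" if "size N' \<le> n" "P \<in> keys (?A d N')" for P d N'
      proof -
        have "keys (?A d N') \<subseteq> keys (?A d N' - single (add_mset d N') 1) \<union> {add_mset d N'}"
          by (auto simp: in_keys_iff lookup_minus lookup_single when_def split: if_splits)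
        then show ?thesis using Suc.IH[OF that(1), of d] that(2) by fastforce
      qed
      have "keys (lin_ext pscale (?A c) ?r) \<subseteq> {P. size P \<le> Suc (size N)}"
      proof
        fix P assume "P \<in> keys (lin_ext pscale (?A c) ?r)"
        then obtain Q where "Q \<in> keys ?r" "P \<in> keys (?A c Q)" by (rule keys_lin_extE)
        then show "P \<in> {P. size P \<le> Suc (size N)}"
          using le_trans[OF sz[of Q P c]] kr[of Q] sN by simp
      qed
      moreover have "keys (lin_ext pscale (\<lambda>d. ?A d N) (sc b c)) \<subseteq> {P. size P \<le> Suc (size N)}"
      proof
        fix P assume "P \<in> keys (lin_ext pscale (\<lambda>d. ?A d N) (sc b c))"
        then obtain d where "P \<in> keys (?A d N)" by (rule keys_lin_extE)
        then show "P \<in> {P. size P \<le> Suc (size N)}" using sz[OF sN] by blast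
      qed
      moreover have "size M = Suc (size N)" using M(1) by simp
      moreover have "pbw_approx sc (Suc n) b M - single (add_mset b M) 1
        = lin_ext pscale (?A c) ?r + lin_ext pscale (\<lambda>d. ?A d N) (sc b c)"
        unfolding unf by simp
      ultimately show ?thesis
        using keys_add[of "lin_ext pscale (?A c) ?r" "lin_ext pscale (\<lambda>d. ?A d N) (sc b c)"] by auto
    qed
    ultimately show ?thesis by blast
  qed
qed

lemma pbw_approx_eq: "size M \<le> n \<Longrightarrow> pbw_approx sc n b M = pbw_approx sc (size M) b M"
proof (induction n)
  case (Suc n)
  then show ?case
    by (cases "size M = Suc n") (use pbw_approx_stable_keys[of M n sc b] in \<open>simp_all del: pbw_approx.simps\<close>)
qed simp

lemma pbw_act_single: "pbw_act sc b (single M 1) = pbw_approx sc (size M) b M"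
  by (simp add: pbw_act_def pm_lin)

lemma pbw_act_lin:
  "pbw_act sc b 0 = 0" "pbw_act sc b (m + n) = pbw_act sc b m + pbw_act sc b n"
  "pbw_act sc b (pscale c m) = pscale c (pbw_act sc b m)" "pbw_act sc b (- m) = - pbw_act sc b m"
  "pbw_act sc b (m - n) = pbw_act sc b m - pbw_act sc b n"
  by (simp_all add: pbw_act_def pm_lin)

lemma pbw_act_lin_ext: "pbw_act sc b (lin_ext pscale g m) = lin_ext pscale (\<lambda>a. pbw_act sc b (g a)) m"
  unfolding pbw_act_def by (rule lin_ext_lin_ext[OF pm_module])

lemma pbw_act_eq: "pbw_act sc b m = lin_ext pscale (\<lambda>M. pbw_act sc b (single M 1)) m"
  unfolding pbw_act_single by (simp add: pbw_act_def)

lemma pbw_act_le: "\<forall>x\<in>#M. b \<le> x \<Longrightarrow> pbw_act sc b (single M 1) = single (add_mset b M) 1"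
  by (cases "size M") (simp_all add: pbw_act_single)

lemma pbw_act_keys_size:
  "keys (pbw_act sc b (single M 1) - single (add_mset b M) 1) \<subseteq> {P. size P \<le> size M}"
  using pbw_approx_stable_keys[of M "size M" sc b] by (simp add: pbw_act_single del: pbw_approx.simps)

text \<open>The recursion freed from fuel. The definition treats the monomial
  \<open>add_mset b N\<close> separately, as it is too long for the remaining fuel; since
  \<open>c\<close> is at most all its entries, its contribution is exactly the leading summand of
  the definition.\<close>

lemma pbw_act_gt:
  fixes b c :: "'b::linorder"
  assumes c: "\<forall>x\<in>#N. c \<le> x" and cb: "c < b"
  shows "pbw_act sc b (single (add_mset c N) 1)
    = pbw_act sc c (pbw_act sc b (single N 1)) + pbw_lact sc (sc b c) (single N 1)"
proof -
  let ?M = "add_mset c N"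
  have n: "\<not> (\<forall>x\<in>#?M. b \<le> x)" using cb by auto
  have mn: "Min (set_mset ?M) = c" using c by (auto intro: Min_eqI)
  let ?r = "pbw_act sc b (single N 1) - single (add_mset b N) 1"
  have 1: "pbw_act sc b (single ?M 1) = single (add_mset b ?M) 1
       + lin_ext pscale (pbw_approx sc (size N) c) ?r
       + lin_ext pscale (\<lambda>d. pbw_act sc d (single N 1)) (sc b c)"
    by (simp only: pbw_act_single size_add_mset pbw_approx.simps n if_False Let_def mn add_mset_remove_trivial)
  have 2: "lin_ext pscale (pbw_approx sc (size N) c) ?r = pbw_act sc c ?r"
    unfolding pbw_act_def[of sc c]
    by (rule lin_ext_cong, rule pbw_approx_eq) (use pbw_act_keys_size in blast)
  have 3: "pbw_act sc c (single (add_mset b N) 1) = single (add_mset b ?M) 1"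
    using c cb by (subst pbw_act_le) (auto simp: add_mset_commute)
  show ?thesis
    unfolding 1 2 pbw_act_lin 3 pbw_lact_def by simp
qed

lemma pbw_lact_lin_left:
  "pbw_lact sc 0 m = 0" "pbw_lact sc (x + y) m = pbw_lact sc x m + pbw_lact sc y m"
  "pbw_lact sc (pscale c x) m = pscale c (pbw_lact sc x m)" "pbw_lact sc (- x) m = - pbw_lact sc x m"
  "pbw_lact sc (x - y) m = pbw_lact sc x m - pbw_lact sc y m"
  "pbw_lact sc (single b 1) m = pbw_act sc b m"
  by (simp_all add: pbw_lact_def pm_lin)

lemma pbw_lact_lin_right:
  "pbw_lact sc x 0 = 0" "pbw_lact sc x (m + n) = pbw_lact sc x m + pbw_lact sc x n"
  "pbw_lact sc x (pscale c m) = pscale c (pbw_lact sc x m)"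
  "pbw_lact sc x (m - n) = pbw_lact sc x m - pbw_lact sc x n"
  by (simp_all add: pbw_lact_def pbw_act_lin pm_lin_fun)

lemma pbw_lact_lin_ext:
  "pbw_lact sc x (lin_ext pscale g m) = lin_ext pscale (\<lambda>a. pbw_lact sc x (g a)) m"
  unfolding pbw_lact_def pbw_act_lin_ext by (rule lin_ext_swap[OF pm_module])

lemma pbw_lact_eq: "pbw_lact sc x m = lin_ext pscale (\<lambda>M. pbw_lact sc x (single M 1)) m"
  using pbw_lact_lin_ext[of sc x "\<lambda>M. single M 1" m] by (simp add: lin_ext_single_id)

section \<open>The action respects the Lie bracket\<close>

locale structure_constants =
  fixes sc :: "'b::linorder \<Rightarrow> 'b \<Rightarrow> ('b \<Rightarrow>\<^sub>0 'k::field)"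
  assumes antisym: "sc b c = - sc c b" and diag: "sc b b = 0"
    and jacobi: "lin_ext pscale (sc a) (sc b c) + lin_ext pscale (sc b) (sc c a)
      + lin_ext pscale (sc c) (sc a b) = 0"
begin

abbreviation "act \<equiv> pbw_act sc"
abbreviation "lact \<equiv> pbw_lact sc"

lemma act_commutator_lact:
  assumes "\<And>y. act x (act y m) - act y (act x m) = lact (sc x y) m"
  shows "act x (lact t m) - lact t (act x m) = lact (lin_ext pscale (sc x) t) m"
proof -
  have "act x (lact t m) - lact t (act x m)
    = lin_ext pscale (\<lambda>y. act x (act y m) - act y (act x m)) t"
    by (simp add: pbw_lact_def pbw_act_lin_ext pm_lin_fun)
  also have "\<dots> = lin_ext pscale (\<lambda>y. lact (sc x y) m) t" by (simp add: assms)
  also have "\<dots> = lact (lin_ext pscale (sc x) t) m"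
    by (simp add: pbw_lact_def lin_ext_lin_ext[OF pm_module])
  finally show ?thesis .
qed

lemma act_commutator_lin_ext:
  assumes "\<And>P. P \<in> keys m \<Longrightarrow> act x (act y (single P 1)) - act y (act x (single P 1)) = lact (sc x y) (single P 1)"
  shows "act x (act y m) - act y (act x m) = lact (sc x y) m"
proof -
  have "act x (act y m) - act y (act x m)
     = lin_ext pscale (\<lambda>P. act x (act y (single P 1)) - act y (act x (single P 1))) m"
    by (simp add: pbw_act_eq[of sc _ m] pbw_act_lin_ext pm_lin_fun)
  also have "\<dots> = lin_ext pscale (\<lambda>P. lact (sc x y) (single P 1)) m"
    by (rule lin_ext_cong) (rule assms)
  also have "\<dots> = lact (sc x y) m" by (rule pbw_lact_eq[symmetric])
  finally show ?thesis .
qed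

lemma act_commutator_min:
  assumes "\<forall>z\<in>#M. y \<le> z" "y < x"
  shows "act x (act y (single M 1)) - act y (act x (single M 1)) = lact (sc x y) (single M 1)"
  using assms by (simp add: pbw_act_le[of M y] pbw_act_gt)

lemma act_commutator_swap:
  assumes "act x (act y m) - act y (act x m) = lact (sc x y) m"
  shows "act y (act x m) - act x (act y m) = lact (sc y x) m"
  using assms antisym[of y x] by (simp add: pbw_lact_lin_left) (metis minus_diff_eq)

text \<open>Induction on the size. If \<open>y\<close> is at most all entries of \<open>M\<close>,
  this is the defining recursion. Otherwise M = c N with \<open>c\<close> below \<open>x\<close> and
  \<open>y\<close>, and \<open>c\<close> is moved to the front of x y c and of y x c. The
  commutators created on the way are known by induction, and the double brackets that remain combine
  by the Jacobi identity.\<close>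

lemma act_commutator_single:
  "act x (act y (single M 1)) - act y (act x (single M 1)) = lact (sc x y) (single M 1)"
proof (induction "size M" arbitrary: x y M rule: less_induct)
  case less
  have gt: "act x (act y (single M 1)) - act y (act x (single M 1)) = lact (sc x y) (single M 1)"
    if yx: "y < x" for x y
  proof (cases "\<forall>z\<in>#M. y \<le> z")
    case True
    then show ?thesis using yx by (rule act_commutator_min)
  next
    case False
    then obtain c N where M: "M = add_mset c N" "c < y" "\<forall>z\<in>#N. c \<le> z"
      by (rule Min_mset_split) blast
    have cx: "c < x" using M yx by simp
    let ?n = "single N (1::'k)"
    have IH: "act a (act b ?n) - act b (act a ?n) = lact (sc a b) ?n" for a b
      using less[of N a b] M(1) by simp
    have zM: "single M 1 = act c ?n" using M by (simp add: pbw_act_le)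
    \<comment> \<open>Among the monomials of \<open>act b ?n\<close> only
      \<open>add_mset b N\<close> is as long as \<open>M\<close>, out of reach of the induction
      hypothesis; there \<open>c\<close> is at most all entries and the claim is the recursion
      itself.\<close>
    have comm_c: "act a (act c (act b ?n)) - act c (act a (act b ?n)) = lact (sc a c) (act b ?n)"
      if "c < a" "c < b" for a b
    proof -
      have "act a (act c (single P 1)) - act c (act a (single P 1)) = lact (sc a c) (single P 1)"
        if P: "P \<in> keys (act b ?n)" for P
      proof -
        have "keys (act b ?n) \<subseteq> insert (add_mset b N) (keys (act b ?n - single (add_mset b N) 1))"
          by (auto simp: in_keys_iff lookup_minus lookup_single when_def split: if_splits)
        with P pbw_act_keys_size[of sc b N] have "P = add_mset b N \<or> size P \<le> size N" by auto
        then show ?thesis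
        proof
          assume "P = add_mset b N"
          then show ?thesis using M(3) \<open>c < a\<close> \<open>c < b\<close>
            by (intro act_commutator_min) auto
        next
          assume "size P \<le> size N"
          then show ?thesis using less[of P a c] M(1) by simp
        qed
      qed
      then show ?thesis by (rule act_commutator_lin_ext)
    qed
    \<comment> \<open>Exchanging \<open>a\<close> and \<open>b\<close> permutes the two middle
      summands, so they cancel from the commutator.\<close>
    have exp: "act a (act b (act c ?n)) = act c (act a (act b ?n)) + lact (sc a c) (act b ?n)
        + lact (sc b c) (act a ?n) + lact (lin_ext pscale (sc a) (sc b c)) ?n"
      if "c < a" "c < b" for a b
    proof -
      have 1: "act b (act c ?n) = act c (act b ?n) + lact (sc b c) ?n"
        using IH[of b c] by (simp add: algebra_simps)
      have 2: "act a (act c (act b ?n)) = act c (act a (act b ?n)) + lact (sc a c) (act b ?n)"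
        using comm_c[OF that] by (simp add: algebra_simps)
      have 3: "act a (lact (sc b c) ?n) = lact (sc b c) (act a ?n) + lact (lin_ext pscale (sc a) (sc b c)) ?n"
        using act_commutator_lact[of a ?n "sc b c"] IH by (simp add: algebra_simps)
      show ?thesis unfolding 1 pbw_act_lin 2 3 by simp
    qed
    have 4: "act c (act x (act y ?n)) - act c (act y (act x ?n)) = act c (lact (sc x y) ?n)"
      using IH[of x y] by (simp flip: pbw_act_lin)
    have 5: "act c (lact (sc x y) ?n) - lact (sc x y) (act c ?n) = lact (lin_ext pscale (sc c) (sc x y)) ?n"
      using act_commutator_lact[of c ?n "sc x y"] IH by simp
    have jac: "lin_ext pscale (sc x) (sc y c) - lin_ext pscale (sc y) (sc x c) = - lin_ext pscale (sc c) (sc x y)"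
    proof -
      have "lin_ext pscale (sc x) (sc y c) + lin_ext pscale (sc y) (sc c x) + lin_ext pscale (sc c) (sc x y) = 0"
        by (rule jacobi)
      moreover have "lin_ext pscale (sc y) (sc c x) = - lin_ext pscale (sc y) (sc x c)"
        using antisym[of c x] by (simp add: pm_lin)
      ultimately show ?thesis
        by (metis (no_types, lifting) add_eq_0_iff uminus_add_conv_diff add.commute)
    qed
    have "lact (lin_ext pscale (sc x) (sc y c)) ?n - lact (lin_ext pscale (sc y) (sc x c)) ?n
       = - lact (lin_ext pscale (sc c) (sc x y)) ?n"
      using jac by (simp flip: pbw_lact_lin_left)
    then have "act x (act y (act c ?n)) - act y (act x (act c ?n))
      = act c (lact (sc x y) ?n) - lact (lin_ext pscale (sc c) (sc x y)) ?n"
      unfolding exp[OF cx M(2)] exp[OF M(2) cx] 4[symmetric] by (simp add: algebra_simps)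
    then show ?thesis unfolding zM using 5 by (simp add: algebra_simps)
  qed
  show ?case
  proof (cases x y rule: linorder_cases)
    case less
    from gt[OF this] show ?thesis by (rule act_commutator_swap)
  next
    case equal
    then show ?thesis by (simp add: diag pbw_lact_lin_left)
  next
    case greater
    then show ?thesis by (rule gt)
  qed
qed

theorem act_commutator: "act x (act y m) - act y (act x m) = lact (sc x y) m"
  by (rule act_commutator_lin_ext) (rule act_commutator_single)

end

section \<open>Leading monomials and the weight degree\<close>

locale weighted_structure_constants = structure_constants sc
  for sc :: "'b::linorder \<Rightarrow> 'b \<Rightarrow> ('b \<Rightarrow>\<^sub>0 'k::field)" +
  fixes wt :: "'b \<Rightarrow> nat" and B :: "'b set"
  assumes wt_bracket: "d \<in> keys (sc b c) \<Longrightarrow> wt d \<le> wt b + wt c"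
    and keys_bracket: "d \<in> keys (sc b c) \<Longrightarrow> d \<in> B"
begin

definition weight :: "'b multiset \<Rightarrow> nat" where
  "weight M = (\<Sum>x\<in>#M. wt x)"

lemma weight_simps [simp]: "weight {#} = 0" "weight (add_mset b M) = wt b + weight M"
  "weight (M + N) = weight M + weight N"
  by (simp_all add: weight_def)

lemma act_single_keys_aux:
  assumes "P \<in> keys (act b (single M 1))"
  shows "P = add_mset b M \<or> P \<in> keys (act b (single M 1) - single (add_mset b M) 1)"
  using assms by (auto simp: in_keys_iff lookup_minus lookup_single when_def split: if_splits)

text \<open>Correction terms may keep the full weight, as \<open>w\<close> does in vu = uv + w. What
  certainly drops is the size, because every correction stems from a bracket, which replaces two
  letters by one.\<close>

lemma act_single_keys:
  assumes "P \<in> keys (act b (single M 1) - single (add_mset b M) 1)"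
  shows "size P \<le> size M \<and> weight P \<le> wt b + weight M \<and> set_mset P \<subseteq> insert b (set_mset M) \<union> B"
  using assms
proof (induction "size M" arbitrary: b M P rule: less_induct)
  case less
  show ?case
  proof (cases "\<forall>x\<in>#M. b \<le> x")
    case True
    then show ?thesis using less.prems by (simp add: pbw_act_le)
  next
    case False
    then obtain c N where M: "M = add_mset c N" "c < b" "\<forall>x\<in>#N. c \<le> x"
      by (rule Min_mset_split) blast
    let ?r = "act b (single N 1) - single (add_mset b N) 1"
    have "act c (single (add_mset b N) 1) = single (add_mset b M) 1"
      using M by (subst pbw_act_le) (auto simp: add_mset_commute)
    then have "act b (single M 1) - single (add_mset b M) 1 = act c ?r + lact (sc b c) (single N 1)"
      unfolding M(1) pbw_act_gt[OF M(3,2)] pbw_act_lin by (simp add: add_mset_commute)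
    with less.prems have "P \<in> keys (act c ?r) \<or> P \<in> keys (lact (sc b c) (single N 1))"
      using keys_add[of "act c ?r" "lact (sc b c) (single N 1)"] by auto
    then show ?thesis
    proof
      assume "P \<in> keys (act c ?r)"
      then obtain Q where Q: "Q \<in> keys ?r" "P \<in> keys (act c (single Q 1))"
        unfolding pbw_act_eq[of sc c ?r] by (rule keys_lin_extE)
      have 1: "size Q \<le> size N \<and> weight Q \<le> wt b + weight N \<and> set_mset Q \<subseteq> insert b (set_mset N) \<union> B"
        using less.hyps[of N Q b] Q(1) M(1) by simp
      have "size P \<le> Suc (size Q) \<and> weight P \<le> wt c + weight Q \<and> set_mset P \<subseteq> insert c (set_mset Q) \<union> B"
        using act_single_keys_aux[OF Q(2)]
      proof
        assume "P = add_mset c Q"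
        then show ?thesis by auto
      next
        assume "P \<in> keys (act c (single Q 1) - single (add_mset c Q) 1)"
        then show ?thesis using less.hyps[of Q P c] 1 M(1) by fastforce
      qed
      then show ?thesis using 1 M(1) by auto
    next
      assume "P \<in> keys (lact (sc b c) (single N 1))"
      then obtain d where d: "d \<in> keys (sc b c)" "P \<in> keys (act d (single N 1))"
        unfolding pbw_lact_def by (rule keys_lin_extE)
      have "size P \<le> Suc (size N) \<and> weight P \<le> wt d + weight N \<and> set_mset P \<subseteq> insert d (set_mset N) \<union> B"
        using act_single_keys_aux[OF d(2)]
      proof
        assume "P = add_mset d N"
        then show ?thesis by auto
      next
        assume "P \<in> keys (act d (single N 1) - single (add_mset d N) 1)"
        then show ?thesis using less.hyps[of N P d] M(1) by fastforce
      qed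
      then show ?thesis using wt_bracket[OF d(1)] keys_bracket[OF d(1)] M(1) by auto
    qed
  qed
qed

text \<open>Weight comes first so that the leading monomial computes the degree, size second so that
  corrections of equal weight are still smaller, and the multiset order makes the comparison total
  while staying compatible with sums of multisets.\<close>

definition mono_less :: "'b multiset \<Rightarrow> 'b multiset \<Rightarrow> bool" where
  "mono_less P Q \<longleftrightarrow> weight P < weight Q \<or> weight P = weight Q \<and>
     (size P < size Q \<or> size P = size Q \<and> P < Q)"

lemma mono_less_irrefl: "\<not> mono_less P P"
  by (simp add: mono_less_def)

lemma mono_less_trans: "mono_less P Q \<Longrightarrow> mono_less Q R \<Longrightarrow> mono_less P R"
  by (auto simp: mono_less_def)

lemma mono_less_linear: "mono_less P Q \<or> P = Q \<or> mono_less Q P"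
  by (auto simp: mono_less_def)

lemma mono_less_add: "mono_less P Q \<Longrightarrow> mono_less (P + R) (Q + R)"
  by (auto simp: mono_less_def)

definition lead :: "('b multiset \<Rightarrow>\<^sub>0 'k) \<Rightarrow> 'b multiset \<Rightarrow> bool" where
  "lead m P \<longleftrightarrow> P \<in> keys m \<and> (\<forall>Q\<in>keys m. Q = P \<or> mono_less Q P)"

lemma lead_exists:
  assumes "m \<noteq> 0"
  shows "\<exists>P. lead m P"
proof -
  have ex: "A \<noteq> {} \<Longrightarrow> \<exists>P\<in>A. \<forall>Q\<in>A. Q = P \<or> mono_less Q P" if "finite A" for A
    using that
  proof (induction A)
    case (insert a A)
    show ?case
    proof (cases "A = {}")
      case False
      then obtain P where P: "P \<in> A" "\<forall>Q\<in>A. Q = P \<or> mono_less Q P" using insert by blast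
      from mono_less_linear[of a P] consider "mono_less a P" | "a = P" | "mono_less P a" by blast
      then show ?thesis
      proof cases
        case 3
        then have "\<forall>Q\<in>insert a A. Q = a \<or> mono_less Q a" using P(2) mono_less_trans by auto
        then show ?thesis by blast
      qed (use P in auto)
    qed simp
  qed simp
  have "keys m \<noteq> {}" using assms by (auto simp: in_keys_iff intro!: poly_mapping_eqI)
  from ex[OF finite_keys this] show ?thesis by (auto simp: lead_def)
qed

text \<open>Adding \<open>R\<close> preserves the strict order, so \<open>P + R\<close> arises from
  the summand of \<open>P\<close> alone and cannot cancel.\<close>

lemma lead_lin_ext:
  assumes m: "lead m P" and g: "\<And>Q. Q \<in> keys m \<Longrightarrow> lead (g Q) (Q + R)"
  shows "lead (lin_ext pscale g m) (P + R)"
  unfolding lead_def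
proof (intro conjI ballI)
  have "lookup (g Q) (P + R) = 0" if "Q \<in> keys m" "Q \<noteq> P" for Q
  proof (rule ccontr)
    assume "lookup (g Q) (P + R) \<noteq> 0"
    then have "P + R \<in> keys (g Q)" by (simp add: in_keys_iff)
    then have "P + R = Q + R \<or> mono_less (P + R) (Q + R)"
      using g[OF that(1)] unfolding lead_def by blast
    moreover have "mono_less (Q + R) (P + R)"
      using m that by (auto simp: lead_def intro: mono_less_add)
    ultimately show False using mono_less_trans mono_less_irrefl by metis
  qed
  then have "lookup (lin_ext pscale g m) (P + R) = (\<Sum>Q\<in>keys m. if Q = P then lookup m P * lookup (g P) (P + R) else 0)"
    unfolding lin_ext_def lookup_sum lookup_pscale by (intro sum.cong) auto
  also have "\<dots> = lookup m P * lookup (g P) (P + R)"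
    using m by (simp add: lead_def)
  also have "\<dots> \<noteq> 0" using m g[of P] by (auto simp: lead_def in_keys_iff)
  finally show "P + R \<in> keys (lin_ext pscale g m)" by (simp add: in_keys_iff)
next
  fix N assume "N \<in> keys (lin_ext pscale g m)"
  then obtain Q where Q: "Q \<in> keys m" "N \<in> keys (g Q)" by (rule keys_lin_extE)
  then have "N = Q + R \<or> mono_less N (Q + R)" using g by (auto simp: lead_def)
  moreover have "Q + R = P + R \<or> mono_less (Q + R) (P + R)"
    using m Q(1) by (auto simp: lead_def intro: mono_less_add)
  ultimately show "N = P + R \<or> mono_less N (P + R)" using mono_less_trans by metis
qed

lemma lead_act_single: "lead (act b (single M 1)) (M + {#b#})"
proof -
  let ?r = "act b (single M 1) - single (add_mset b M) 1"
  have "add_mset b M \<notin> keys ?r" using act_single_keys[of "add_mset b M" b M] by auto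
  then have "add_mset b M \<in> keys (act b (single M 1))"
    by (simp add: in_keys_iff lookup_minus)
  moreover have "Q = add_mset b M \<or> mono_less Q (add_mset b M)" if "Q \<in> keys (act b (single M 1))" for Q
    using act_single_keys_aux[OF that] act_single_keys[of Q b M] by (auto simp: mono_less_def)
  ultimately show ?thesis by (simp add: lead_def)
qed

lemma lead_act: "lead m P \<Longrightarrow> lead (act b m) (P + {#b#})"
  unfolding pbw_act_eq[of sc b m] by (rule lead_lin_ext) (assumption, rule lead_act_single)

lemma lead_foldr_act: "lead m P \<Longrightarrow> lead (foldr act bs m) (mset bs + P)"
proof (induction bs)
  case (Cons b bs)
  then show ?case using lead_act[of "foldr act bs m" _ b] by simp
qed simp

text \<open>The product of \<open>U(L)\<close> in coordinates of ordered monomials: each monomial of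
  \<open>m\<close> acts on \<open>n\<close> as the word of its sorted letters.\<close>

definition pbw_mult :: "('b multiset \<Rightarrow>\<^sub>0 'k) \<Rightarrow> ('b multiset \<Rightarrow>\<^sub>0 'k) \<Rightarrow> ('b multiset \<Rightarrow>\<^sub>0 'k)" where
  "pbw_mult m n = lin_ext pscale (\<lambda>M. foldr act (sorted_list_of_multiset M) n) m"

lemma lead_pbw_mult: "lead m P \<Longrightarrow> lead n Q \<Longrightarrow> lead (pbw_mult m n) (P + Q)"
  unfolding pbw_mult_def
  by (rule lead_lin_ext) (assumption, metis lead_foldr_act mset_sorted_list_of_multiset)

text \<open>The index type may contain more than the basis. Only on combinations of monomials in
  basis indices will the map to the division ring be injective.\<close>

definition over_basis :: "('b multiset \<Rightarrow>\<^sub>0 'k) \<Rightarrow> bool" where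
  "over_basis m \<longleftrightarrow> (\<forall>P\<in>keys m. set_mset P \<subseteq> B)"

text \<open>At \<open>0\<close> this is the unspecified \<open>Max {}\<close>, hence the nonzero
  premises below.\<close>

definition pbw_degree :: "('b multiset \<Rightarrow>\<^sub>0 'k) \<Rightarrow> nat" where
  "pbw_degree m = Max (weight ` keys m)"

lemma pbw_degree_lead:
  assumes "lead m P"
  shows "pbw_degree m = weight P"
  unfolding pbw_degree_def
  by (rule Max_eqI) (use assms in \<open>auto simp: lead_def mono_less_def\<close>)

lemma lead_nonzero: "lead m P \<Longrightarrow> m \<noteq> 0"
  by (auto simp: lead_def)

lemma pbw_degree_mult:
  assumes "m \<noteq> 0" "n \<noteq> 0"
  shows "pbw_mult m n \<noteq> 0" "pbw_degree (pbw_mult m n) = pbw_degree m + pbw_degree n"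
proof -
  from assms obtain P Q where "lead m P" "lead n Q" using lead_exists by blast
  with lead_pbw_mult[OF this] show "pbw_mult m n \<noteq> 0"
    "pbw_degree (pbw_mult m n) = pbw_degree m + pbw_degree n"
    by (auto simp: pbw_degree_lead dest: lead_nonzero)
qed

lemma pbw_degree_add:
  assumes "m + n \<noteq> 0"
  shows "pbw_degree (m + n) \<le> max (pbw_degree m) (pbw_degree n)"
proof -
  obtain P where P: "lead (m + n) P" using lead_exists[OF assms] by blast
  then have "P \<in> keys m \<or> P \<in> keys n" using keys_add[of m n] by (auto simp: lead_def)
  then have "weight P \<le> pbw_degree m \<or> weight P \<le> pbw_degree n"
    unfolding pbw_degree_def by (auto intro!: Max_ge)
  then show ?thesis using pbw_degree_lead[OF P] by auto
qed

lemma over_basis_lin_ext: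
  "(\<And>Q. Q \<in> keys m \<Longrightarrow> over_basis (g Q)) \<Longrightarrow> over_basis (lin_ext pscale g m)"
  unfolding over_basis_def by (meson keys_lin_extE)

lemma over_basis_act:
  assumes "b \<in> B" "over_basis m"
  shows "over_basis (act b m)"
  unfolding pbw_act_eq[of sc b m]
proof (rule over_basis_lin_ext)
  fix Q assume "Q \<in> keys m"
  then have "set_mset Q \<subseteq> B" using assms by (simp add: over_basis_def)
  then have "set_mset P \<subseteq> B" if "P \<in> keys (act b (single Q 1))" for P
    using act_single_keys_aux[OF that] act_single_keys[of P b Q] assms(1) by auto
  then show "over_basis (act b (single Q 1))" by (simp add: over_basis_def)
qed

lemma over_basis_foldr_act:
  "set bs \<subseteq> B \<Longrightarrow> over_basis m \<Longrightarrow> over_basis (foldr act bs m)"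
  by (induction bs) (auto intro: over_basis_act)

lemma over_basis_mult:
  assumes "over_basis m" "over_basis n"
  shows "over_basis (pbw_mult m n)"
  unfolding pbw_mult_def
  by (rule over_basis_lin_ext, rule over_basis_foldr_act)
     (use assms in \<open>auto simp: over_basis_def\<close>)

lemma over_basis_add: "over_basis m \<Longrightarrow> over_basis n \<Longrightarrow> over_basis (m + n)"
  using keys_add[of m n] by (auto simp: over_basis_def)

end

text \<open>Each letter is at most all later ones, so no correction ever appears: an ordered word
  can be read off from its effect on the empty monomial. The independence of ordered monomials comes
  from this.\<close>

lemma foldr_act_sorted: 
  "sorted bs \<Longrightarrow> foldr (pbw_act sc) bs (single {#} 1) = single (mset bs) 1"
proof (induction bs)
  case (Cons b bs)
  then have "\<forall>x\<in>#mset bs. b \<le> x" by simp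
  then show ?case using Cons by (simp add: pbw_act_le)
qed simp

section \<open>Realisation in an algebra\<close>

locale pbw_realisation = weighted_structure_constants sc wt B
  for sc :: "'b::linorder \<Rightarrow> 'b \<Rightarrow> ('b \<Rightarrow>\<^sub>0 'k::field)" and wt B +
  fixes eps :: "'k \<Rightarrow> 'd::division_ring" and F :: "'b \<Rightarrow> 'd"
  assumes eps: "central_alg_map eps"
    and F_bracket: "F b * F c - F c * F b = lin_ext (\<lambda>a d. eps a * d) F (sc b c)"
begin

abbreviation "dlin \<equiv> lin_ext (\<lambda>a d. eps a * d)"

lemma dmod: "module (\<lambda>a d. eps a * d)"
proof -
  have "eps 1 = 1" "\<And>a b. eps (a + b) = eps a + eps b" "\<And>a b. eps (a * b) = eps a * eps b"
    using eps unfolding central_alg_map_def by blast+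
  then show ?thesis by unfold_locales (simp_all add: distrib_left distrib_right mult.assoc)
qed

definition psi :: "('b multiset \<Rightarrow>\<^sub>0 'k) \<Rightarrow> 'd" where
  "psi = dlin (\<lambda>M. prod_list (map F (sorted_list_of_multiset M)))"

lemma psi_lin: "psi 0 = 0" "psi (m + n) = psi m + psi n" "psi (pscale c m) = eps c * psi m"
  "psi (m - n) = psi m - psi n" "psi (- m) = - psi m"
  using lin_ext_zero[OF dmod] lin_ext_add[OF dmod] lin_ext_scale[OF dmod] lin_ext_diff[OF dmod]
    lin_ext_uminus[OF dmod]
  by (simp_all add: psi_def)

lemma psi_single: "psi (single M 1) = prod_list (map F (sorted_list_of_multiset M))"
proof -
  have "eps 1 = 1" using eps unfolding central_alg_map_def by blast
  then show ?thesis by (simp add: psi_def lin_ext_single[OF dmod])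
qed

lemma psi_lin_ext: "psi (lin_ext pscale g m) = dlin (\<lambda>a. psi (g a)) m"
  unfolding psi_def by (rule lin_ext_lin_ext[OF dmod])

lemma psi_eq: "psi m = dlin (\<lambda>M. psi (single M 1)) m"
  unfolding psi_single by (simp add: psi_def)

lemma dlin_mult_right: "dlin g m * x = dlin (\<lambda>a. g a * x) m"
  by (simp add: lin_ext_def sum_distrib_right mult.assoc)

lemma dlin_mult_left: "x * dlin g m = dlin (\<lambda>a. x * g a) m"
proof -
  have "x * (eps a * y) = eps a * (x * y)" for a y
    using eps unfolding central_alg_map_def by (metis mult.assoc)
  then show ?thesis by (simp add: lin_ext_def sum_distrib_left)
qed

lemma insort_min: "\<forall>x\<in>set xs. b \<le> x \<Longrightarrow> insort b xs = b # xs"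
  by (cases xs) auto

lemma psi_act_le: "\<forall>x\<in>#M. b \<le> x \<Longrightarrow> psi (act b (single M 1)) = F b * psi (single M 1)"
  by (simp add: pbw_act_le psi_single sorted_list_of_multiset_insert insort_min)

lemma psi_act_keys:
  assumes "\<And>P. P \<in> keys m \<Longrightarrow> psi (act b (single P 1)) = F b * psi (single P 1)"
  shows "psi (act b m) = F b * psi m"
  unfolding pbw_act_eq[of sc b m] psi_eq[of m] psi_lin_ext dlin_mult_left
  by (rule lin_ext_cong) (rule assms)

text \<open>The recursion of the action is the rewriting of \<open>F b * F c\<close> into
  \<open>F c * F b\<close> plus a bracket in the division ring, so the proof repeats the induction
  of the action.\<close>

lemma psi_act_single: "psi (act b (single M 1)) = F b * psi (single M 1)"
proof (induction "size M" arbitrary: b M rule: less_induct)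
  case less
  show ?case
  proof (cases "\<forall>x\<in>#M. b \<le> x")
    case True
    then show ?thesis by (rule psi_act_le)
  next
    case False
    then obtain c N where M: "M = add_mset c N" "c < b" "\<forall>x\<in>#N. c \<le> x"
      by (rule Min_mset_split) blast
    let ?n = "single N (1::'k)"
    have IH: "psi (act d ?n) = F d * psi ?n" for d using less[of N d] M(1) by simp
    have 1: "psi (act c (act b ?n)) = F c * psi (act b ?n)"
    proof (rule psi_act_keys)
      fix P assume P: "P \<in> keys (act b ?n)"
      show "psi (act c (single P 1)) = F c * psi (single P 1)"
        using act_single_keys_aux[OF P]
      proof
        assume "P = add_mset b N"
        then show ?thesis using M by (intro psi_act_le) auto
      next
        assume "P \<in> keys (act b ?n - single (add_mset b N) 1)"
        then have "size P < size M" using act_single_keys M(1) by fastforce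
        then show ?thesis by (rule less)
      qed
    qed
    have 2: "psi (lact (sc b c) ?n) = (F b * F c - F c * F b) * psi ?n"
      unfolding F_bracket dlin_mult_right pbw_lact_def psi_lin_ext IH by (rule refl)
    have 3: "psi (single M 1) = F c * psi ?n"
      using psi_act_le[OF M(3)] pbw_act_le[OF M(3), of sc] M(1) by simp
    show ?thesis
      unfolding 3 unfolding M(1) pbw_act_gt[OF M(3,2)] psi_lin 1 2 IH by (simp add: algebra_simps)
  qed
qed

lemma psi_act: "psi (act b m) = F b * psi m"
  by (rule psi_act_keys) (rule psi_act_single)

lemma psi_lact: "psi (lact x m) = dlin F x * psi m"
  unfolding pbw_lact_def psi_lin_ext dlin_mult_right psi_act by (rule refl)

lemma psi_foldr_act: "psi (foldr act bs m) = prod_list (map F bs) * psi m"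
  by (induction bs) (simp_all add: psi_act mult.assoc)

lemma psi_mult: "psi (pbw_mult m n) = psi m * psi n"
  unfolding pbw_mult_def psi_lin_ext psi_foldr_act dlin_mult_right[symmetric] by (simp add: psi_def)

end

section \<open>The degree function on an enveloping algebra\<close>

text \<open>A copy of an arbitrary type that carries a linear order, so that the basis elements of any
  Lie algebra can index ordered monomials.\<close>

datatype 'a well_ordered = Wo (un_wo: 'a)

definition some_linear_order :: "'a rel" where
  "some_linear_order = (SOME r. well_order_on UNIV r)"

lemma some_linear_order: "linear_order (some_linear_order :: 'a rel)"
proof -
  have "well_order_on UNIV (some_linear_order :: 'a rel)"
    unfolding some_linear_order_def using well_order_on[of "UNIV :: 'a set"] by (rule someI_ex)
  then show ?thesis by (simp add: well_order_on_def)
qed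

instantiation well_ordered :: (type) linorder
begin

definition less_eq_well_ordered :: "'a well_ordered \<Rightarrow> 'a well_ordered \<Rightarrow> bool" where
  "x \<le> y \<longleftrightarrow> (un_wo x, un_wo y) \<in> some_linear_order"

definition less_well_ordered :: "'a well_ordered \<Rightarrow> 'a well_ordered \<Rightarrow> bool" where
  "x < y \<longleftrightarrow> x \<le> y \<and> \<not> y \<le> x" for x y :: "'a well_ordered"

instance
proof
  have r: "refl (some_linear_order :: 'a rel)" "trans (some_linear_order :: 'a rel)"
    "antisym (some_linear_order :: 'a rel)" "total (some_linear_order :: 'a rel)"
    using some_linear_order
    by (auto simp: linear_order_on_def partial_order_on_def preorder_on_def)
  fix x y z :: "'a well_ordered"
  show "x < y \<longleftrightarrow> x \<le> y \<and> \<not> y \<le> x" by (simp add: less_well_ordered_def)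
  show "x \<le> x" using r(1) by (simp add: less_eq_well_ordered_def refl_on_def)
  show "x \<le> y \<Longrightarrow> y \<le> z \<Longrightarrow> x \<le> z"
    using r(2) unfolding less_eq_well_ordered_def by (rule transD)
  show "x \<le> y \<Longrightarrow> y \<le> x \<Longrightarrow> x = y"
    using r(3) unfolding less_eq_well_ordered_def
    by (metis antisymD well_ordered.expand)
  show "x \<le> y \<or> y \<le> x"
    using r(1,4) unfolding less_eq_well_ordered_def by (metis UNIV_I refl_on_def total_on_def)
qed

end

text \<open>This is \<open>fa_eval\<close> with values in an arbitrary module, so that the same
  rules serve for evaluation in the division ring and for the action of words on ordered
  monomials.\<close>

definition word_sum :: "('k::field \<Rightarrow> 'v \<Rightarrow> 'v::ab_group_add) \<Rightarrow> ('x list \<Rightarrow> 'v) \<Rightarrow> ('x list \<Rightarrow> 'k) \<Rightarrow> 'v" where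
  "word_sum scl g c = (\<Sum>w | c w \<noteq> 0. scl (c w) (g w))"

lemma fa_eval_word_sum: "fa_eval eps f = word_sum (\<lambda>a d. eps a * d) (\<lambda>w. prod_list (map f w))"
  by (simp add: fun_eq_iff fa_eval_def word_sum_def)

context
  fixes scl :: "'k::field \<Rightarrow> 'v \<Rightarrow> 'v::ab_group_add"
  assumes mod: "module scl"
begin

interpretation module scl by (fact mod)

lemma word_sum_superset:
  assumes "finite A" "{w. c w \<noteq> 0} \<subseteq> A"
  shows "word_sum scl g c = (\<Sum>w\<in>A. scl (c w) (g w))"
  unfolding word_sum_def by (rule sum.mono_neutral_left[OF assms]) auto

lemma word_sum_add:
  assumes "c \<in> free_alg" "d \<in> free_alg"
  shows "word_sum scl g (\<lambda>w. c w + d w) = word_sum scl g c + word_sum scl g d"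
proof -
  let ?A = "{w. c w \<noteq> 0} \<union> {w. d w \<noteq> 0}"
  have "finite ?A" using assms by (simp add: free_alg_def)
  moreover have "{w. c w + d w \<noteq> 0} \<subseteq> ?A" by auto
  ultimately show ?thesis
    by (simp add: word_sum_superset[of ?A] scale_left_distrib sum.distrib)
qed

lemma word_sum_scale:
  assumes "c \<in> free_alg"
  shows "word_sum scl g (\<lambda>w. a * c w) = scl a (word_sum scl g c)"
proof -
  let ?A = "{w. c w \<noteq> 0}"
  have "finite ?A" using assms by (simp add: free_alg_def)
  moreover have "{w. a * c w \<noteq> 0} \<subseteq> ?A" by auto
  ultimately show ?thesis
    using word_sum_superset[of ?A "\<lambda>w. a * c w" g] word_sum_superset[of ?A c g]
    by (simp add: scale_sum_right)
qed

lemma word_sum_word: "word_sum scl g (fa_word w) = g w"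
  by (subst word_sum_superset[of "{w}"]) (auto simp: fa_word_def)

end

lemma free_alg_add: "c \<in> free_alg \<Longrightarrow> d \<in> free_alg \<Longrightarrow> (\<lambda>w. c w + d w) \<in> free_alg"
  unfolding free_alg_def by (auto intro: finite_subset[of _ "{w. c w \<noteq> 0} \<union> {w. d w \<noteq> 0}"])

lemma free_alg_scale: "c \<in> free_alg \<Longrightarrow> (\<lambda>w. a * c w) \<in> free_alg"
  unfolding free_alg_def by (auto intro: finite_subset[of _ "{w. c w \<noteq> 0}"])

lemma free_alg_word: "fa_word w \<in> free_alg"
  unfolding free_alg_def fa_word_def by (auto intro: finite_subset[of _ "{w}"])

lemma supp_fa_lmul: "{u. fa_lmul w c u \<noteq> 0} = (\<lambda>u. w @ u) ` {u. c u \<noteq> 0}"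
proof (intro set_eqI iffI)
  fix u assume "u \<in> {u. fa_lmul w c u \<noteq> 0}"
  then have "take (length w) u = w" "c (drop (length w) u) \<noteq> 0"
    by (auto simp: fa_lmul_def split: if_splits)
  then show "u \<in> (\<lambda>u. w @ u) ` {u. c u \<noteq> 0}"
    by (metis (mono_tags, lifting) append_take_drop_id image_eqI mem_Collect_eq)
qed (auto simp: fa_lmul_def)

lemma supp_fa_rmul: "{u. fa_rmul c w u \<noteq> 0} = (\<lambda>u. u @ w) ` {u. c u \<noteq> 0}"
proof (intro set_eqI iffI)
  fix u assume "u \<in> {u. fa_rmul c w u \<noteq> 0}"
  then have "drop (length u - length w) u = w" "c (take (length u - length w) u) \<noteq> 0"
    by (auto simp: fa_rmul_def split: if_splits)
  then show "u \<in> (\<lambda>u. u @ w) ` {u. c u \<noteq> 0}"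
    by (metis (mono_tags, lifting) append_take_drop_id image_eqI mem_Collect_eq)
qed (auto simp: fa_rmul_def)

context
  fixes scale :: "'k::field \<Rightarrow> 'l::ab_group_add \<Rightarrow> 'l" and br :: "'l \<Rightarrow> 'l \<Rightarrow> 'l"
  assumes lie: "lie_algebra scale br"
begin

interpretation vector_space scale
  using lie by (simp add: lie_algebra_def)

lemma lie_bracket_lin: "br (x + y) z = br x z + br y z" "br (scale a x) z = scale a (br x z)"
  "br z (x + y) = br z x + br z y" "br z (scale a x) = scale a (br z x)" "br 0 z = 0" "br z 0 = 0"
proof -
  have l: "\<And>a b x y z. br (scale a x + scale b y) z = scale a (br x z) + scale b (br y z)"
    "\<And>a b x y z. br z (scale a x + scale b y) = scale a (br z x) + scale b (br z y)"
    using lie unfolding lie_algebra_def by blast+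
  show "br (x + y) z = br x z + br y z" using l(1)[of 1 x 1 y z] by simp
  show "br (scale a x) z = scale a (br x z)" using l(1)[of a x 0 x z] by simp
  show "br z (x + y) = br z x + br z y" using l(2)[of z 1 x 1 y] by simp
  show "br z (scale a x) = scale a (br z x)" using l(2)[of z a x 0 x] by simp
  show "br 0 z = 0" using l(1)[of 0 0 0 0 z] by simp
  show "br z 0 = 0" using l(2)[of z 0 0 0 0] by simp
qed

lemma lie_bracket_self: "br x x = 0"
  using lie unfolding lie_algebra_def by blast

lemma lie_bracket_antisym: "br x y = - br y x"
proof -
  have "br (x + y) (x + y) = br x y + br y x" unfolding lie_bracket_lin by (simp add: lie_bracket_self)
  then show ?thesis by (simp add: lie_bracket_self eq_neg_iff_add_eq_0)
qed

end

locale lie_weighted_basis =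
  fixes scale :: "'k::field \<Rightarrow> 'l::ab_group_add \<Rightarrow> 'l" and br :: "'l \<Rightarrow> 'l \<Rightarrow> 'l"
    and eps :: "'k \<Rightarrow> 'd::division_ring" and f :: "'l \<Rightarrow> 'd"
    and B :: "'l set" and wt :: "'l \<Rightarrow> nat"
  assumes lie: "lie_algebra scale br"
    and ore: "is_ore_fraction_ring_uea scale br eps f"
    and independent: "\<not> module.dependent scale B"
    and span: "module.span scale B = UNIV"
    and wt_br: "b \<in> B \<Longrightarrow> c \<in> B \<Longrightarrow> br b c \<in> module.span scale {d \<in> B. wt d \<le> wt b + wt c}"
begin

sublocale vector_space scale
  using lie by (simp add: lie_algebra_def)

lemmas br_lin = lie_bracket_lin[OF lie] and br_self = lie_bracket_self[OF lie]
  and br_antisym = lie_bracket_antisym[OF lie]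

lemma br_jacobi: "br x (br y z) + br y (br z x) + br z (br x y) = 0"
  using lie unfolding lie_algebra_def by blast

lemma eps_map: "central_alg_map eps"
  using ore unfolding is_ore_fraction_ring_uea_def by blast

lemma eps_hom: "eps 0 = 0" "eps 1 = 1" "eps (a + b) = eps a + eps b" "eps (a * b) = eps a * eps b"
  using eps_map unfolding central_alg_map_def by blast+

lemma eps_module: "module (\<lambda>a d. eps a * d)"
  by unfold_locales (simp_all add: eps_hom distrib_left distrib_right mult.assoc)

lemma fa_eval_ideal: "c \<in> free_alg \<Longrightarrow> fa_eval eps f c = 0 \<longleftrightarrow> c \<in> uea_ideal scale br"
  using ore unfolding is_ore_fraction_ring_uea_def by blast

lemma eps_neg: "eps (- a) = - eps a"
  using eps_hom(3)[of a "- a"] eps_hom(1) by (simp add: eq_neg_iff_add_eq_0 add.commute)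

lemma f_combination: "f (scale a x + scale b y) = eps a * f x + eps b * f y"
proof -
  \<comment> \<open>The relator, with differences written as sums of scalar multiples so that the
    rules for \<open>word_sum\<close> apply.\<close>
  let ?c = "\<lambda>u. fa_word [scale a x + scale b y] u + ((- a) * fa_word [x] u + (- b) * fa_word [y] u)"
  have fa: "?c \<in> free_alg" by (intro free_alg_add free_alg_scale free_alg_word)
  have "?c = (\<lambda>u. fa_word [scale a x + scale b y] u - a * fa_word [x] u - b * fa_word [y] u)"
    by (simp add: algebra_simps)
  then have "?c \<in> uea_relations scale br" unfolding uea_relations_def by blast
  then have "?c \<in> uea_ideal scale br" unfolding uea_ideal_def by (rule fa_ideal.gen)
  then have "fa_eval eps f ?c = 0" using fa_eval_ideal[OF fa] by blast
  moreover have "fa_eval eps f ?c = f (scale a x + scale b y) + (eps (- a) * f x + eps (- b) * f y)"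
    unfolding fa_eval_word_sum
    by (simp only: word_sum_add[OF eps_module] word_sum_scale[OF eps_module] word_sum_word[OF eps_module]
        free_alg_add free_alg_scale free_alg_word) simp
  ultimately have "f (scale a x + scale b y) - (eps a * f x + eps b * f y) = 0"
    by (simp add: eps_neg algebra_simps)
  then show ?thesis by (simp only: right_minus_eq)
qed

lemma f_add: "f (x + y) = f x + f y"
  using f_combination[of 1 x 1 y] by (simp add: eps_hom)

lemma f_scale: "f (scale a x) = eps a * f x"
  using f_combination[of a x 0 x] by (simp add: eps_hom)

lemma f_br: "f (br x y) = f x * f y - f y * f x"
proof -
  let ?c = "\<lambda>u. fa_word [x, y] u + ((- 1) * fa_word [y, x] u + (- 1) * fa_word [br x y] u)"
  have fa: "?c \<in> free_alg" by (intro free_alg_add free_alg_scale free_alg_word)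
  have "?c = (\<lambda>u. fa_word [x, y] u - fa_word [y, x] u - fa_word [br x y] u)"
    by (simp add: algebra_simps)
  then have "?c \<in> uea_relations scale br" unfolding uea_relations_def by blast
  then have "?c \<in> uea_ideal scale br" unfolding uea_ideal_def by (rule fa_ideal.gen)
  then have "fa_eval eps f ?c = 0" using fa_eval_ideal[OF fa] by blast
  moreover have "fa_eval eps f ?c = f x * f y + (eps (- 1) * (f y * f x) + eps (- 1) * f (br x y))"
    unfolding fa_eval_word_sum
    by (simp only: word_sum_add[OF eps_module] word_sum_scale[OF eps_module] word_sum_word[OF eps_module]
        free_alg_add free_alg_scale free_alg_word) simp
  ultimately show ?thesis by (simp add: eps_neg eps_hom algebra_simps)
qed

definition coords :: "'l \<Rightarrow> ('l well_ordered \<Rightarrow>\<^sub>0 'k)" where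
  "coords x = Abs_poly_mapping (\<lambda>b. representation B x (un_wo b))"

lemma lookup_coords [simp]: "lookup (coords x) b = representation B x (un_wo b)"
proof -
  have "{b. representation B x (un_wo b) \<noteq> 0} \<subseteq> Wo ` {b. representation B x b \<noteq> 0}"
    by (metis (mono_tags, lifting) image_eqI mem_Collect_eq subsetI well_ordered.collapse)
  then have "finite {b. representation B x (un_wo b) \<noteq> 0}"
    by (rule finite_subset) (simp add: finite_representation)
  then show ?thesis by (simp add: coords_def)
qed

lemma keys_coords: "keys (coords x) = Wo ` {b. representation B x b \<noteq> 0}"
  by (auto simp: in_keys_iff image_iff) (metis well_ordered.collapse)

lemma keys_coords_basis: "b \<in> keys (coords x) \<Longrightarrow> un_wo b \<in> B"
  by (auto simp: in_keys_iff dest: representation_ne_zero)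

lemma coords_add: "coords (x + y) = coords x + coords y"
  by (rule poly_mapping_eqI) (simp add: lookup_add representation_add independent span)

lemma coords_scale: "coords (scale a x) = pscale a (coords x)"
  by (rule poly_mapping_eqI) (simp add: representation_scale independent span)

lemma coords_uminus: "coords (- x) = - coords x"
proof -
  have "coords 0 = 0" using coords_add[of 0 0] by simp
  then have "coords (- x) + coords x = 0" using coords_add[of "- x" x] by simp
  then show ?thesis by (simp add: eq_neg_iff_add_eq_0)
qed

lemma coords_basis: "b \<in> B \<Longrightarrow> coords b = single (Wo b) 1"
  by (rule poly_mapping_eqI)
     (auto simp: representation_basis independent lookup_single when_def)

lemma coords_expand:
  assumes mod: "module scl" and add: "\<And>x y. h (x + y) = h x + h y"
    and sc: "\<And>a x. h (scale a x) = scl a (h x)"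
  shows "h x = lin_ext scl (\<lambda>b. if un_wo b \<in> B then h (un_wo b) else 0) (coords x)"
proof -
  have h0: "h 0 = 0" using add[of 0 0] by simp
  have hs: "h (sum g A) = (\<Sum>a\<in>A. h (g a))" for g and A :: "'l set"
    by (induction A rule: infinite_finite_induct) (simp_all add: h0 add)
  have "h x = h (\<Sum>b | representation B x b \<noteq> 0. scale (representation B x b) b)"
    by (subst sum_nonzero_representation_eq) (simp_all add: independent span)
  also have "\<dots> = (\<Sum>b | representation B x b \<noteq> 0. scl (representation B x b) (h b))"
    by (simp add: hs sc)
  also have "\<dots> = lin_ext scl (\<lambda>b. if un_wo b \<in> B then h (un_wo b) else 0) (coords x)"
    unfolding lin_ext_def keys_coords
    by (subst sum.reindex) (auto simp: inj_on_def intro!: sum.cong dest: representation_ne_zero)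
  finally show ?thesis .
qed

lemma linear_eq_on_basis:
  assumes mod: "module scl"
    and "\<And>x y. h (x + y) = h x + h y" "\<And>a x. h (scale a x) = scl a (h x)"
    and "\<And>x y. g (x + y) = g x + g y" "\<And>a x. g (scale a x) = scl a (g x)"
    and "\<And>b. b \<in> B \<Longrightarrow> h b = g b"
  shows "h x = g x"
  using coords_expand[of scl h x] coords_expand[of scl g x] assms by (simp cong: if_cong)

text \<open>Indices outside the basis are made central, so that all structure constants are total.\<close>

definition bracket_consts :: "'l well_ordered \<Rightarrow> 'l well_ordered \<Rightarrow> ('l well_ordered \<Rightarrow>\<^sub>0 'k)" where
  "bracket_consts b c = (if un_wo b \<in> B \<and> un_wo c \<in> B then coords (br (un_wo b) (un_wo c)) else 0)"

lemma lin_ext_bracket_consts: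
  assumes "un_wo a \<in> B"
  shows "lin_ext pscale (bracket_consts a) (coords x) = coords (br (un_wo a) x)"
proof -
  have "coords (br (un_wo a) x)
    = lin_ext pscale (\<lambda>b. if un_wo b \<in> B then coords (br (un_wo a) (un_wo b)) else 0) (coords x)"
    by (rule coords_expand[OF pm_module, of "\<lambda>x. coords (br (un_wo a) x)"])
       (simp_all add: br_lin coords_add coords_scale)
  then show ?thesis using assms by (simp add: bracket_consts_def[abs_def] cong: if_cong)
qed

definition realise :: "'l well_ordered \<Rightarrow> 'd" where
  "realise b = (if un_wo b \<in> B then f (un_wo b) else 0)"

lemma lin_ext_realise: "lin_ext (\<lambda>a d. eps a * d) realise (coords x) = f x"
  unfolding realise_def[abs_def]
  by (rule coords_expand[OF eps_module, symmetric]) (simp_all add: f_add f_scale)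

lemma coords_span:
  assumes "x \<in> module.span scale {d \<in> B. P d}" "b \<in> keys (coords x)"
  shows "P (un_wo b)"
proof -
  have "representation {d \<in> B. P d} x = representation B x"
    using representation_extend[of B x "{d \<in> B. P d}"] assms(1) independent by auto
  then have "representation {d \<in> B. P d} x (un_wo b) \<noteq> 0"
    using assms(2) by (simp add: in_keys_iff)
  then show ?thesis using representation_ne_zero by blast
qed

sublocale pbw_realisation bracket_consts "\<lambda>b. wt (un_wo b)" "{b. un_wo b \<in> B}" eps realise
proof unfold_locales
  fix a b c d :: "'l well_ordered"
  show "bracket_consts b c = - bracket_consts c b"
    using br_antisym[of "un_wo b" "un_wo c"] by (simp add: bracket_consts_def coords_uminus)
  show "bracket_consts b b = 0"
    using coords_add[of 0 0] by (simp add: bracket_consts_def br_self)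
  show "lin_ext pscale (bracket_consts a) (bracket_consts b c) +
       lin_ext pscale (bracket_consts b) (bracket_consts c a) +
       lin_ext pscale (bracket_consts c) (bracket_consts a b) = 0"
  proof (cases "un_wo a \<in> B \<and> un_wo b \<in> B \<and> un_wo c \<in> B")
    case True
    let ?a = "un_wo a" and ?b = "un_wo b" and ?c = "un_wo c"
    have "coords (br ?a (br ?b ?c) + br ?b (br ?c ?a) + br ?c (br ?a ?b)) = 0"
      using coords_add[of 0 0] by (simp add: br_jacobi)
    then show ?thesis using True
      by (simp add: bracket_consts_def[of b c] bracket_consts_def[of c a] bracket_consts_def[of a b]
          lin_ext_bracket_consts coords_add)
  next
    case False
    have "lin_ext pscale (bracket_consts d) x = 0" if "un_wo d \<notin> B" for d x
      using that by (simp add: lin_ext_def bracket_consts_def)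
    then show ?thesis using False by (auto simp: bracket_consts_def pm_lin)
  qed
  assume d: "d \<in> keys (bracket_consts b c)"
  then have bc: "un_wo b \<in> B" "un_wo c \<in> B" "d \<in> keys (coords (br (un_wo b) (un_wo c)))"
    by (auto simp: bracket_consts_def split: if_splits)
  show "wt (un_wo d) \<le> wt (un_wo b) + wt (un_wo c)"
    using coords_span[OF wt_br[OF bc(1,2)] bc(3)] .
  show "d \<in> {b. un_wo b \<in> B}" using keys_coords_basis[OF bc(3)] by simp
next
  show "central_alg_map eps" by (rule eps_map)
next
  fix b c
  show "realise b * realise c - realise c * realise b = lin_ext (\<lambda>a d. eps a * d) realise (bracket_consts b c)"
    by (auto simp: bracket_consts_def lin_ext_realise f_br realise_def lin_ext_zero[OF eps_module])
qed

section \<open>The action of \<open>U(L)\<close> on ordered monomials and the Poincare-Birkhoff-Witt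
  theorem\<close>

definition word_act :: "'l list \<Rightarrow> ('l well_ordered multiset \<Rightarrow>\<^sub>0 'k) \<Rightarrow> ('l well_ordered multiset \<Rightarrow>\<^sub>0 'k)" where
  "word_act ws m = foldr (\<lambda>x. lact (coords x)) ws m"

lemma lact_commutator:
  "lact (coords x) (lact (coords y) m) - lact (coords y) (lact (coords x) m) = lact (coords (br x y)) m"
proof (rule linear_eq_on_basis[OF pm_module,
      where h = "\<lambda>x. lact (coords x) (lact (coords y) m) - lact (coords y) (lact (coords x) m)"])
  fix b assume b: "b \<in> B"
  show "lact (coords b) (lact (coords y) m) - lact (coords y) (lact (coords b) m) = lact (coords (br b y)) m"
  proof (rule linear_eq_on_basis[OF pm_module,
      where h = "\<lambda>y. lact (coords b) (lact (coords y) m) - lact (coords y) (lact (coords b) m)"])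
    fix c assume "c \<in> B"
    then show "lact (coords b) (lact (coords c) m) - lact (coords c) (lact (coords b) m) = lact (coords (br b c)) m"
      using b act_commutator[of "Wo b" "Wo c" m]
      by (simp add: coords_basis pbw_lact_lin_left bracket_consts_def)
  qed (simp_all add: coords_add coords_scale br_lin pbw_lact_lin_left pbw_lact_lin_right
      pm.scale_right_diff_distrib)
qed (simp_all add: coords_add coords_scale br_lin pbw_lact_lin_left pbw_lact_lin_right
      pm.scale_right_diff_distrib)

lemma word_act_sum: "word_act w (\<Sum>i\<in>I. pscale (a i) (m i)) = (\<Sum>i\<in>I. pscale (a i) (word_act w (m i)))"
proof (induction w)
  case Nil
  then show ?case by (simp add: word_act_def)
next
  case (Cons x w)
  have "lact (coords x) (\<Sum>i\<in>I. pscale (a i) (n i)) = (\<Sum>i\<in>I. pscale (a i) (lact (coords x) (n i)))" for n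
    by (induction I rule: infinite_finite_induct) (simp_all add: pbw_lact_lin_right)
  then show ?case using Cons by (simp add: word_act_def)
qed

text \<open>All \<open>m\<close> are treated at once, because a right multiple by \<open>w\<close>
  acts on \<open>m\<close> as the original element acts on \<open>word_act w m\<close>. Finite
  support is carried along since the rules for \<open>word_sum\<close> require it.\<close>

lemma uea_ideal_word_act:
  assumes "c \<in> uea_ideal scale br"
  shows "c \<in> free_alg \<and> (\<forall>m. word_sum pscale (\<lambda>w. word_act w m) c = 0)"
  using assms unfolding uea_ideal_def
proof (induction rule: fa_ideal.induct)
  case (gen g)
  then consider a b x y where "g = (\<lambda>u. fa_word [scale a x + scale b y] u + ((- a) * fa_word [x] u + (- b) * fa_word [y] u))"
    | x y where "g = (\<lambda>u. fa_word [x, y] u + ((- 1) * fa_word [y, x] u + (- 1) * fa_word [br x y] u))"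
    unfolding uea_relations_def by (auto simp: algebra_simps)
  then show ?case
  proof cases
    case 1
    show ?thesis unfolding 1
      by (simp only: word_sum_add[OF pm_module] word_sum_scale[OF pm_module]
          word_sum_word[OF pm_module] free_alg_add free_alg_scale free_alg_word)
         (simp add: word_act_def coords_add coords_scale pbw_lact_lin_left)
  next
    case 2
    show ?thesis unfolding 2
      using lact_commutator[of x y]
      by (simp only: word_sum_add[OF pm_module] word_sum_scale[OF pm_module]
          word_sum_word[OF pm_module] free_alg_add free_alg_scale free_alg_word)
         (simp add: word_act_def algebra_simps)
  qed
next
  case zero
  then show ?case by (simp add: free_alg_def word_sum_def)
next
  case (add p q)
  then show ?case by (simp add: free_alg_add word_sum_add[OF pm_module])
next
  case (smult p a)
  then show ?case by (simp add: free_alg_scale word_sum_scale[OF pm_module])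
next
  case (lmul p w)
  have "word_sum pscale (\<lambda>u. word_act u m) (fa_lmul w p) = word_act w (word_sum pscale (\<lambda>u. word_act u m) p)" for m
    unfolding word_sum_def supp_fa_lmul word_act_sum
    by (subst sum.reindex) (auto simp: inj_on_def fa_lmul_def word_act_def)
  moreover have "word_act w 0 = 0" using word_act_sum[of w _ _ "{}"] by simp
  ultimately show ?case using lmul by (simp add: free_alg_def supp_fa_lmul)
next
  case (rmul p w)
  have "word_sum pscale (\<lambda>u. word_act u m) (fa_rmul p w) = word_sum pscale (\<lambda>u. word_act u (word_act w m)) p" for m
    unfolding word_sum_def supp_fa_rmul
    by (subst sum.reindex) (auto simp: inj_on_def fa_rmul_def word_act_def)
  then show ?case using rmul by (simp add: free_alg_def supp_fa_rmul)
qed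

text \<open>If \<open>psi m\<close> vanishes, then \<open>m\<close>, read as a combination of sorted
  words, lies in the defining ideal and acts as zero; yet its effect on the empty monomial is
  \<open>m\<close> itself.\<close>

lemma psi_injective:
  assumes ob: "over_basis m" and "psi m = 0"
  shows "m = 0"
proof -
  let ?h = "\<lambda>M :: 'l well_ordered multiset. map un_wo (sorted_list_of_multiset M)"
  define c where "c w = (if sorted (map Wo w) then lookup m (mset (map Wo w)) else 0)" for w
  have map_id: "map (Wo \<circ> un_wo) xs = xs" for xs :: "'l well_ordered list"
    by (simp add: map_idI)
  have c_h: "c (?h M) = lookup m M" for M
    by (simp add: c_def map_id)
  have inj: "inj_on ?h A" for A
    by (rule inj_on_inverseI[where g = "\<lambda>w. mset (map Wo w)"]) (simp add: map_id flip: mset_map)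
  have supp: "{w. c w \<noteq> 0} = ?h ` keys m"
  proof (intro set_eqI iffI)
    fix w assume "w \<in> {w. c w \<noteq> 0}"
    then have w: "sorted (map Wo w)" "mset (map Wo w) \<in> keys m"
      by (auto simp: c_def in_keys_iff split: if_splits)
    have "?h (mset (map Wo w)) = w"
      using w(1) by (simp add: sorted_sort_id o_def flip: mset_map)
    then show "w \<in> ?h ` keys m" using w(2) by (metis image_eqI)
  next
    fix w assume "w \<in> ?h ` keys m"
    then show "w \<in> {w. c w \<noteq> 0}" using c_h by (auto simp: in_keys_iff)
  qed
  have fa: "c \<in> free_alg" by (simp add: free_alg_def supp)
  have basis: "un_wo b \<in> B" if "M \<in> keys m" "b \<in># M" for M b
    using ob that by (auto simp: over_basis_def)
  have "fa_eval eps f c = (\<Sum>M\<in>keys m. eps (lookup m M) * prod_list (map f (?h M)))"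
    unfolding fa_eval_def supp by (subst sum.reindex[OF inj]) (simp add: c_h)
  also have "\<dots> = psi m"
    unfolding psi_def lin_ext_def
    by (intro sum.cong refl arg_cong2[where f = "(*)"] arg_cong[where f = prod_list])
       (auto simp: realise_def basis)
  finally have "fa_eval eps f c = 0" using assms(2) by simp
  then have "c \<in> uea_ideal scale br" using fa_eval_ideal[OF fa] by blast
  from uea_ideal_word_act[OF this] have "word_sum pscale (\<lambda>w. word_act w (single {#} 1)) c = 0" by blast
  moreover have "word_sum pscale (\<lambda>w. word_act w (single {#} 1)) c
    = (\<Sum>M\<in>keys m. pscale (lookup m M) (word_act (?h M) (single {#} 1)))"
    unfolding word_sum_def supp by (subst sum.reindex[OF inj]) (simp add: c_h)
  moreover have "word_act (?h M) (single {#} 1) = single M 1" if "M \<in> keys m" for M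
  proof -
    have "word_act (map un_wo bs) n = foldr act bs n" if "\<forall>b\<in>set bs. un_wo b \<in> B" for bs n
      using that by (induction bs) (auto simp: word_act_def coords_basis pbw_lact_lin_left)
    then have "word_act (?h M) (single {#} 1) = foldr act (sorted_list_of_multiset M) (single {#} 1)"
      using basis[OF that] by simp
    then show ?thesis by (simp add: foldr_act_sorted)
  qed
  ultimately have "lin_ext pscale (\<lambda>M. single M 1) m = 0" by (simp add: lin_ext_def)
  then show ?thesis by (simp add: lin_ext_single_id)
qed

lemma over_basis_lact: "over_basis m \<Longrightarrow> over_basis (lact (coords x) m)"
  unfolding pbw_lact_def
  by (intro over_basis_lin_ext over_basis_act) (auto dest: keys_coords_basis)

lemma over_basis_word_act: "over_basis m \<Longrightarrow> over_basis (word_act w m)"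
  unfolding word_act_def by (induction w) (simp_all add: over_basis_lact)

lemma psi_word_act: "psi (word_act w m) = prod_list (map f w) * psi m"
  by (induction w) (simp_all add: word_act_def psi_lact lin_ext_realise mult.assoc)

lemma psi_one: "psi (single {#} 1) = 1"
  by (simp add: psi_single)

lemma over_basis_one: "over_basis (single {#} 1)"
  by (simp add: over_basis_def)

lemma over_basis_uminus: "over_basis m \<Longrightarrow> over_basis (- m)"
  by (simp add: over_basis_def in_keys_iff)

lemma fa_eval_in_range:
  assumes "c \<in> free_alg"
  shows "\<exists>m. over_basis m \<and> fa_eval eps f c = psi m"
proof (intro exI conjI)
  let ?m = "word_sum pscale (\<lambda>w. word_act w (single {#} 1)) c"
  have "over_basis (\<Sum>w\<in>A. pscale (c w) (word_act w (single {#} 1)))" for A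
  proof (induction A rule: infinite_finite_induct)
    case (insert w A)
    have "over_basis (pscale (c w) (word_act w (single {#} 1)))"
      using over_basis_word_act[OF over_basis_one, of w] keys_pscale by (fastforce simp: over_basis_def)
    then show ?case using insert by (simp add: over_basis_add)
  qed (simp_all add: over_basis_def)
  then show "over_basis ?m" by (simp add: word_sum_def)
  have "psi (\<Sum>w\<in>A. pscale (c w) (word_act w (single {#} 1))) = (\<Sum>w\<in>A. eps (c w) * prod_list (map f w))" for A
    by (induction A rule: infinite_finite_induct) (simp_all add: psi_lin psi_word_act psi_one)
  then show "fa_eval eps f c = psi ?m" by (simp add: word_sum_def fa_eval_def)
qed

text \<open>Take for \<open>U\<close> the image of the enveloping algebra. Each of its elements is
  \<open>psi m\<close> for exactly one \<open>m\<close> over the basis, and the degree of that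
  \<open>m\<close> is transported.\<close>

theorem uea_degree_exists:
  "\<exists>U dg. (\<forall>c\<in>free_alg. fa_eval eps f c \<in> U) \<and> 1 \<in> U \<and> (\<forall>a\<in>U. \<forall>b\<in>U. a + b \<in> U \<and> a * b \<in> U)
    \<and> (\<forall>a\<in>U. \<forall>b\<in>U. a \<noteq> 0 \<longrightarrow> b \<noteq> 0 \<longrightarrow> dg (a * b) = dg a + (dg b :: nat))
    \<and> (\<forall>a\<in>U. \<forall>b\<in>U. a + b \<noteq> 0 \<longrightarrow> a \<noteq> 0 \<longrightarrow> b \<noteq> 0 \<longrightarrow> dg (a + b) \<le> max (dg a) (dg b))
    \<and> (\<forall>b\<in>B. f b \<noteq> 0 \<and> dg (f b) = wt b)
    \<and> (\<forall>x n. f x \<noteq> 0 \<longrightarrow> x \<in> module.span scale {b \<in> B. wt b \<le> n} \<longrightarrow> dg (f x) \<le> n)"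
proof -
  define U where "U = psi ` {m. over_basis m}"
  define dg where "dg d = pbw_degree (SOME m. over_basis m \<and> psi m = d)" for d
  have inj: "m = n" if "over_basis m" "over_basis n" "psi m = psi n" for m n
    using psi_injective[OF over_basis_add[OF that(1) over_basis_uminus[OF that(2)]]] that(3)
    by (simp add: psi_lin)
  have dg: "dg (psi m) = pbw_degree m" if "over_basis m" for m
  proof -
    have "(SOME n. over_basis n \<and> psi n = psi m) = m"
      by (rule some_equality) (use that inj in auto)
    then show ?thesis by (simp add: dg_def)
  qed
  have nz: "m \<noteq> 0" if "psi m \<noteq> 0" for m using that psi_lin(1) by metis
  have fx: "over_basis (lin_ext pscale (\<lambda>b. single {#b#} 1) (coords x))"
    "f x = psi (lin_ext pscale (\<lambda>b. single {#b#} 1) (coords x))" for x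
  proof -
    have *: "lin_ext pscale (\<lambda>b. single {#b#} 1) (coords x) = lact (coords x) (single {#} 1)"
      by (simp add: pbw_lact_def pbw_act_le)
    show "over_basis (lin_ext pscale (\<lambda>b. single {#b#} 1) (coords x))"
      unfolding * by (rule over_basis_lact[OF over_basis_one])
    show "f x = psi (lin_ext pscale (\<lambda>b. single {#b#} 1) (coords x))"
      unfolding * psi_lact by (simp add: lin_ext_realise psi_one)
  qed
  show ?thesis
  proof (rule exI[of _ U], rule exI[of _ dg], intro conjI ballI impI allI)
    show "fa_eval eps f c \<in> U" if "c \<in> free_alg" for c
      using fa_eval_in_range[OF that] by (auto simp: U_def)
    show "1 \<in> U" unfolding U_def using psi_one over_basis_one by (metis image_eqI mem_Collect_eq)
    fix a assume "a \<in> U"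
    then obtain m where m: "over_basis m" "a = psi m" by (auto simp: U_def)
    fix b assume "b \<in> U"
    then obtain n where n: "over_basis n" "b = psi n" by (auto simp: U_def)
    show "a + b \<in> U" unfolding U_def m(2) n(2) psi_lin(2)[symmetric] using m(1) n(1) by (simp add: over_basis_add)
    show "a * b \<in> U" unfolding U_def m(2) n(2) psi_mult[symmetric] using m(1) n(1) by (simp add: over_basis_mult)
    show "dg (a * b) = dg a + dg b" if "a \<noteq> 0" "b \<noteq> 0"
      using that m n by (simp add: dg over_basis_mult pbw_degree_mult nz flip: psi_mult)
    show "dg (a + b) \<le> max (dg a) (dg b)" if "a + b \<noteq> 0"
      using that m n pbw_degree_add[of m n] nz[of "m + n"] dg[of m] dg[of n] dg[of "m + n"]
      by (simp add: over_basis_add psi_lin)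
  next
    fix b assume b: "b \<in> B"
    have "lin_ext pscale (\<lambda>b. single {#b#} 1) (coords b) = single {#Wo b#} 1"
      using b by (simp add: coords_basis pm_lin)
    then have e: "over_basis (single {#Wo b#} 1)" "f b = psi (single {#Wo b#} 1)" using fx[of b] by auto
    have "single {#Wo b#} (1::'k) \<noteq> 0" by (metis lookup_single_eq lookup_zero one_neq_zero)
    then show "f b \<noteq> 0" using psi_injective[OF e(1)] e(2) by auto
    show "dg (f b) = wt b" unfolding e(2) dg[OF e(1)] by (simp add: pbw_degree_def)
  next
    fix x n assume x: "f x \<noteq> 0" "x \<in> module.span scale {b \<in> B. wt b \<le> n}"
    let ?m = "lin_ext pscale (\<lambda>b. single {#b#} 1) (coords x)"
    have ne: "?m \<noteq> 0" using nz[of ?m] fx[of x] x(1) by simp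
    have "weight P \<le> n" if "P \<in> keys ?m" for P
      using that by (rule keys_lin_extE) (use coords_span[OF x(2)] in auto)
    moreover have "keys ?m \<noteq> {}" using ne by (auto simp: in_keys_iff intro!: poly_mapping_eqI)
    ultimately have "pbw_degree ?m \<le> n" unfolding pbw_degree_def by (intro Max.boundedI) auto
    then show "dg (f x) \<le> n" using fx[of x] dg by metis
  qed
qed

end

section \<open>Freeness modulo the maximal ideal of a local subring\<close>

text \<open>\<open>M\<close> is a two-sided ideal of \<open>R\<close> whose complement consists of
  units, so \<open>R / M\<close> is a division ring. The quotient is not formed: its equality
  becomes the congruence \<open>cong\<close>, and all arithmetic stays in the ambient division
  ring.\<close>

locale residue_ring =
  fixes R M :: "'d::division_ring set"
  assumes one_R: "1 \<in> R" and add_R: "x \<in> R \<Longrightarrow> y \<in> R \<Longrightarrow> x + y \<in> R"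
    and minus_R: "x \<in> R \<Longrightarrow> - x \<in> R" and mult_R: "x \<in> R \<Longrightarrow> y \<in> R \<Longrightarrow> x * y \<in> R"
    and M_R: "M \<subseteq> R" and add_M: "x \<in> M \<Longrightarrow> y \<in> M \<Longrightarrow> x + y \<in> M"
    and mult_RM: "x \<in> R \<Longrightarrow> y \<in> M \<Longrightarrow> x * y \<in> M" and mult_MR: "x \<in> M \<Longrightarrow> y \<in> R \<Longrightarrow> x * y \<in> M"
    and zero_M: "0 \<in> M" and one_M: "1 \<notin> M" and inverse_R: "x \<in> R \<Longrightarrow> x \<notin> M \<Longrightarrow> inverse x \<in> R"
begin

lemma zero_R: "0 \<in> R"
  using zero_M M_R by blast

lemma minus_M: "x \<in> M \<Longrightarrow> - x \<in> M"
  using mult_RM[OF minus_R[OF one_R]] by force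

lemma diff_R: "x \<in> R \<Longrightarrow> y \<in> R \<Longrightarrow> x - y \<in> R"
  using add_R[of x "- y"] minus_R by simp

lemma diff_M: "x \<in> M \<Longrightarrow> y \<in> M \<Longrightarrow> x - y \<in> M"
  using add_M[of x "- y"] minus_M by simp

lemma mult_notin_M: "x \<in> R \<Longrightarrow> y \<in> R \<Longrightarrow> x \<notin> M \<Longrightarrow> y \<notin> M \<Longrightarrow> x * y \<notin> M"
proof
  assume x: "x \<in> R" "x \<notin> M" and y: "y \<in> R" "y \<notin> M" and xy: "x * y \<in> M"
  have "inverse x * (x * y) \<in> M" using mult_RM[OF inverse_R[OF x] xy] .
  moreover have "x \<noteq> 0" using x(2) zero_M by auto
  ultimately show False using y(2) by (simp flip: mult.assoc)
qed

lemma power_R: "x \<in> R \<Longrightarrow> x ^ n \<in> R"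
  by (induction n) (auto simp: one_R mult_R)

lemma power_notin_M: "x \<in> R \<Longrightarrow> x \<notin> M \<Longrightarrow> x ^ n \<notin> M"
  by (induction n) (auto simp: one_M mult_notin_M power_R)

definition cong :: "'d \<Rightarrow> 'd \<Rightarrow> bool" (infix "\<approx>" 50) where
  "x \<approx> y \<longleftrightarrow> x - y \<in> M"

lemma cong_refl [simp]: "x \<approx> x"
  by (simp add: cong_def zero_M)

lemma cong_sym: "x \<approx> y \<Longrightarrow> y \<approx> x"
  using minus_M by (fastforce simp: cong_def)

lemma cong_trans [trans]: "x \<approx> y \<Longrightarrow> y \<approx> w \<Longrightarrow> x \<approx> w"
  using add_M by (fastforce simp: cong_def)

lemma cong_add: "x \<approx> y \<Longrightarrow> x' \<approx> y' \<Longrightarrow> x + x' \<approx> y + y'"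
  using add_M[of "x - y" "x' - y'"] by (simp add: cong_def algebra_simps)

lemma cong_diff: "x \<approx> y \<Longrightarrow> x' \<approx> y' \<Longrightarrow> x - x' \<approx> y - y'"
  using diff_M[of "x - y" "x' - y'"] by (simp add: cong_def algebra_simps)

lemma cong_mult_left: "a \<in> R \<Longrightarrow> x \<approx> y \<Longrightarrow> a * x \<approx> a * y"
  using mult_RM[of a "x - y"] by (simp add: cong_def algebra_simps)

lemma cong_mult_right: "a \<in> R \<Longrightarrow> x \<approx> y \<Longrightarrow> x * a \<approx> y * a"
  using mult_MR[of "x - y" a] by (simp add: cong_def algebra_simps)

lemma cong_mult: "x \<approx> y \<Longrightarrow> x' \<approx> y' \<Longrightarrow> x' \<in> R \<Longrightarrow> y \<in> R \<Longrightarrow> x * x' \<approx> y * y'"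
  using cong_mult_left cong_mult_right cong_trans by blast

lemma cong_sum: "(\<And>i. i \<in> I \<Longrightarrow> h i \<approx> g i) \<Longrightarrow> sum h I \<approx> sum g I"
  by (induction I rule: infinite_finite_induct) (auto intro: cong_add)

lemma cong_M: "x \<approx> y \<Longrightarrow> x \<in> M \<longleftrightarrow> y \<in> M"
  using add_M[of "x - y" y] diff_M[of x "x - y"] by (auto simp: cong_def)

lemma cong_0: "x \<approx> 0 \<longleftrightarrow> x \<in> M"
  by (simp add: cong_def)

lemma cong_R: "x \<approx> y \<Longrightarrow> x \<in> R \<longleftrightarrow> y \<in> R"
  using add_R[of "x - y" y] diff_R[of x "x - y"] M_R by (auto simp: cong_def)

end

text \<open>The pole condition expresses that no nonzero combination of the powers of \<open>s\<close>
  is a difference \<open>\<sigma> g \<mp> g\<close>.\<close>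

locale skew_residue = residue_ring R M
  for R M :: "'d::division_ring set" +
  fixes ev :: "'K::field \<Rightarrow> 'd" and \<sigma> :: "'K \<Rightarrow> 'K" and con :: "'k::field \<Rightarrow> 'K"
    and z :: 'd and s t :: 'K
  assumes char0: "n > 0 \<Longrightarrow> of_nat n \<noteq> (0 :: 'K)"
    and ev_1: "ev 1 = 1" and ev_add: "ev (a + b) = ev a + ev b" and ev_mult: "ev (a * b) = ev a * ev b"
    and ev_R: "ev a \<in> R"
    and \<sigma>_1: "\<sigma> 1 = 1" and \<sigma>_add: "\<sigma> (a + b) = \<sigma> a + \<sigma> b" and \<sigma>_mult: "\<sigma> (a * b) = \<sigma> a * \<sigma> b"
    and \<sigma>_con: "\<sigma> (con k) = con k" and \<sigma>_t: "\<sigma> t = t + 2"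
    and con_0: "con 0 = 0"
    and fixed: "\<sigma> a = a \<Longrightarrow> \<exists>k. a = con k" and antifixed: "\<sigma> a = - a \<Longrightarrow> a = 0"
    and poles: "finite I \<Longrightarrow> l = 1 \<or> l = - 1 \<Longrightarrow>
      \<sigma> a - l * a = (\<Sum>i\<in>I. con (c i) * s ^ Suc i) \<Longrightarrow> i \<in> I \<Longrightarrow> c i = 0"
    and z_R: "z \<in> R" and z_M: "z \<notin> M"
    and z_ev: "z * ev a - ev (\<sigma> a) * z \<in> M"
begin

lemma ev_0: "ev 0 = 0"
  using ev_add[of 0 0] by simp

lemma ev_minus: "ev (- a) = - ev a"
  using ev_add[of a "- a"] by (simp add: ev_0 eq_neg_iff_add_eq_0 add.commute)

lemma ev_diff: "ev (a - b) = ev a - ev b"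
  using ev_add[of a "- b"] by (simp add: ev_minus)

lemma ev_sum: "ev (sum h I) = (\<Sum>i\<in>I. ev (h i))"
  by (induction I rule: infinite_finite_induct) (auto simp: ev_0 ev_add)

lemma \<sigma>_0: "\<sigma> 0 = 0"
  using \<sigma>_add[of 0 0] by (metis add_0_left add_cancel_left_left)

lemma \<sigma>_eq_0: "\<sigma> a = 0 \<longleftrightarrow> a = 0"
proof
  assume "\<sigma> a = 0"
  then have "\<sigma> (a * inverse a) = 0" by (simp add: \<sigma>_mult)
  then show "a = 0" using \<sigma>_1 by (cases "a = 0") auto
qed (simp add: \<sigma>_0)

lemma \<sigma>_minus: "\<sigma> (- a) = - \<sigma> a"
  using \<sigma>_add[of a "- a"] by (simp add: \<sigma>_0 eq_neg_iff_add_eq_0 add.commute)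

lemma ev_notin_M: "a \<noteq> 0 \<Longrightarrow> ev a \<notin> M"
proof
  assume "a \<noteq> 0" "ev a \<in> M"
  then have "ev (inverse a * a) \<in> M" unfolding ev_mult by (intro mult_RM ev_R)
  then show False using \<open>a \<noteq> 0\<close> one_M by (simp add: ev_1)
qed

lemma z_ev_cong: "z * ev a \<approx> ev (\<sigma> a) * z"
  using z_ev by (simp add: cong_def)

text \<open>If \<open>z\<close> were congruent to 1 or -1, it would commute with \<open>ev t\<close>
  modulo \<open>M\<close>, whereas \<open>\<sigma>\<close> moves \<open>t\<close> by 2.\<close>

lemma z_notin: "1 + z \<notin> M" "1 - z \<notin> M"
proof -
  have *: "\<not> z \<approx> ev e" if e: "\<sigma> e = e" "e \<noteq> 0" for e
  proof
    assume z: "z \<approx> ev e"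
    have "ev e * ev t \<approx> z * ev t" by (rule cong_mult_right[OF ev_R cong_sym[OF z]])
    also have "\<dots> \<approx> ev (\<sigma> t) * z" by (rule z_ev_cong)
    also have "\<dots> \<approx> ev (\<sigma> t) * ev e" by (rule cong_mult_left[OF ev_R z])
    finally have "ev (e * t - \<sigma> t * e) \<in> M" by (simp add: cong_def ev_diff ev_mult)
    then have "e * t - \<sigma> t * e = 0" using ev_notin_M by blast
    then have "2 * e = 0" by (simp add: \<sigma>_t algebra_simps)
    then show False using char0[of 2] e(2) by simp
  qed
  show "1 + z \<notin> M"
    using *[of "- 1"] by (simp add: \<sigma>_minus \<sigma>_1 ev_minus ev_1 cong_def add.commute)
  have "z - 1 \<notin> M" using *[of 1] by (simp add: \<sigma>_1 ev_1 cong_def)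
  then show "1 - z \<notin> M" using minus_M[of "1 - z"] by auto
qed

section \<open>Words in resolvents and powers of \<open>s\<close>\<close>

definition resolvent :: "bool \<Rightarrow> 'd" where
  "resolvent b = (if b then inverse (1 + z) else inverse (1 - z))"

definition sign :: "bool \<Rightarrow> 'K" where
  "sign b = (if b then 1 else - 1)"

lemma sign_simps: "sign b * sign b = 1" "\<sigma> (sign b) = sign b" "sign b \<noteq> 0"
  by (auto simp: sign_def \<sigma>_1 \<sigma>_minus)

lemma resolvent_R: "resolvent b \<in> R"
  unfolding resolvent_def using inverse_R z_notin z_R one_R add_R diff_R by auto

text \<open>Equivalently, left multiplication by \<open>z + ev (sign b)\<close> replaces the
  resolvent by the scalar \<open>ev (sign b)\<close>. This is how a word loses its first
  letter.\<close>

lemma z_resolvent: "z * resolvent b = ev (sign b) * (1 - resolvent b)"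
proof -
  have "1 + z \<noteq> 0" "1 - z \<noteq> 0" using z_notin zero_M by auto
  then have "(1 + z) * inverse (1 + z) = 1" "(1 - z) * inverse (1 - z) = 1" by simp_all
  then show ?thesis
    by (auto simp: resolvent_def sign_def ev_1 ev_minus algebra_simps)
qed

text \<open>A letter \<open>(b, i)\<close> carries the power \<open>i + 1\<close>: after
  cancellation in a product of \<open>S\<close> and \<open>T\<close>, two conjugating factors are
  always separated by at least one \<open>s\<close>.\<close>

primrec word_val :: "(bool \<times> nat) list \<Rightarrow> 'd" where
  "word_val [] = 1"
| "word_val (a # w) = resolvent (fst a) * ev (s ^ Suc (snd a)) * word_val w"

lemma word_val_R: "word_val w \<in> R"
  by (induction w) (simp_all add: one_R mult_R resolvent_R ev_R del: power_Suc)

lemma z_word_val: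
  "z * word_val (a # w) = ev (sign (fst a)) * (ev (s ^ Suc (snd a)) * word_val w - word_val (a # w))"
  by (simp add: mult.assoc[symmetric] z_resolvent del: power_Suc) (simp add: algebra_simps)

abbreviation comb :: "(bool \<times> nat) list set \<Rightarrow> ((bool \<times> nat) list \<Rightarrow> 'K) \<Rightarrow> 'd" where
  "comb A a \<equiv> \<Sum>w\<in>A. ev (a w) * word_val w"

text \<open>A left span modulo \<open>M\<close> over the field \<open>ev\<close> embeds. Powers of
  \<open>z\<close> are included because repeated multiplication by \<open>z\<close> turns a
  resolvent first into scalars and then into polynomials in \<open>z\<close>; with them the span is
  closed under \<open>z\<close>.\<close>

inductive_set short_span :: "nat \<Rightarrow> 'd set" for L :: nat where
  ideal: "x \<in> M \<Longrightarrow> x \<in> short_span L"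
| power: "z ^ n \<in> short_span L"
| word: "0 < length w \<Longrightarrow> length w \<le> L \<Longrightarrow> word_val w \<in> short_span L"
| add: "x \<in> short_span L \<Longrightarrow> y \<in> short_span L \<Longrightarrow> x + y \<in> short_span L"
| scale: "x \<in> short_span L \<Longrightarrow> ev a * x \<in> short_span L"

lemma short_span_R: "x \<in> short_span L \<Longrightarrow> x \<in> R"
  by (induction rule: short_span.induct) (use M_R in \<open>auto simp: power_R z_R word_val_R add_R mult_R ev_R\<close>)

lemma short_span_minus: "x \<in> short_span L \<Longrightarrow> - x \<in> short_span L"
  using short_span.scale[of x L "- 1"] by (simp add: ev_minus ev_1)

lemma short_span_diff: "x \<in> short_span L \<Longrightarrow> y \<in> short_span L \<Longrightarrow> x - y \<in> short_span L"
  using short_span.add[of x L "- y"] short_span_minus by simp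

lemma short_span_sum: "(\<And>i. i \<in> I \<Longrightarrow> h i \<in> short_span L) \<Longrightarrow> sum h I \<in> short_span L"
  by (induction I rule: infinite_finite_induct)
     (auto intro: short_span.add short_span.ideal zero_M)

lemma short_span_cong: "x \<approx> y \<Longrightarrow> x \<in> short_span L \<longleftrightarrow> y \<in> short_span L"
  using short_span_diff[of x L "x - y"] short_span.add[of "x - y" L y] short_span.ideal[of "x - y" L]
  by (auto simp: cong_def)

lemma short_span_word_le: "length w \<le> L \<Longrightarrow> word_val w \<in> short_span L"
  using short_span.word[of w L] short_span.power[of 0 L] by (cases "w = []") auto

lemma z_ev_mult: "x \<in> R \<Longrightarrow> z * (ev a * x) \<approx> ev (\<sigma> a) * (z * x)"
  using cong_mult_right[OF _ z_ev_cong, of x a] by (simp add: mult.assoc)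

lemma short_span_z: "x \<in> short_span L \<Longrightarrow> z * x \<in> short_span L"
proof (induction rule: short_span.induct)
  case (ideal x)
  then show ?case by (intro short_span.ideal mult_RM z_R)
next
  case (power n)
  then show ?case using short_span.power[of "Suc n"] by simp
next
  case (word w)
  then obtain a v where w: "w = a # v" by (cases w) auto
  show ?case unfolding w z_word_val
    by (intro short_span.scale short_span_diff short_span_word_le) (use word w in auto)
next
  case (add x y)
  then show ?case by (auto simp: distrib_left intro: short_span.add)
next
  case (scale x a)
  then show ?case using short_span_cong[OF z_ev_mult[OF short_span_R]] by (blast intro: short_span.scale)
qed

lemma short_span_top:
  assumes "x \<in> short_span (Suc L)"
  shows "\<exists>A a. finite A \<and> (\<forall>w\<in>A. length w = Suc L) \<and> x - comb A a \<in> short_span L"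
  using assms
proof (induction rule: short_span.induct)
  case (ideal x)
  then show ?case by (intro exI[of _ "{}"]) (auto intro: short_span.ideal)
next
  case (power n)
  then show ?case by (intro exI[of _ "{}"]) (auto intro: short_span.power)
next
  case (word w)
  show ?case
  proof (cases "length w = Suc L")
    case True
    then show ?thesis
      by (intro exI[of _ "{w}"] exI[of _ "\<lambda>_. 1"]) (auto simp: ev_1 intro: short_span.ideal zero_M)
  next
    case False
    then show ?thesis using word by (intro exI[of _ "{}"]) (auto intro: short_span.word)
  qed
next
  case (add x y)
  then obtain A a B b where AB: "finite A" "\<forall>w\<in>A. length w = Suc L" "finite B" "\<forall>w\<in>B. length w = Suc L"
    and x: "x - comb A a \<in> short_span L"
    and y: "y - comb B b \<in> short_span L" by blast
  let ?c = "\<lambda>w. (if w \<in> A then a w else 0) + (if w \<in> B then b w else 0)"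
  have "comb (A \<union> B) ?c
     = (\<Sum>w\<in>A \<union> B. if w \<in> A then ev (a w) * word_val w else 0) + (\<Sum>w\<in>A \<union> B. if w \<in> B then ev (b w) * word_val w else 0)"
    by (simp add: sum.distrib[symmetric] ev_add distrib_right ev_0 cong: if_cong) (intro sum.cong, auto simp: ev_0)
  also have "\<dots> = comb A a + comb B b"
    using AB by (simp flip: sum.inter_restrict add: Int_absorb1 Int_absorb2)
  finally have "x + y - comb (A \<union> B) ?c \<in> short_span L"
    using short_span.add[OF x y] by (simp add: algebra_simps)
  then show ?case using AB by (intro exI[of _ "A \<union> B"] exI[of _ ?c]) auto
next
  case (scale x g)
  then obtain A a where A: "finite A" "\<forall>w\<in>A. length w = Suc L"
    and x: "x - comb A a \<in> short_span L" by blast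
  have "ev g * (x - comb A a) = ev g * x - (\<Sum>w\<in>A. ev (g * a w) * word_val w)"
    by (simp add: right_diff_distrib sum_distrib_left ev_mult mult.assoc)
  then show ?case using A short_span.scale[OF x, of g] by (intro exI[of _ A] exI[of _ "\<lambda>w. g * a w"]) auto
qed

lemma short_span_0:
  assumes "x \<in> short_span 0"
  shows "\<exists>d a. x \<approx> (\<Sum>n<d. ev (a n) * z ^ n)"
  using assms
proof (induction rule: short_span.induct)
  case (ideal x)
  then show ?case by (intro exI[of _ 0]) (auto simp: cong_0)
next
  case (power n)
  have "(\<Sum>i<Suc n. ev (if i = n then 1 else 0) * z ^ i) = z ^ n" by (simp add: ev_0 ev_1)
  then show ?case by (metis cong_refl)
next
  case (word w)
  then show ?case by simp
next
  case (add x y)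
  then obtain d a e b where x: "x \<approx> (\<Sum>n<d. ev (a n) * z ^ n)" and y: "y \<approx> (\<Sum>n<e. ev (b n) * z ^ n)" by blast
  have ext: "(\<Sum>n<d. ev (a n) * z ^ n) = (\<Sum>n<m. ev (if n < d then a n else 0) * z ^ n)" if "d \<le> m" for d m a
    using that by (intro sum.mono_neutral_cong_left) (auto simp: ev_0)
  have "x + y \<approx> (\<Sum>n<max d e. ev ((if n < d then a n else 0) + (if n < e then b n else 0)) * z ^ n)"
    using cong_add[OF x y] ext[of d "max d e" a] ext[of e "max d e" b]
    by (simp add: ev_add distrib_right sum.distrib)
  then show ?case
    by (intro exI[of _ "max d e"] exI[of _ "\<lambda>n. (if n < d then a n else 0) + (if n < e then b n else 0)"])
next
  case (scale x g)
  then obtain d a where x: "x \<approx> (\<Sum>n<d. ev (a n) * z ^ n)" by blast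
  have "ev g * x \<approx> (\<Sum>n<d. ev (g * a n) * z ^ n)"
    using cong_mult_left[OF ev_R x, of g] by (simp add: sum_distrib_left ev_mult mult.assoc)
  then show ?case by (intro exI[of _ d] exI[of _ "\<lambda>n. g * a n"])
qed

lemma z_power_ev_t: "z ^ n * ev t \<approx> ev (t + of_nat (2 * n)) * z ^ n"
proof (induction n)
  case (Suc n)
  have \<sigma>n: "\<sigma> (of_nat m) = of_nat m" for m by (induction m) (simp_all add: \<sigma>_0 \<sigma>_add \<sigma>_1)
  have "z ^ Suc n * ev t = z * (z ^ n * ev t)" by (simp add: mult.assoc)
  also have "\<dots> \<approx> z * (ev (t + of_nat (2 * n)) * z ^ n)" by (rule cong_mult_left[OF z_R Suc])
  also have "\<dots> \<approx> ev (\<sigma> (t + of_nat (2 * n))) * (z * z ^ n)" by (rule z_ev_mult) (simp add: power_R z_R)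
  also have "\<sigma> (t + of_nat (2 * n)) = t + of_nat (2 * Suc n)" unfolding \<sigma>_add \<sigma>n \<sigma>_t by simp
  finally show ?case by simp
qed simp

text \<open>Right multiplication by \<open>ev t\<close> multiplies \<open>z ^ n\<close> on the left
  by \<open>t + 2 n\<close>, and these factors are distinct in characteristic zero. Subtracting
  \<open>t + 2 d\<close> times the relation therefore removes its top term and no other.\<close>

lemma z_powers_independent:
  assumes "(\<Sum>n<d. ev (a n) * z ^ n) \<in> M" "n < d"
  shows "a n = 0"
  using assms
proof (induction d arbitrary: a n)
  case (Suc d)
  let ?Y = "\<lambda>d. \<Sum>n<d. ev (a n) * z ^ n"
  let ?t = "\<lambda>n. t + of_nat (2 * n)"
  have Y: "?Y (Suc d) \<in> M" using Suc.prems by simp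
  have 1: "?Y (Suc d) * ev t \<approx> (\<Sum>n<Suc d. ev (a n) * (ev (?t n) * z ^ n))"
    unfolding sum_distrib_right mult.assoc by (intro cong_sum cong_mult_left ev_R z_power_ev_t)
  have "(\<Sum>n<Suc d. ev (a n) * (ev (?t n) * z ^ n)) - ev (?t d) * ?Y (Suc d)
     = (\<Sum>n<Suc d. ev (a n * (?t n - ?t d)) * z ^ n)"
    by (simp only: sum_distrib_left sum_subtractf[symmetric])
       (intro sum.cong refl, simp add: ev_mult[symmetric] mult.assoc[symmetric] left_diff_distrib[symmetric] ev_diff[symmetric], simp add: algebra_simps)
  also have "\<dots> = (\<Sum>n<d. ev (a n * (?t n - ?t d)) * z ^ n)" by (simp add: ev_0)
  finally have 2: "(\<Sum>n<d. ev (a n * (?t n - ?t d)) * z ^ n)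
     = (\<Sum>n<Suc d. ev (a n) * (ev (?t n) * z ^ n)) - ev (?t d) * ?Y (Suc d)" by simp
  have "(\<Sum>n<Suc d. ev (a n) * (ev (?t n) * z ^ n)) \<in> M"
    using cong_M[OF 1] mult_MR[OF Y ev_R] by blast
  then have "(\<Sum>n<d. ev (a n * (?t n - ?t d)) * z ^ n) \<in> M"
    unfolding 2 by (intro diff_M mult_RM ev_R Y)
  then have "a n * (?t n - ?t d) = 0" if "n < d" for n
    using Suc.IH[of "\<lambda>n. a n * (?t n - ?t d)"] that by blast
  moreover have "?t n - ?t d \<noteq> 0" if "n < d" for n
  proof -
    have "?t n - ?t d = - of_nat (2 * (d - n))" using that by (simp add: of_nat_diff algebra_simps)
    then show ?thesis using char0[of "2 * (d - n)"] that by (simp del: of_nat_mult)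
  qed
  ultimately have lt: "a n = 0" if "n < d" for n using that by simp
  then have "ev (a d) * z ^ d \<in> M" using Y by (simp add: ev_0)
  then have "a d = 0" using mult_notin_M[OF ev_R power_R[OF z_R]] power_notin_M[OF z_R z_M] ev_notin_M by blast
  then show ?case using lt Suc.prems(2) by (cases "n = d") auto
qed simp

lemma con_power_sum_zero:
  assumes "finite I" "(\<Sum>i\<in>I. con (c i) * s ^ Suc i) = 0" "i \<in> I"
  shows "c i = 0"
  using poles[OF assms(1), of 1 0 c i] assms by (simp add: \<sigma>_0)

definition head_sign :: "(bool \<times> nat) list \<Rightarrow> 'K" where
  "head_sign w = sign (fst (hd w))"

text \<open>Apply \<open>z_resolvent\<close> to each first letter; words in the second sum are
  shorter by one. The parameter \<open>e\<close> is free so that it can be matched with the head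
  sign of a chosen word: if its coefficient is fixed by \<open>\<sigma>\<close>, that word drops out
  of the first sum.\<close>

lemma z_plus_sign_sum:
  assumes "finite A" "\<And>w. w \<in> A \<Longrightarrow> w \<noteq> []"
  shows "z * comb A a + ev e * comb A a
    \<approx> (\<Sum>w\<in>A. ev (e * a w - head_sign w * \<sigma> (a w)) * word_val w)
      + (\<Sum>w\<in>A. ev (head_sign w * \<sigma> (a w) * s ^ Suc (snd (hd w))) * word_val (tl w))"
proof -
  have "z * (ev (a w) * word_val w) + ev e * (ev (a w) * word_val w)
    \<approx> ev (e * a w - head_sign w * \<sigma> (a w)) * word_val w
      + ev (head_sign w * \<sigma> (a w) * s ^ Suc (snd (hd w))) * word_val (tl w)" if "w \<in> A" for w
  proof -
    obtain b v where w: "w = b # v" using assms(2)[OF \<open>w \<in> A\<close>] by (cases w) auto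
    have "z * (ev (a w) * word_val w) \<approx> ev (\<sigma> (a w)) * (z * word_val w)"
      by (rule z_ev_mult[OF word_val_R])
    then have "z * (ev (a w) * word_val w) + ev e * (ev (a w) * word_val w)
      \<approx> ev (\<sigma> (a w)) * (z * word_val w) + ev e * (ev (a w) * word_val w)"
      by (rule cong_add) simp
    also have "\<dots> = ev (\<sigma> (a w) * head_sign w * s ^ Suc (snd b)) * word_val v - ev (\<sigma> (a w) * head_sign w) * word_val w
       + ev (e * a w) * word_val w"
      unfolding w z_word_val by (simp only: ev_mult mult.assoc right_diff_distrib head_sign_def list.sel)
    finally show ?thesis
      by (simp add: w ev_diff mult.commute[of "\<sigma> _"] left_diff_distrib add_diff_eq diff_add_eq add.commute del: word_val.simps power_Suc)
  qed
  then have "(\<Sum>w\<in>A. z * (ev (a w) * word_val w) + ev e * (ev (a w) * word_val w))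
    \<approx> (\<Sum>w\<in>A. ev (e * a w - head_sign w * \<sigma> (a w)) * word_val w
      + ev (head_sign w * \<sigma> (a w) * s ^ Suc (snd (hd w))) * word_val (tl w))"
    by (rule cong_sum)
  then show ?thesis by (simp only: sum.distrib sum_distrib_left)
qed


lemma tail_sum_group:
  assumes "finite A" "\<And>w. w \<in> A \<Longrightarrow> w \<noteq> [] \<and> fst (hd w) = b" "tl ` A \<subseteq> D" "finite D"
  shows "(\<Sum>w\<in>A. ev (e * con (c w) * s ^ Suc (snd (hd w))) * word_val (tl w))
    = (\<Sum>v\<in>D. ev (e * (\<Sum>i | (b, i) # v \<in> A. con (c ((b, i) # v)) * s ^ Suc i)) * word_val v)"
proof -
  have fib: "(\<Sum>w | w \<in> A \<and> tl w = v. g (hd w) w) = (\<Sum>i | (b, i) # v \<in> A. g (b, i) ((b, i) # v))"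
    for v and g :: "bool \<times> nat \<Rightarrow> (bool \<times> nat) list \<Rightarrow> 'x::comm_monoid_add"
  proof -
    have "{w \<in> A. tl w = v} = (\<lambda>i. (b, i) # v) ` {i. (b, i) # v \<in> A}"
    proof (intro set_eqI iffI)
      fix w assume "w \<in> {w \<in> A. tl w = v}"
      then have "w = (b, snd (hd w)) # v" "w \<in> A"
        using assms(2)[of w] by (auto simp: prod_eq_iff intro: list.expand)
      then show "w \<in> (\<lambda>i. (b, i) # v) ` {i. (b, i) # v \<in> A}" by auto
    qed auto
    then show ?thesis by (simp add: sum.reindex inj_on_def)
  qed
  have "(\<Sum>w\<in>A. ev (e * con (c w) * s ^ Suc (snd (hd w))) * word_val (tl w))
    = (\<Sum>v\<in>D. \<Sum>w | w \<in> A \<and> tl w = v. ev (e * con (c w) * s ^ Suc (snd (hd w))) * word_val (tl w))"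
    by (rule sum.group[symmetric]) (use assms in auto)
  also have "\<dots> = (\<Sum>v\<in>D. \<Sum>i | (b, i) # v \<in> A. ev (e * con (c ((b, i) # v)) * s ^ Suc i) * word_val v)"
    using fib[of "\<lambda>a w. ev (e * con (c w) * s ^ Suc (snd a)) * word_val (tl w)"] by simp
  also have "\<dots> = (\<Sum>v\<in>D. ev (e * (\<Sum>i | (b, i) # v \<in> A. con (c ((b, i) # v)) * s ^ Suc i)) * word_val v)"
    by (simp only: sum_distrib_left ev_sum sum_distrib_right mult.assoc)
  finally show ?thesis .
qed

lemma finite_letters: "finite A \<Longrightarrow> finite {i :: nat. (b :: bool, i) # v \<in> A}"
proof -
  assume "finite A"
  then have "finite ((\<lambda>w. snd (hd w)) ` A)" by simp
  moreover have "{i. (b, i) # v \<in> A} \<subseteq> (\<lambda>w. snd (hd w)) ` A" by force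
  ultimately show ?thesis by (rule rev_finite_subset)
qed

text \<open>Constants are fixed by \<open>\<sigma>\<close>, so with a common head sign all words
  that keep their first letter cancel. What is left has combinations of positive powers of
  \<open>s\<close> as coefficients, the input of \<open>poles\<close>.\<close>

lemma z_plus_sign_constant:
  assumes A: "finite A" "\<And>w. w \<in> A \<Longrightarrow> w \<noteq> [] \<and> fst (hd w) = b" and D: "tl ` A \<subseteq> D" "finite D"
  shows "z * comb A (\<lambda>w. con (c w)) + ev (sign b) * comb A (\<lambda>w. con (c w))
    \<approx> comb D (\<lambda>v. sign b * (\<Sum>i | (b, i) # v \<in> A. con (c ((b, i) # v)) * s ^ Suc i))"
proof -
  let ?X = "comb A (\<lambda>w. con (c w))" and ?e = "sign b"
  have "z * ?X + ev ?e * ?X \<approx> (\<Sum>w\<in>A. ev (?e * con (c w) - head_sign w * \<sigma> (con (c w))) * word_val w)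
      + (\<Sum>w\<in>A. ev (head_sign w * \<sigma> (con (c w)) * s ^ Suc (snd (hd w))) * word_val (tl w))"
    by (rule z_plus_sign_sum) (use A in force)+
  also have "\<dots> = (\<Sum>w\<in>A. ev (?e * con (c w) * s ^ Suc (snd (hd w))) * word_val (tl w))"
    using A(2) by (simp add: head_sign_def \<sigma>_con ev_0 del: power_Suc)
  also have "\<dots> = comb D (\<lambda>v. ?e * (\<Sum>i | (b, i) # v \<in> A. con (c ((b, i) # v)) * s ^ Suc i))"
    by (rule tail_sum_group[OF A D])
  finally show ?thesis .
qed

text \<open>The combination is congruent to a polynomial \<open>Y\<close> in \<open>z\<close>, and
  \<open>z + e\<close> turns it into a scalar \<open>e h\<close>. Since \<open>z\<close> raises the
  degree of a nonzero \<open>Y\<close>, comparison from the top forces \<open>Y\<close> and then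
  \<open>h\<close> to vanish, and positive powers of \<open>s\<close> are independent over the
  constants.\<close>

lemma constant_relation_base:
  assumes A: "finite A" "\<And>w. w \<in> A \<Longrightarrow> length w = Suc 0 \<and> fst (hd w) = b"
    and X: "comb A (\<lambda>w. con (c w)) \<in> short_span 0" and w: "w \<in> A"
  shows "c w = 0"
proof -
  let ?X = "comb A (\<lambda>w. con (c w))" and ?e = "sign b"
  define h where "h = (\<Sum>i | (b, i) # [] \<in> A. con (c ((b, i) # [])) * s ^ Suc i)"
  have "tl ` A \<subseteq> {[]}" using A(2) by (force simp: length_Suc_conv)
  then have zX: "z * ?X + ev ?e * ?X \<approx> ev (?e * h)"
    using z_plus_sign_constant[of A b "{[]}" c] A by (force simp: h_def)
  obtain d p where p: "?X \<approx> (\<Sum>n<d. ev (p n) * z ^ n)" using short_span_0[OF X] by blast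
  let ?Y = "\<Sum>n<d. ev (p n) * z ^ n"
  \<comment> \<open>The coefficients of \<open>(z + e) Y - e h\<close> in powers of
    \<open>z\<close>.\<close>
  define r where "r n = (if n = 0 then 0 else \<sigma> (p (n - 1))) + (if n < d then ?e * p n else 0)
      - (if n = 0 then ?e * h else 0)" for n
  have zY: "z * ?Y \<approx> (\<Sum>n<d. ev (\<sigma> (p n)) * (z * z ^ n))"
    unfolding sum_distrib_left by (intro cong_sum z_ev_mult power_R z_R)
  have r_sum: "(\<Sum>n<Suc d. ev (r n) * z ^ n)
     = (\<Sum>n<d. ev (\<sigma> (p n)) * (z * z ^ n)) + ev ?e * ?Y - ev (?e * h)"
  proof -
    have "(\<Sum>n<Suc d. ev (if n = 0 then 0 else \<sigma> (p (n - 1))) * z ^ n) = (\<Sum>n<d. ev (\<sigma> (p n)) * (z * z ^ n))"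
      by (subst sum.lessThan_Suc_shift) (simp add: ev_0)
    moreover have "(\<Sum>n<Suc d. ev (if n < d then ?e * p n else 0) * z ^ n) = ev ?e * ?Y"
      by (simp add: ev_0 sum_distrib_left ev_mult mult.assoc)
    moreover have "(\<Sum>n<Suc d. ev (if n = 0 then ?e * h else 0) * z ^ n) = ev (?e * h)"
      by (subst sum.lessThan_Suc_shift) (simp add: ev_0)
    ultimately show ?thesis
      by (simp only: r_def ev_add ev_diff distrib_right left_diff_distrib sum.distrib sum_subtractf)
  qed
  have zYr: "z * ?Y + ev ?e * ?Y - ev (?e * h) \<approx> (\<Sum>n<Suc d. ev (r n) * z ^ n)"
    unfolding r_sum by (intro cong_diff cong_add zY cong_refl)
  have "z * ?Y + ev ?e * ?Y \<approx> ev (?e * h)"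
  proof -
    have "z * ?Y + ev ?e * ?Y \<approx> z * ?X + ev ?e * ?X"
      by (intro cong_add cong_mult_left z_R ev_R cong_sym[OF p])
    also note zX
    finally show ?thesis .
  qed
  then have rM: "(\<Sum>n<Suc d. ev (r n) * z ^ n) \<in> M"
    using cong_M[OF zYr] by (simp only: cong_def)
  have r: "r n = 0" if "n < Suc d" for n by (rule z_powers_independent[OF rM that])
  have p0: "p n = 0" if "n < d" for n
    using that
  proof (induction "d - n" arbitrary: n rule: less_induct)
    case less
    have "r (Suc n) = 0" using r[of "Suc n"] less.prems by simp
    moreover have "p (Suc n) = 0" if "Suc n < d" using less.hyps[of "Suc n"] that less.prems by simp
    ultimately have "\<sigma> (p n) = 0" by (auto simp: r_def split: if_splits)
    then show ?case by (simp add: \<sigma>_eq_0)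
  qed
  have "h = 0" using r[of 0] p0[of 0] sign_simps(3)[of b] by (auto simp: r_def split: if_splits)
  moreover obtain i where i: "w = [(b, i)]"
    using A(2)[OF w] by (cases w) (auto simp: prod_eq_iff)
  ultimately show ?thesis
    using con_power_sum_zero[OF finite_letters[OF A(1), of b "[]"], where c = "\<lambda>i. c ((b, i) # [])" and i = i] w
    by (simp add: h_def)
qed

text \<open>By assumption the combination agrees, up to words of length at most \<open>L\<close>,
  with words of length \<open>L + 1\<close> with some coefficients \<open>p\<close>. Applying
  \<open>z + e\<close> to both and comparing the words of length \<open>L + 1\<close> through the
  induction hypothesis gives \<open>h = p - l * \<sigma> p\<close> for each word, where
  \<open>h\<close> is a constant combination of powers of \<open>s\<close> and \<open>l\<close> is a
  sign. By \<open>poles\<close> all constants vanish.\<close>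

lemma constant_relation_step:
  assumes IH: "\<And>A a. finite A \<Longrightarrow> (\<And>w. w \<in> A \<Longrightarrow> length w = Suc L) \<Longrightarrow>
      comb A a \<in> short_span L \<Longrightarrow> \<forall>w\<in>A. a w = 0"
    and A: "finite A" "\<And>w. w \<in> A \<Longrightarrow> length w = Suc (Suc L) \<and> fst (hd w) = b"
    and X: "comb A (\<lambda>w. con (c w)) \<in> short_span (Suc L)" and w: "w \<in> A"
  shows "c w = 0"
proof -
  let ?X = "comb A (\<lambda>w. con (c w))" and ?e = "sign b"
  let ?h = "\<lambda>v. \<Sum>i | (b, i) # v \<in> A. con (c ((b, i) # v)) * s ^ Suc i"
  obtain D0 p0 where D0: "finite D0" "\<forall>v\<in>D0. length v = Suc L"
    and X0: "?X - comb D0 p0 \<in> short_span L"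
    using short_span_top[OF X] by blast
  define D where "D = D0 \<union> tl ` A"
  define p where "p v = (if v \<in> D0 then p0 v else 0)" for v
  have D: "finite D" "\<And>v. v \<in> D \<Longrightarrow> length v = Suc L" "tl ` A \<subseteq> D"
    using D0 A by (auto simp: D_def)
  have "comb D0 p0 = comb D p"
    by (rule sum.mono_neutral_cong_left) (use D(1) in \<open>auto simp: D_def p_def ev_0\<close>)
  then have X1: "?X - comb D p \<in> short_span L" using X0 by simp
  let ?Y = "comb D p"
  have zX: "z * ?X + ev ?e * ?X \<approx> (\<Sum>v\<in>D. ev (?e * ?h v) * word_val v)"
    by (rule z_plus_sign_constant) (use A D in force)+
  have zY: "z * ?Y + ev ?e * ?Y \<approx> (\<Sum>v\<in>D. ev (?e * p v - head_sign v * \<sigma> (p v)) * word_val v)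
      + (\<Sum>v\<in>D. ev (head_sign v * \<sigma> (p v) * s ^ Suc (snd (hd v))) * word_val (tl v))" (is "_ \<approx> ?Y1 + ?Y2")
    by (rule z_plus_sign_sum) (use D in force)+
  have Y2: "?Y2 \<in> short_span L"
    by (intro short_span_sum short_span.scale short_span_word_le) (use D(2) in force)
  have "z * (?X - ?Y) + ev ?e * (?X - ?Y) \<in> short_span L"
    by (intro short_span.add short_span_z short_span.scale X1)
  also have "z * (?X - ?Y) + ev ?e * (?X - ?Y) = (z * ?X + ev ?e * ?X) - (z * ?Y + ev ?e * ?Y)"
    by (simp only: right_diff_distrib add_diff_add)
  finally have "(\<Sum>v\<in>D. ev (?e * ?h v) * word_val v) - (?Y1 + ?Y2) \<in> short_span L"
    unfolding short_span_cong[OF cong_diff[OF zX zY]] .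
  then have "(\<Sum>v\<in>D. ev (?e * ?h v) * word_val v) - (?Y1 + ?Y2) + ?Y2 \<in> short_span L"
    using Y2 by (rule short_span.add)
  moreover have "(\<Sum>v\<in>D. ev (?e * ?h v) * word_val v) - (?Y1 + ?Y2) + ?Y2
      = (\<Sum>v\<in>D. ev (?e * ?h v - (?e * p v - head_sign v * \<sigma> (p v))) * word_val v)"
    by (simp only: ev_diff[of "?e * ?h _"] left_diff_distrib[of "ev (?e * ?h _)"] sum_subtractf) simp
  ultimately have z0: "\<forall>v\<in>D. ?e * ?h v - (?e * p v - head_sign v * \<sigma> (p v)) = 0"
    by (intro IH[OF D(1,2)]) (assumption, simp only:)
  obtain i v where iv: "w = (b, i) # v" using A(2)[OF w] by (cases w) (auto simp: prod_eq_iff)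
  have v: "v \<in> D" using D(3) w iv by force
  let ?l = "?e * head_sign v"
  have hs: "head_sign v * head_sign v = 1" "\<sigma> (head_sign v) = head_sign v" by (simp_all add: head_sign_def sign_simps)
  have ll: "?l = 1 \<or> ?l = - 1" by (auto simp: head_sign_def sign_def)
  have "?e * (?e * ?h v - (?e * p v - head_sign v * \<sigma> (p v))) = 0" using z0 v by simp
  then have "?e * ?e * ?h v = ?e * ?e * p v - ?l * \<sigma> (p v)" by (simp add: algebra_simps del: power_Suc)
  then have hv: "?h v = p v - ?l * \<sigma> (p v)" by (simp only: sign_simps mult_1)
  have l2: "?l * ?l = 1" using ll by auto
  \<comment> \<open>Because \<open>l * l = 1\<close>, the element \<open>- (l * p v)\<close> puts
    the equation into the shape that \<open>poles\<close> expects.\<close>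
  have "\<sigma> (- (?l * p v)) - ?l * (- (?l * p v)) = ?l * ?l * p v - ?l * \<sigma> (p v)"
    by (simp add: \<sigma>_minus \<sigma>_mult hs sign_simps algebra_simps)
  then have "\<sigma> (- (?l * p v)) - ?l * (- (?l * p v)) = ?h v" unfolding l2 hv by simp
  from poles[OF finite_letters[OF A(1)] ll this, of i] show ?thesis using w iv by simp
qed

text \<open>For each length, induction on the number of words. One coefficient is normalised to 1,
  and \<open>z + e\<close> with \<open>e\<close> its head sign removes that word. The smaller
  relation has zero coefficients, so every coefficient satisfies \<open>\<sigma> a = a\<close> or
  \<open>\<sigma> a = - a\<close> according to its head sign. The former are constants, the latter
  vanish, and a relation with constant coefficients and one head sign is impossible.\<close>

theorem words_independent:
  assumes "finite A" "\<And>w. w \<in> A \<Longrightarrow> length w = Suc L" "comb A a \<in> short_span L"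
  shows "\<forall>w\<in>A. a w = 0"
  using assms
proof (induction L arbitrary: A a)
  \<comment> \<open>The case of constant coefficients is a premise, because for longer words its
    proof uses the theorem for the previous length.\<close>
  have main: "\<forall>w\<in>A. a w = 0"
    if const: "\<And>A b c w. finite A \<Longrightarrow> (\<And>w. w \<in> A \<Longrightarrow> length w = Suc L \<and> fst (hd w) = b) \<Longrightarrow>
        comb A (\<lambda>w. con (c w)) \<in> short_span L \<Longrightarrow> w \<in> A \<Longrightarrow> c w = 0"
      and A: "finite A" "\<And>w. w \<in> A \<Longrightarrow> length w = Suc L" "comb A a \<in> short_span L"
    for L A a
    using A
  proof (induction "card A" arbitrary: A a rule: less_induct)
    case less
    show ?case
    proof (rule ccontr)
      assume "\<not> (\<forall>w\<in>A. a w = 0)"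
      then obtain w0 where w0: "w0 \<in> A" "a w0 \<noteq> 0" by blast
      define a' where "a' w = inverse (a w0) * a w" for w
      have a'0: "a' w0 = 1" using w0 by (simp add: a'_def)
      let ?X = "comb A a'"
      have "?X = ev (inverse (a w0)) * comb A a"
        by (simp add: a'_def ev_mult sum_distrib_left mult.assoc)
      then have X: "?X \<in> short_span L" using less.prems(3) by (simp add: short_span.scale)
      let ?e = "head_sign w0"
      let ?d = "\<lambda>w. ?e * a' w - head_sign w * \<sigma> (a' w)"
      let ?Y1 = "comb A ?d"
      let ?Y2 = "\<Sum>w\<in>A. ev (head_sign w * \<sigma> (a' w) * s ^ Suc (snd (hd w))) * word_val (tl w)"
      have "z * ?X + ev ?e * ?X \<approx> ?Y1 + ?Y2"
        by (rule z_plus_sign_sum) (use less.prems in force)+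
      moreover have "z * ?X + ev ?e * ?X \<in> short_span L"
        by (intro short_span.add short_span_z short_span.scale X)
      ultimately have "?Y1 + ?Y2 \<in> short_span L" using short_span_cong by blast
      moreover have "?Y2 \<in> short_span L"
        by (intro short_span_sum short_span.scale short_span_word_le) (use less.prems(2) in force)
      ultimately have Y1: "?Y1 \<in> short_span L" using short_span_diff by fastforce
      have d0: "?d w0 = 0" by (simp add: a'0 \<sigma>_1)
      have "?Y1 = comb (A - {w0}) ?d"
        unfolding sum.remove[OF less.prems(1) w0(1)] d0 ev_0 by simp
      then have "comb (A - {w0}) ?d \<in> short_span L" using Y1 by simp
      moreover have "card (A - {w0}) < card A" using less.prems(1) w0(1) by (rule card_Diff1_less)
      ultimately have "\<forall>w\<in>A - {w0}. ?d w = 0"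
        using less.hyps[of "A - {w0}" ?d] less.prems by simp
      then have d: "?d w = 0" if "w \<in> A" for w using d0 that by blast
      have hs2: "head_sign w * head_sign w = 1" for w by (simp add: head_sign_def sign_simps)
      have sg: "\<sigma> (a' w) = head_sign w * ?e * a' w" if "w \<in> A" for w
      proof -
        have "head_sign w * ?d w = 0" using d[OF that] by simp
        then have "head_sign w * ?e * a' w = head_sign w * head_sign w * \<sigma> (a' w)" by (simp add: algebra_simps)
        then show ?thesis by (simp add: hs2)
      qed
      define A1 where "A1 = {w \<in> A. fst (hd w) = fst (hd w0)}"
      have other: "a' w = 0" if "w \<in> A" "w \<notin> A1" for w
      proof (rule antifixed)
        have "head_sign w * ?e = - 1" using that by (auto simp: A1_def head_sign_def sign_def)
        then show "\<sigma> (a' w) = - a' w" using sg[OF that(1)] by simp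
      qed
      have "\<exists>c. a' w = con c" if "w \<in> A1" for w
      proof (rule fixed)
        have "head_sign w * ?e = 1" using that hs2[of w0] by (simp add: A1_def head_sign_def)
        then show "\<sigma> (a' w) = a' w" using sg[of w] that by (simp add: A1_def)
      qed
      then obtain c where c: "\<And>w. w \<in> A1 \<Longrightarrow> a' w = con (c w)" by metis
      have "?X = comb A1 (\<lambda>w. con (c w))"
        by (rule sum.mono_neutral_cong_right) (use less.prems(1) other c in \<open>auto simp: A1_def ev_0\<close>)
      then have "comb A1 (\<lambda>w. con (c w)) \<in> short_span L" using X by simp
      then have "c w0 = 0"
        by (rule const[of A1 "fst (hd w0)", rotated 2]) (use less.prems(1,2) w0(1) in \<open>auto simp: A1_def\<close>)
      then show False using c[of w0] w0(1) a'0 con_0 by (simp add: A1_def)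
    qed
  qed
  {
    case 0
    show ?case by (rule main[OF _ 0]) (rule constant_relation_base)
  next
    case (Suc L)
    show ?case by (rule main[OF _ Suc.prems]) (rule constant_relation_step[OF Suc.IH])
  }
qed


section \<open>Products of \<open>s\<close> and its Cayley conjugate as words in resolvents\<close>

inductive_set pure_span :: "nat \<Rightarrow> 'd set" for L :: nat where
  zero: "0 \<in> pure_span L"
| add: "x \<in> pure_span L \<Longrightarrow> y \<in> pure_span L \<Longrightarrow> x + y \<in> pure_span L"
| minus: "x \<in> pure_span L \<Longrightarrow> - x \<in> pure_span L"
| word: "length w \<le> L \<Longrightarrow> ev (s ^ i) * word_val w \<in> pure_span L"

lemma pure_span_short_span: "x \<in> pure_span L \<Longrightarrow> x \<in> short_span L"
  by (induction rule: pure_span.induct)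
     (auto intro: short_span.add short_span_minus short_span.scale short_span_word_le short_span.ideal zero_M)

lemma pure_span_mono: "x \<in> pure_span L \<Longrightarrow> L \<le> L' \<Longrightarrow> x \<in> pure_span L'"
  by (induction rule: pure_span.induct) (auto intro: pure_span.intros)

lemma pure_span_diff: "x \<in> pure_span L \<Longrightarrow> y \<in> pure_span L \<Longrightarrow> x - y \<in> pure_span L"
  using pure_span.add[of x L "- y"] pure_span.minus by simp

lemma pure_span_ev_s: "x \<in> pure_span L \<Longrightarrow> ev s * x \<in> pure_span L"
proof (induction rule: pure_span.induct)
  case (word w i)
  then have "ev (s ^ Suc i) * word_val w \<in> pure_span L" by (rule pure_span.word)
  then show ?case by (simp add: ev_mult mult.assoc)
qed (auto simp: distrib_left intro: pure_span.intros)

text \<open>This is why \<open>pure_span\<close> admits only integer combinations of powers of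
  \<open>s\<close> as coefficients: a resolvent times a positive power of \<open>s\<close> is a
  letter, whereas a general coefficient would be trapped behind the resolvent.\<close>

lemma pure_span_resolvent: "x \<in> pure_span L \<Longrightarrow> resolvent b * (ev s * x) \<in> pure_span (Suc L)"
proof (induction rule: pure_span.induct)
  case (word w i)
  have "resolvent b * (ev s * (ev (s ^ i) * word_val w)) = ev (s ^ 0) * word_val ((b, i) # w)"
    by (simp add: ev_mult ev_1 mult.assoc)
  then show ?case using pure_span.word[of "(b, i) # w" "Suc L" 0] word by simp
qed (auto simp: distrib_left intro: pure_span.intros)

text \<open>The Cayley transform of \<open>z\<close> and its inverse, written as twice a resolvent
  minus 1, so that the conjugating factors of \<open>T\<close> expand into resolvents and
  scalars.\<close>

definition cayley :: "bool \<Rightarrow> 'd" where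
  "cayley b = resolvent b + resolvent b - 1"

lemma cayley_eq: "cayley True = inverse (1 + z) * (1 - z)" "cayley False = (1 + z) * inverse (1 - z)"
proof -
  have nz: "1 + z \<noteq> 0" "1 - z \<noteq> 0" using z_notin zero_M by auto
  have e: "1 - z = 2 - (1 + z)" "1 + z = 2 - (1 - z)" by simp_all
  have "inverse (1 + z) * (1 - z) = inverse (1 + z) * (2 - (1 + z))" by (subst e(1)) (rule refl)
  also have "\<dots> = cayley True" unfolding right_diff_distrib using nz
    by (simp only: cayley_def resolvent_def if_True left_inverse[OF nz(1)] mult_2_right)
  finally show "cayley True = inverse (1 + z) * (1 - z)" by simp
  have "(1 + z) * inverse (1 - z) = (2 - (1 - z)) * inverse (1 - z)" by (subst e(2)) (rule refl)
  also have "\<dots> = cayley False" unfolding left_diff_distrib[of 2] using nz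
    by (simp add: cayley_def resolvent_def mult_2)
  finally show "cayley False = (1 + z) * inverse (1 - z)" by simp
qed

lemma cayley_inverse: "cayley False * cayley True = 1"
proof -
  have nz: "1 + z \<noteq> 0" "1 - z \<noteq> 0" using z_notin zero_M by auto
  have "inverse (1 - z) * inverse (1 + z) = inverse ((1 + z) * (1 - z))"
    using nz by (simp add: nonzero_inverse_mult_distrib)
  also have "(1 + z) * (1 - z) = (1 - z) * (1 + z)" by (simp add: algebra_simps)
  also have "inverse ((1 - z) * (1 + z)) = inverse (1 + z) * inverse (1 - z)"
    using nz by (simp add: nonzero_inverse_mult_distrib)
  finally have "cayley False * cayley True = (1 + z) * (inverse (1 + z) * inverse (1 - z)) * (1 - z)"
    unfolding cayley_eq by (metis mult.assoc)
  then show ?thesis using nz by (simp add: mult.assoc)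
qed

lemma cayley_R: "cayley b \<in> R"
  unfolding cayley_def by (intro diff_R add_R resolvent_R one_R)

text \<open>\<open>state_val b x\<close> is the value of the word \<open>x\<close> after a letter \<open>b\<close>: a conjugating factor occurs
  only where the letter changes.\<close>

primrec state_val :: "bool \<Rightarrow> bool list \<Rightarrow> 'd" where
  "state_val b [] = 1"
| "state_val b (c # x) = (if c = b then ev s * state_val c x else cayley b * (ev s * state_val c x))"

text \<open>Between adjacent conjugated letters the factors
  \<open>cayley False * cayley True\<close> cancel. A word ending in a conjugated letter would leave
  an extra \<open>cayley False\<close> at the right end, hence the condition on the last
  letter.\<close>

lemma state_val_eq:
  assumes "last (b # x) = True"
  shows "state_val b x = (if b then 1 else cayley False)
    * prod_list (map (\<lambda>b. if b then ev s else cayley True * ev s * cayley False) x)"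
  using assms
proof (induction x arbitrary: b)
  case (Cons c x)
  then have IH: "state_val c x = (if c then 1 else cayley False)
    * prod_list (map (\<lambda>b. if b then ev s else cayley True * ev s * cayley False) x)" by simp
  have "cayley False * (cayley True * y) = y" for y
    using cayley_inverse by (simp flip: mult.assoc)
  then show ?case unfolding state_val.simps IH by (cases b; cases c) (simp_all add: mult.assoc)
qed simp

text \<open>\<open>runs b x\<close> is the run-length encoding of \<open>x\<close>: the number of leading letters \<open>b\<close>, then one pair per
  later run, with the letter that precedes the run and the length of the run minus 1.\<close>

primrec runs :: "bool \<Rightarrow> bool list \<Rightarrow> nat \<times> (bool \<times> nat) list" where
  "runs b [] = (0, [])"
| "runs b (c # x) = (if c = b then (Suc (fst (runs c x)), snd (runs c x))
     else (0, (b, fst (runs c x)) # snd (runs c x)))"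

text \<open>Decoder for \<open>runs\<close>, so that distinct words have distinct encodings. Runs
  alternate, so the letter flips at every pair.\<close>

fun unruns :: "bool \<Rightarrow> nat \<Rightarrow> (bool \<times> nat) list \<Rightarrow> bool list" where
  "unruns b i [] = replicate i b"
| "unruns b i ((c, j) # w) = replicate i b @ unruns (\<not> b) (Suc j) w"

lemma unruns_Suc: "unruns b (Suc i) w = b # unruns b i w"
  by (cases w) auto

lemma unruns_runs: "unruns b (fst (runs b x)) (snd (runs b x)) = x"
proof (induction x arbitrary: b)
  case (Cons c x)
  show ?case
  proof (cases "c = b")
    case True
    then show ?thesis using Cons[of b] by (simp add: unruns_Suc)
  next
    case False
    then have "c = (\<not> b)" by auto
    then show ?thesis using Cons[of c] by (simp add: unruns_Suc)
  qed
qed simp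

text \<open>Each change of letter contributes twice a resolvent minus 1. Taking the resolvent every
  time gives the leading word and the power of 2; each choice of -1 gives a shorter word. The
  alternative \<open>r = 0\<close> covers the empty encoding, for which \<open>length - 1\<close> is
  truncated to 0.\<close>

lemma state_val_top:
  "\<exists>r. state_val b x = of_nat (2 ^ length (snd (runs b x))) * (ev (s ^ fst (runs b x)) * word_val (snd (runs b x))) + r
    \<and> (r = 0 \<or> snd (runs b x) \<noteq> [] \<and> r \<in> pure_span (length (snd (runs b x)) - 1))"
proof (induction x arbitrary: b)
  case Nil
  then show ?case by (simp add: ev_1)
next
  case (Cons c x)
  let ?i = "fst (runs c x)" and ?w = "snd (runs c x)"
  let ?n = "of_nat (2 ^ length ?w) :: 'd"
  obtain r where r: "state_val c x = ?n * (ev (s ^ ?i) * word_val ?w) + r"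
    and rp: "r = 0 \<or> ?w \<noteq> [] \<and> r \<in> pure_span (length ?w - 1)"
    using Cons.IH by blast
  have n: "y * (?n * x) = ?n * (y * x)" for x y
    by (metis mult.assoc mult_of_nat_commute)
  have sval: "ev s * state_val c x = ?n * (ev (s ^ Suc ?i) * word_val ?w) + ev s * r"
    unfolding r distrib_left n by (simp add: ev_mult mult.assoc)
  show ?case
  proof (cases "c = b")
    case True
    then have e: "runs b (c # x) = (Suc ?i, ?w)" "state_val b (c # x) = ev s * state_val c x" by simp_all
    show ?thesis unfolding e fst_conv snd_conv sval using rp
      by (intro exI[of _ "ev s * r"]) (auto intro: pure_span_ev_s)
  next
    case False
    let ?r = "- (?n * (ev (s ^ Suc ?i) * word_val ?w)) + (resolvent b * (ev s * r) + resolvent b * (ev s * r) - ev s * r)"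
    have nat_mult: "of_nat m * y \<in> pure_span L" if "y \<in> pure_span L" for m y L
      using that by (induction m) (auto simp: distrib_right intro: pure_span.intros)
    have "r \<in> pure_span (length ?w - 1)" using rp pure_span.zero by auto
    then have "ev s * r \<in> pure_span (length ?w)"
      by (intro pure_span_ev_s) (erule pure_span_mono, simp)
    moreover have "resolvent b * (ev s * r) \<in> pure_span (length ?w)"
    proof (cases "r = 0")
      case False
      then show ?thesis using rp pure_span_resolvent[of r "length ?w - 1" b] by (cases ?w) auto
    qed (simp add: pure_span.zero)
    ultimately have rr: "?r \<in> pure_span (length ?w)"
      by (intro pure_span.add pure_span.minus pure_span_diff nat_mult pure_span.word) simp_all
    have "cayley b * (ev s * state_val c x) = (?n + ?n) * (resolvent b * (ev (s ^ Suc ?i) * word_val ?w)) + ?r"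
      unfolding sval cayley_def left_diff_distrib distrib_right distrib_left n
      by (simp add: algebra_simps del: power_Suc)
    then show ?thesis using False rr
      by (intro exI[of _ ?r]) (simp add: mult.assoc ev_1 mult_2 power_Suc[of 2] del: power_Suc)
  qed
qed

text \<open>Only the words with the longest encodings matter. By \<open>words_independent\<close>
  their coefficients vanish when grouped by equal words in resolvents. Within a group, different
  words carry different powers of \<open>s\<close> in front, and these are independent over the
  constants.\<close>

theorem cayley_conjugates_free:
  assumes p: "p \<in> free_alg" and S: "S \<in> R" "S \<approx> ev s"
    and T: "T \<in> R" "T \<approx> cayley True * ev s * cayley False"
    and rel: "fa_eval (\<lambda>c. ev (con c)) (\<lambda>b. if b then S else T) p = 0"
  shows "p = (\<lambda>_. 0)"
proof (rule ccontr)
  assume "p \<noteq> (\<lambda>_. 0)"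
  define Q where "Q = {x. p x \<noteq> 0}"
  have Q: "finite Q" "Q \<noteq> {}" using p \<open>p \<noteq> _\<close> by (auto simp: Q_def free_alg_def fun_eq_iff)
  let ?P = "\<lambda>x. prod_list (map (\<lambda>b. if b then S else T) x)"
  let ?PP = "\<lambda>x. prod_list (map (\<lambda>b. if b then ev s else cayley True * ev s * cayley False) x)"
  have P_R: "?P x \<in> R" "?PP x \<in> R" for x
    by (induction x) (auto simp: one_R mult_R S T ev_R cayley_R)
  have P_cong: "?P x \<approx> ?PP x" for x
    by (induction x) (auto intro!: cong_mult S T P_R ev_R mult_R cayley_R)
  \<comment> \<open>Multiplying the relation by \<open>S\<close> on the right makes every word end
    in the unconjugated letter, as \<open>state_val_eq\<close> requires.\<close>
  let ?x = "\<lambda>x. x @ [True]"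
  have "(\<Sum>x\<in>Q. ev (con (p x)) * ?P (?x x)) = fa_eval (\<lambda>c. ev (con c)) (\<lambda>b. if b then S else T) p * S"
    by (simp add: fa_eval_def Q_def sum_distrib_right mult.assoc)
  also have "\<dots> = 0" by (simp add: rel)
  finally have zero: "(\<Sum>x\<in>Q. ev (con (p x)) * ?P (?x x)) = 0" .
  have "(\<Sum>x\<in>Q. ev (con (p x)) * ?P (?x x)) \<approx> (\<Sum>x\<in>Q. ev (con (p x)) * ?PP (?x x))"
    by (intro cong_sum cong_mult_left ev_R P_cong)
  also have "(\<lambda>x. ?PP (?x x)) = (\<lambda>x. state_val True (?x x))"
    using state_val_eq[of True "?x _"] by simp
  finally have relM: "(\<Sum>x\<in>Q. ev (con (p x)) * state_val True (?x x)) \<in> M"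
    unfolding zero using cong_0 cong_sym by blast
  let ?i = "\<lambda>x. fst (runs True (?x x))" and ?w = "\<lambda>x. snd (runs True (?x x))"
  have inj: "x = y" if "?i x = ?i y" "?w x = ?w y" for x y
  proof -
    have "unruns True (?i x) (?w x) = unruns True (?i y) (?w y)" by (simp only: that)
    then show ?thesis by (simp only: unruns_runs append_same_eq)
  qed
  define L where "L = Max ((\<lambda>x. length (?w x)) ` Q)"
  have L: "length (?w x) \<le> L" if "x \<in> Q" for x using that Q(1) by (simp add: L_def)
  have "L \<in> (\<lambda>x. length (?w x)) ` Q" unfolding L_def by (rule Max_in) (use Q in auto)
  then obtain x0 where x0: "x0 \<in> Q" "length (?w x0) = L" by blast
  define Q1 where "Q1 = {x \<in> Q. length (?w x) = L}"
  have Q1: "finite Q1" "x0 \<in> Q1" using Q x0 by (auto simp: Q1_def)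
  have "\<forall>x. \<exists>r. state_val True (?x x) = of_nat (2 ^ length (?w x)) * (ev (s ^ ?i x) * word_val (?w x)) + r
      \<and> (r = 0 \<or> ?w x \<noteq> [] \<and> r \<in> pure_span (length (?w x) - 1))"
    by (intro allI state_val_top)
  from choice[OF this] obtain r where r_all: "\<forall>x. state_val True (?x x)
        = of_nat (2 ^ length (?w x)) * (ev (s ^ ?i x) * word_val (?w x)) + r x
      \<and> (r x = 0 \<or> ?w x \<noteq> [] \<and> r x \<in> pure_span (length (?w x) - 1))" ..
  then have r: "state_val True (?x x) = of_nat (2 ^ length (?w x)) * (ev (s ^ ?i x) * word_val (?w x)) + r x"
    "r x = 0 \<or> ?w x \<noteq> [] \<and> r x \<in> pure_span (length (?w x) - 1)" for x
    by blast+
  define t where "t x = con (p x) * of_nat (2 ^ L) * s ^ ?i x" for x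
  have ev_nat: "ev (of_nat m) = of_nat m" for m by (induction m) (simp_all add: ev_0 ev_add ev_1)
  have split: "(\<Sum>x\<in>Q. ev (con (p x)) * state_val True (?x x))
     = (\<Sum>x\<in>Q1. ev (t x) * word_val (?w x)) + (\<Sum>x\<in>Q1. ev (con (p x)) * r x)
       + (\<Sum>x\<in>Q - Q1. ev (con (p x)) * state_val True (?x x))"
  proof -
    have sub: "Q1 \<subseteq> Q" by (auto simp: Q1_def)
    have *: "ev (con (p x)) * state_val True (?x x) = ev (t x) * word_val (?w x) + ev (con (p x)) * r x" if "x \<in> Q1" for x
    proof -
      have "length (?w x) = L" using that by (simp add: Q1_def)
      then show ?thesis unfolding r(1) t_def ev_mult ev_nat by (simp only: distrib_left mult.assoc)
    qed
    have "(\<Sum>x\<in>Q1. ev (con (p x)) * state_val True (?x x))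
      = (\<Sum>x\<in>Q1. ev (t x) * word_val (?w x)) + (\<Sum>x\<in>Q1. ev (con (p x)) * r x)"
      unfolding sum.distrib[symmetric] by (rule sum.cong[OF refl *])
    then show ?thesis unfolding sum.subset_diff[OF sub Q(1)] by (simp only: add.commute)
  qed
  have two: "of_nat (2 ^ L) \<noteq> (0 :: 'K)" using char0[of "2 ^ L"] by simp
  have fin: "p x0 = 0" if "(\<Sum>x | x \<in> Q1 \<and> ?w x = ?w x0. t x) = 0"
  proof -
    let ?Q2 = "{x \<in> Q1. ?w x = ?w x0}"
    have inji: "inj_on ?i ?Q2" using inj by (auto simp: inj_on_def)
    define c where "c j = p (the_inv_into ?Q2 ?i j)" for j
    have "0 = (\<Sum>x\<in>?Q2. t x)" using that by simp
    also have "\<dots> = of_nat (2 ^ L) * (\<Sum>x\<in>?Q2. con (p x) * s ^ ?i x)"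
      by (simp add: t_def sum_distrib_left mult_ac)
    finally have "of_nat (2 ^ L) * (\<Sum>x\<in>?Q2. con (p x) * s ^ ?i x) = 0" by (rule sym)
    then have "(\<Sum>x\<in>?Q2. con (p x) * s ^ ?i x) = 0" using two by (simp only: mult_eq_0_iff simp_thms)
    \<comment> \<open>\<open>con_power_sum_zero\<close> speaks of positive powers only, so one more
      factor \<open>s\<close> is supplied.\<close>
    then have "s * (\<Sum>x\<in>?Q2. con (p x) * s ^ ?i x) = 0" by simp
    then have "(\<Sum>x\<in>?Q2. con (c (?i x)) * s ^ Suc (?i x)) = 0"
      by (simp add: sum_distrib_left mult_ac c_def the_inv_into_f_f[OF inji])
    then have "(\<Sum>j\<in>?i ` ?Q2. con (c j) * s ^ Suc j) = 0"
      by (subst sum.reindex[OF inji]) simp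
    from con_power_sum_zero[OF _ this, of "?i x0"] have "c (?i x0) = 0" using Q1 by simp
    then show ?thesis using Q1(2) by (simp add: c_def the_inv_into_f_f[OF inji])
  qed
  have "p x0 = 0"
  proof (cases L)
    \<comment> \<open>\<open>words_independent\<close> starts at length 1. Here no resolvent occurs
      and the relation involves powers of \<open>s\<close> alone.\<close>
    case 0
    have w: "?w x = []" if "x \<in> Q" for x using L[OF that] 0 by simp
    then have "Q1 = Q" "\<And>x. x \<in> Q \<Longrightarrow> r x = 0" using r(2) 0 by (auto simp: Q1_def)
    then have "(\<Sum>x\<in>Q1. ev (t x)) \<in> M" using relM split w by simp
    then have "ev (\<Sum>x\<in>Q1. t x) \<in> M" by (simp add: ev_sum)
    then have "(\<Sum>x\<in>Q1. t x) = 0" using ev_notin_M by blast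
    moreover have "{x \<in> Q1. ?w x = ?w x0} = Q1" using w x0 by (auto simp: Q1_def)
    ultimately show ?thesis by (intro fin) simp
  next
    case (Suc L')
    have rL: "r x \<in> short_span L'" if "x \<in> Q" for x
      using r(2)[of x]
    proof
      assume "?w x \<noteq> [] \<and> r x \<in> pure_span (length (?w x) - 1)"
      then show ?thesis using L[OF that] Suc
        by (intro pure_span_short_span) (erule conjE, erule pure_span_mono, simp)
    qed (simp add: short_span.ideal zero_M)
    have "(\<Sum>x\<in>Q1. ev (con (p x)) * r x) \<in> short_span L'"
      by (intro short_span_sum short_span.scale rL) (simp add: Q1_def)
    moreover have "(\<Sum>x\<in>Q - Q1. ev (con (p x)) * state_val True (?x x)) \<in> short_span L'"
    proof (intro short_span_sum short_span.scale)
      fix x assume "x \<in> Q - Q1"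
      then have "x \<in> Q" "length (?w x) \<le> L'" using L[of x] Suc by (auto simp: Q1_def)
      then have "ev (of_nat (2 ^ length (?w x))) * (ev (s ^ ?i x) * word_val (?w x)) + r x \<in> short_span L'"
        by (intro short_span.add short_span.scale short_span_word_le rL)
      then show "state_val True (?x x) \<in> short_span L'" unfolding r(1) ev_nat .
    qed
    moreover have "(\<Sum>x\<in>Q. ev (con (p x)) * state_val True (?x x)) \<in> short_span L'"
      using relM by (rule short_span.ideal)
    ultimately have "(\<Sum>x\<in>Q. ev (con (p x)) * state_val True (?x x))
        - (\<Sum>x\<in>Q - Q1. ev (con (p x)) * state_val True (?x x))
        - (\<Sum>x\<in>Q1. ev (con (p x)) * r x) \<in> short_span L'"
      by (intro short_span_diff)
    then have "(\<Sum>x\<in>Q1. ev (t x) * word_val (?w x)) \<in> short_span L'"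
      unfolding split by (simp only: add_diff_cancel_right')
    also have "(\<Sum>x\<in>Q1. ev (t x) * word_val (?w x)) = (\<Sum>w\<in>?w ` Q1. \<Sum>x | x \<in> Q1 \<and> ?w x = w. ev (t x) * word_val (?w x))"
      by (rule sum.image_gen[OF Q1(1)])
    also have "\<dots> = (\<Sum>w\<in>?w ` Q1. ev (\<Sum>x | x \<in> Q1 \<and> ?w x = w. t x) * word_val w)"
      by (simp add: ev_sum sum_distrib_right)
    finally have "\<forall>w\<in>?w ` Q1. (\<Sum>x | x \<in> Q1 \<and> ?w x = w. t x) = 0"
      by (intro words_independent) (use Q1 Suc in \<open>auto simp: Q1_def\<close>)
    then show ?thesis by (intro fin) (use Q1(2) in blast)
  qed
  then show False using x0 by (simp add: Q_def)
qed

end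

section \<open>Rational functions and the shift\<close>

text \<open>The choice is legitimate for an injective homomorphism \<open>h\<close>: its image is
  commutative, so \<open>h a * inverse (h b)\<close> does not depend on the representative even
  though the target need not commute.\<close>

definition fract_lift :: "('a::idom \<Rightarrow> 'd::division_ring) \<Rightarrow> 'a fract \<Rightarrow> 'd" where
  "fract_lift h x = (SOME d. \<exists>a b. b \<noteq> 0 \<and> x = Fract a b \<and> d = h a * inverse (h b))"

locale fract_lift_hom =
  fixes h :: "'a::idom \<Rightarrow> 'd::division_ring"
  assumes h_add: "h (a + b) = h a + h b" and h_mult: "h (a * b) = h a * h b"
    and h_1: "h 1 = 1" and h_nonzero: "a \<noteq> 0 \<Longrightarrow> h a \<noteq> 0"
begin

lemma h_commute: "h a * h b = h b * h a"
  by (metis h_mult mult.commute)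

lemma h_commute_inverse: "b \<noteq> 0 \<Longrightarrow> h a * inverse (h b) = inverse (h b) * h a"
proof -
  assume "b \<noteq> 0"
  then have nz: "h b \<noteq> 0" by (rule h_nonzero)
  then have "h a * inverse (h b) = inverse (h b) * (h b * h a) * inverse (h b)" by (simp flip: mult.assoc)
  also have "\<dots> = inverse (h b) * h a" unfolding h_commute[of b a] using nz by (simp add: mult.assoc)
  finally show ?thesis .
qed

lemma fract_lift_Fract:
  assumes "b \<noteq> 0"
  shows "fract_lift h (Fract a b) = h a * inverse (h b)"
  unfolding fract_lift_def
proof (rule some_equality)
  show "\<exists>a' b'. b' \<noteq> 0 \<and> Fract a b = Fract a' b' \<and> h a * inverse (h b) = h a' * inverse (h b')"
    using assms by blast
next
  fix d assume "\<exists>a' b'. b' \<noteq> 0 \<and> Fract a b = Fract a' b' \<and> d = h a' * inverse (h b')"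
  then obtain a' b' where ab: "b' \<noteq> 0" "Fract a b = Fract a' b'" "d = h a' * inverse (h b')" by blast
  have nz: "h b \<noteq> 0" "h b' \<noteq> 0" using assms ab(1) h_nonzero by blast+
  have "a * b' = a' * b" using ab(2) assms ab(1) by (simp add: eq_fract)
  then have "h a * h b' = h a' * h b" by (metis h_mult)
  then have "h a' = h a * h b' * inverse (h b)" using nz by (simp add: mult.assoc)
  then have "d = h a * (h b' * inverse (h b) * inverse (h b'))" unfolding ab(3) by (simp add: mult.assoc)
  also have "\<dots> = h a * inverse (h b)"
    using nz by (subst h_commute_inverse[OF assms, of b']) (simp add: mult.assoc)
  finally show "d = h a * inverse (h b)" .
qed

lemma fract_lift_mult: "fract_lift h (x * y) = fract_lift h x * fract_lift h y"
proof (cases x, cases y)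
  fix a b c d assume x: "x = Fract a b" "b \<noteq> 0" and y: "y = Fract c d" "d \<noteq> 0"
  have "fract_lift h (x * y) = h a * h c * (inverse (h d) * inverse (h b))"
    using x y h_nonzero by (simp add: fract_lift_Fract h_mult nonzero_inverse_mult_distrib)
  also have "\<dots> = h a * (h c * inverse (h d)) * inverse (h b)" by (simp add: mult.assoc)
  also have "\<dots> = h a * inverse (h b) * (h c * inverse (h d))"
  proof -
    have "inverse (h d) * inverse (h b) = inverse (h b) * inverse (h d)"
      using h_nonzero x(2) y(2) by (metis h_commute nonzero_inverse_mult_distrib)
    then show ?thesis using h_commute_inverse[OF x(2), of c]
      by (metis mult.assoc)
  qed
  finally show ?thesis using x y by (simp add: fract_lift_Fract)
qed

lemma fract_lift_embed: "fract_lift h (Fract a 1) = h a"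
  by (simp add: fract_lift_Fract h_1)

lemma fract_lift_1: "fract_lift h 1 = 1"
  by (simp add: One_fract_def fract_lift_embed h_1)

lemma fract_lift_add: "fract_lift h (x + y) = fract_lift h x + fract_lift h y"
proof (cases x, cases y)
  fix a b c d assume x: "x = Fract a b" "b \<noteq> 0" and y: "y = Fract c d" "d \<noteq> 0"
  have e: "Fract e (b * d) * Fract (b * d) 1 = Fract e 1" for e
    using x(2) y(2) by (simp add: eq_fract)
  have nz: "fract_lift h (Fract (b * d) 1) \<noteq> 0" using x(2) y(2) h_nonzero by (simp add: fract_lift_embed)
  have "x = Fract (a * d) (b * d)" "y = Fract (c * b) (b * d)" "x + y = Fract (a * d + c * b) (b * d)"
    using x y by (simp_all add: eq_fract)
  then have "fract_lift h (x + y) * fract_lift h (Fract (b * d) 1)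
    = (fract_lift h x + fract_lift h y) * fract_lift h (Fract (b * d) 1)"
    by (simp only: distrib_right fract_lift_mult[symmetric] e) (simp add: fract_lift_embed h_add)
  then show ?thesis using nz by simp
qed

end

lemma Fract_add_same: "d \<noteq> 0 \<Longrightarrow> Fract a d + Fract b d = Fract (a + b) d"
  by (simp add: eq_fract algebra_simps)

lemma Fract_sum_same: "d \<noteq> 0 \<Longrightarrow> (\<Sum>i\<in>I. Fract (g i) d) = Fract (\<Sum>i\<in>I. g i) d"
  by (induction I rule: infinite_finite_induct)
     (simp_all add: Fract_add_same fract_collapse del: add_fract)

lemma Fract_power: "d \<noteq> 0 \<Longrightarrow> Fract a d ^ n = Fract (a ^ n) (d ^ n)"
  by (induction n) (simp_all add: One_fract_def)

lemma Fract_power_common: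
  assumes "d \<noteq> 0" "i \<le> m"
  shows "Fract c 1 * Fract n d ^ Suc i = Fract (c * n ^ Suc i * d ^ (m - i)) (d ^ Suc m)"
proof -
  have "Suc m = Suc i + (m - i)" using assms(2) by simp
  then have "d ^ Suc m = d ^ Suc i * d ^ (m - i)" by (metis power_add)
  then show ?thesis using assms(1)
    by (simp only: Fract_power[OF assms(1)] mult_fract) (simp add: eq_fract mult_ac)
qed

section \<open>The shift by 2 on polynomials and rational functions\<close>

definition poly_shift :: "'k::field_char_0 poly \<Rightarrow> 'k poly" where
  "poly_shift p = pcompose p [:2, 1:]"

definition poly_unshift :: "'k::field_char_0 poly \<Rightarrow> 'k poly" where
  "poly_unshift p = pcompose p [:-2, 1:]"

lemma poly_shift_simps: "poly_shift (p + r) = poly_shift p + poly_shift r"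
  "poly_shift (p * r) = poly_shift p * poly_shift r" "poly_shift 1 = 1" "poly_shift 0 = 0"
  "poly_shift [:c:] = [:c:]" "poly (poly_shift p) x = poly p (x + 2)"
  "poly_shift (pCons a p) = [:a:] + [:2, 1:] * poly_shift p" "poly_shift (p - r) = poly_shift p - poly_shift r"
  by (simp_all add: poly_shift_def pcompose_add pcompose_mult pcompose_1 poly_pcompose
      pcompose_pCons pcompose_diff add.commute)

lemma poly_unshift_simps: "poly_unshift (p * r) = poly_unshift p * poly_unshift r"
  "poly (poly_unshift p) x = poly p (x - 2)"
  by (simp_all add: poly_unshift_def pcompose_mult poly_pcompose)

lemma poly_unshift_shift: "poly_unshift (poly_shift p) = p"
  by (simp add: poly_unshift_def poly_shift_def pcompose_assoc[symmetric] pcompose_pCons)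

lemma poly_shift_eq_0: "poly_shift p = 0 \<longleftrightarrow> p = 0"
  by (metis poly_unshift_shift poly_shift_simps(4))

lemma degree_poly_shift: "degree (poly_shift p) = degree p"
  by (simp add: poly_shift_def degree_pcompose)

lemma lead_coeff_poly_shift: "lead_coeff (poly_shift p) = lead_coeff p"
  using lead_coeff_comp[of "[:2, 1:]" p] by (simp add: poly_shift_def)

lemma poly_eq_0_on_ray:
  fixes p :: "'k::field_char_0 poly"
  assumes "\<And>n. n \<ge> N \<Longrightarrow> poly p (2 * of_nat n) = 0"
  shows "p = 0"
proof (rule ccontr)
  assume "p \<noteq> 0"
  then have "finite {x. poly p x = 0}" by (rule poly_roots_finite)
  moreover have "(\<lambda>n. 2 * of_nat n :: 'k) ` {N..} \<subseteq> {x. poly p x = 0}" using assms by auto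
  ultimately have "finite ((\<lambda>n. 2 * of_nat n :: 'k) ` {N..})" by (rule rev_finite_subset)
  then have "finite {N..}" by (rule finite_imageD) (simp add: inj_on_def)
  then show False by (simp add: infinite_Ici)
qed

lemma poly_eventually_nonzero:
  fixes r :: "'k::field_char_0 poly" and g :: "nat \<Rightarrow> 'k"
  assumes "r \<noteq> 0" "inj g"
  obtains N where "\<And>n. n \<ge> N \<Longrightarrow> poly r (g n) \<noteq> 0"
proof -
  have "finite (g -` {x. poly r x = 0})"
    using poly_roots_finite[OF assms(1)] assms(2) by (rule finite_vimageI)
  then obtain N where "\<forall>n\<in>g -` {x. poly r x = 0}. n \<le> N" by (metis finite_nat_set_iff_bounded_le)
  then have "poly r (g n) \<noteq> 0" if "n \<ge> Suc N" for n using that by auto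
  then show thesis by (rule that)
qed

text \<open>Beyond the roots of \<open>r\<close> the quotient \<open>p / r\<close> takes one value
  \<open>c\<close> at all points \<open>2 n\<close>, so \<open>p - c r\<close> has infinitely many
  roots.\<close>

lemma poly_shift_ratio_fixed:
  fixes p r :: "'k::field_char_0 poly"
  assumes "r \<noteq> 0" "poly_shift p * r = p * poly_shift r"
  shows "\<exists>c. p = smult c r"
proof -
  obtain N where N: "\<And>n. n \<ge> N \<Longrightarrow> poly r (2 * of_nat n) \<noteq> 0"
    by (rule poly_eventually_nonzero[OF assms(1), of "\<lambda>n. 2 * of_nat n"]) (auto simp: inj_def)
  let ?c = "\<lambda>n. poly p (2 * of_nat n) / poly r (2 * of_nat n)"
  have step: "?c (Suc n) = ?c n" if "n \<ge> N" for n
  proof -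
    have "poly (poly_shift p * r) (2 * of_nat n) = poly (p * poly_shift r) (2 * of_nat n)"
      by (simp add: assms(2))
    then have eq: "poly p (2 * of_nat (Suc n)) * poly r (2 * of_nat n) = poly p (2 * of_nat n) * poly r (2 * of_nat (Suc n))"
      by (simp add: poly_shift_simps algebra_simps)
    have nz: "poly r (2 * of_nat n) \<noteq> 0" "poly r (2 * of_nat (Suc n)) \<noteq> 0"
      using N[of n] N[of "Suc n"] that by simp_all
    show ?thesis unfolding frac_eq_eq[OF nz(2,1)] by (rule eq)
  qed
  have "?c n = ?c N" if "n \<ge> N" for n
    using that by (induction n rule: dec_induct) (use step in auto)
  then have "poly (p - smult (?c N) r) (2 * of_nat n) = 0" if "n \<ge> N" for n
    using N[OF that] that by (metis eq_divide_eq poly_diff poly_smult right_minus_eq)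
  then have "p - smult (?c N) r = 0" by (rule poly_eq_0_on_ray)
  then show ?thesis by auto
qed

lemma poly_shift_fixed:
  fixes p :: "'k::field_char_0 poly"
  assumes "poly_shift p = p"
  shows "\<exists>c. p = [:c:]"
  using poly_shift_ratio_fixed[of 1 p] assms by (auto simp: poly_shift_simps)

abbreviation "fract_shift \<equiv> fract_lift (\<lambda>p. Fract (poly_shift p) 1)"

interpretation fract_shift: fract_lift_hom "\<lambda>p :: 'k::field_char_0 poly. Fract (poly_shift p) 1"
  by unfold_locales (auto simp: poly_shift_simps One_fract_def Zero_fract_def eq_fract poly_shift_eq_0)

lemma fract_shift_Fract: "b \<noteq> 0 \<Longrightarrow> fract_shift (Fract a b) = Fract (poly_shift a) (poly_shift b)"
  by (simp add: fract_shift.fract_lift_Fract)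

lemma fract_shift_fixed:
  assumes "fract_shift a = a"
  shows "\<exists>c. a = Fract [:c:] 1"
proof (cases a)
  case (Fract p r)
  then have "poly_shift p * r = p * poly_shift r"
    using assms by (simp add: fract_shift_Fract eq_fract poly_shift_eq_0)
  then obtain c where "p = smult c r" using poly_shift_ratio_fixed Fract by blast
  then show ?thesis using Fract by (auto simp: eq_fract)
qed

text \<open>The shift preserves leading coefficients, so a change of sign would make the leading
  coefficient of \<open>p * r\<close> equal to its own negative.\<close>

lemma fract_shift_antifixed:
  assumes "fract_shift a = - a"
  shows "a = 0"
proof (cases a)
  case (Fract p r)
  then have "poly_shift p * r = - (p * poly_shift r)"
    using assms by (simp add: fract_shift_Fract eq_fract poly_shift_eq_0)
  then have "lead_coeff (poly_shift p * r) = lead_coeff (- (p * poly_shift r))" by simp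
  then have "lead_coeff p * lead_coeff r = - (lead_coeff p * lead_coeff r)"
    by (simp only: lead_coeff_mult lead_coeff_minus lead_coeff_poly_shift)
  then have "2 * (lead_coeff p * lead_coeff r) = 0" by (simp add: eq_neg_iff_add_eq_0)
  then have "p = 0" using Fract by simp
  then show ?thesis using Fract by (simp add: fract_collapse)
qed

section \<open>Poles along orbits of the shift\<close>

definition regular_at :: "'k::field_char_0 \<Rightarrow> 'k poly fract \<Rightarrow> bool" where
  "regular_at x g \<longleftrightarrow> (\<exists>p r. g = Fract p r \<and> poly r x \<noteq> 0)"

lemma regular_at_embed: "regular_at x (Fract p 1)"
  unfolding regular_at_def by (intro exI[of _ p] exI[of _ 1]) simp

lemma regular_at_add: "regular_at x g \<Longrightarrow> regular_at x h \<Longrightarrow> regular_at x (g + h)"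
  unfolding regular_at_def
proof (elim exE conjE)
  fix p r p' r' assume *: "g = Fract p r" "poly r x \<noteq> 0" "h = Fract p' r'" "poly r' x \<noteq> 0"
  then have "r \<noteq> 0" "r' \<noteq> 0" by auto
  with * show "\<exists>p r. g + h = Fract p r \<and> poly r x \<noteq> 0"
    by (intro exI[of _ "p * r' + p' * r"] exI[of _ "r * r'"]) simp
qed

lemma regular_at_mult: "regular_at x g \<Longrightarrow> regular_at x h \<Longrightarrow> regular_at x (g * h)"
  unfolding regular_at_def
proof (elim exE conjE)
  fix p r p' r' assume "g = Fract p r" "poly r x \<noteq> 0" "h = Fract p' r'" "poly r' x \<noteq> 0"
  then show "\<exists>p r. g * h = Fract p r \<and> poly r x \<noteq> 0"
    by (intro exI[of _ "p * p'"] exI[of _ "r * r'"]) simp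
qed

lemma regular_at_power: "regular_at x g \<Longrightarrow> regular_at x (g ^ n)"
  by (induction n) (auto simp: regular_at_mult One_fract_def regular_at_embed)

lemma regular_at_sum: "(\<And>i. i \<in> I \<Longrightarrow> regular_at x (g i)) \<Longrightarrow> regular_at x (sum g I)"
  by (induction I rule: infinite_finite_induct) (auto simp: regular_at_add Zero_fract_def regular_at_embed)

lemma regular_at_sign:
  assumes "l = 1 \<or> l = - 1"
  shows "regular_at x l"
proof -
  have "l = Fract 1 1 \<or> l = Fract (- 1) 1" using assms by (auto simp: One_fract_def)
  then show ?thesis using regular_at_embed by metis
qed

lemma regular_at_shift_iff: "regular_at x (fract_shift g) \<longleftrightarrow> regular_at (x + 2) g"
proof
  assume "regular_at (x + 2) g"
  then obtain p r where g: "g = Fract p r" "poly r (x + 2) \<noteq> 0" by (auto simp: regular_at_def)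
  then have "r \<noteq> 0" by auto
  then show "regular_at x (fract_shift g)" unfolding regular_at_def
    by (intro exI[of _ "poly_shift p"] exI[of _ "poly_shift r"]) (use g in \<open>simp add: fract_shift_Fract poly_shift_simps\<close>)
next
  assume "regular_at x (fract_shift g)"
  then obtain p r where g: "fract_shift g = Fract p r" "poly r x \<noteq> 0" by (auto simp: regular_at_def)
  then have r0: "r \<noteq> 0" by auto
  show "regular_at (x + 2) g"
  proof (cases g)
    case (Fract a b)
    then have "poly_shift a * r = p * poly_shift b"
      using g r0 by (simp add: fract_shift_Fract eq_fract poly_shift_eq_0)
    then have "poly_unshift (poly_shift a * r) = poly_unshift (p * poly_shift b)" by simp
    then have "a * poly_unshift r = poly_unshift p * b" by (simp add: poly_unshift_simps poly_unshift_shift)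
    moreover have x: "poly (poly_unshift r) (x + 2) \<noteq> 0" using g(2) by (simp add: poly_unshift_simps)
    moreover from x have "poly_unshift r \<noteq> 0" by auto
    ultimately have "g = Fract (poly_unshift p) (poly_unshift r)" using Fract by (simp add: eq_fract)
    then show ?thesis using x unfolding regular_at_def by blast
  qed
qed

lemma regular_at_eventually:
  fixes \<beta> :: "'k::field_char_0" and g :: "'k poly fract"
  shows "\<exists>N. \<forall>n\<ge>N. regular_at (\<beta> + 2 * of_nat n) g \<and> regular_at (\<beta> - 2 * of_nat n) g"
proof (cases g)
  case (Fract p r)
  obtain N where N: "\<And>n. n \<ge> N \<Longrightarrow> poly r (\<beta> + 2 * of_nat n) \<noteq> 0"
    by (rule poly_eventually_nonzero[OF Fract(2), of "\<lambda>n. \<beta> + 2 * of_nat n"]) (auto simp: inj_def)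
  obtain N' where N': "\<And>n. n \<ge> N' \<Longrightarrow> poly r (\<beta> - 2 * of_nat n) \<noteq> 0"
    by (rule poly_eventually_nonzero[OF Fract(2), of "\<lambda>n. \<beta> - 2 * of_nat n"]) (auto simp: inj_def)
  show ?thesis
    by (intro exI[of _ "max N N'"]) (use N N' Fract in \<open>auto simp: regular_at_def\<close>)
qed

text \<open>A pole of \<open>\<sigma> g - l g\<close> on an orbit of the shift is never alone there: the first
  and the last pole of \<open>g\<close> on the orbit survive in two different places.\<close>

lemma isolated_pole_not_difference:
  fixes \<beta> :: "'k::field_char_0"
  assumes l: "l = 1 \<or> l = - 1"
    and reg: "\<And>n. n > 0 \<Longrightarrow> regular_at (\<beta> + 2 * of_nat n) (fract_shift g - l * g)
      \<and> regular_at (\<beta> - 2 * of_nat n) (fract_shift g - l * g)"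
  shows "regular_at \<beta> (fract_shift g - l * g)"
proof -
  define h where "h = fract_shift g - l * g"
  have ll: "l * l = 1" using l by auto
  have sg: "fract_shift g = h + l * g" by (simp add: h_def)
  have g: "g = l * fract_shift g + (- l) * h"
    unfolding sg using ll by (simp add: algebra_simps)
  have nl: "- l = 1 \<or> - l = - 1" using l by auto
  obtain N where N: "\<And>n. n \<ge> N \<Longrightarrow> regular_at (\<beta> + 2 * of_nat n) g \<and> regular_at (\<beta> - 2 * of_nat n) g"
    using regular_at_eventually by blast
  have up: "regular_at x (fract_shift g)" if "regular_at x g" "regular_at x h" for x
    unfolding sg by (intro regular_at_add regular_at_mult regular_at_sign[OF l] that)
  have down: "regular_at x g" if "regular_at x (fract_shift g)" "regular_at x h" for x
    by (subst g) (intro regular_at_add regular_at_mult regular_at_sign[OF l] regular_at_sign[OF nl] that)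
  \<comment> \<open>Regularity of \<open>g\<close> travels from both far ends of the orbit towards
    \<open>\<beta>\<close>: from the right down to \<open>\<beta> + 2\<close>, from the left up to
    \<open>\<beta>\<close>, without using \<open>h\<close> at \<open>\<beta>\<close> itself.\<close>
  have right: "regular_at (\<beta> + 2 * of_nat (Suc n)) g" for n
  proof (induction "N - Suc n" arbitrary: n)
    case 0
    then show ?case using N[of "Suc n"] by simp
  next
    case (Suc m)
    then have "regular_at (\<beta> + 2 * of_nat (Suc n) + 2) g" using Suc(1)[of "Suc n"] by (simp add: algebra_simps)
    then show ?case using reg[of "Suc n"] by (intro down) (simp_all add: regular_at_shift_iff h_def)
  qed
  have left: "regular_at (\<beta> - 2 * of_nat n) g" for n
  proof (induction "N - n" arbitrary: n)
    case 0
    then show ?case using N[of n] by simp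
  next
    case (Suc m)
    then have "regular_at (\<beta> - 2 * of_nat (Suc n)) g" using Suc(1)[of "Suc n"] by simp
    then have "regular_at (\<beta> - 2 * of_nat (Suc n)) (fract_shift g)"
      using reg[of "Suc n"] by (intro up) (simp_all add: h_def)
    then show ?case by (simp add: regular_at_shift_iff algebra_simps)
  qed
  have "regular_at \<beta> (fract_shift g)" using right[of 0] by (simp add: regular_at_shift_iff)
  moreover have "regular_at \<beta> g" using left[of 0] by simp
  ultimately have "regular_at \<beta> (fract_shift g + (- l) * g)"
    by (intro regular_at_add regular_at_mult regular_at_sign[OF nl])
  then show ?thesis by simp
qed

definition cross_ratio :: "'k::field_char_0 poly fract" where
  "cross_ratio = Fract [:- (1/3), 1:] [:1/3, 1:]"

definition symm_ratio :: "'k::field_char_0 poly fract" where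
  "symm_ratio = cross_ratio + inverse cross_ratio"

lemma symm_ratio_eq: "symm_ratio = Fract ([:- (1/3), 1:]^2 + [:1/3, 1:]^2) ([:- (1/3), 1:] * [:1/3, 1:])"
  by (simp add: symm_ratio_def cross_ratio_def power2_eq_square mult.commute)

text \<open>Let \<open>m\<close> be the largest index with a nonzero constant. Over the common
  denominator only the term of \<open>m\<close> survives in the numerator at 1/3, so the sum has a
  pole there; it is the only one on its orbit, which \<open>isolated_pole_not_difference\<close>
  excludes.\<close>

lemma symm_ratio_no_difference:
  fixes c :: "nat \<Rightarrow> 'k::field_char_0"
  assumes I: "finite I" and l: "l = 1 \<or> l = - 1"
    and eq: "fract_shift a - l * a = (\<Sum>i\<in>I. Fract [:c i:] 1 * symm_ratio ^ Suc i)" and i: "i \<in> I"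
  shows "c i = 0"
proof (rule ccontr)
  assume "c i \<noteq> 0"
  define I' where "I' = {i \<in> I. c i \<noteq> 0}"
  have I': "finite I'" "i \<in> I'" using I i \<open>c i \<noteq> 0\<close> by (auto simp: I'_def)
  let ?n = "[:- (1/3), 1:]^2 + [:1/3, 1:]^2 :: 'k poly" and ?d = "[:- (1/3), 1:] * [:1/3, 1:] :: 'k poly"
  have d0: "?d \<noteq> 0" by (metis mult_eq_0_iff one_neq_zero pCons_eq_0_iff)
  define h where "h = (\<Sum>i\<in>I. Fract [:c i:] 1 * symm_ratio ^ Suc i)"
  have h': "h = (\<Sum>i\<in>I'. Fract [:c i:] 1 * symm_ratio ^ Suc i)"
    unfolding h_def by (rule sum.mono_neutral_right) (auto simp: I'_def I fract_collapse)
  define m where "m = Max I'"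
  have "m \<in> I'" unfolding m_def by (rule Max_in) (use I' in auto)
  then have m: "m \<in> I'" "\<And>i. i \<in> I' \<Longrightarrow> i \<le> m" using I' by (simp_all add: m_def)
  define Q where "Q = (\<Sum>i\<in>I'. [:c i:] * ?n ^ Suc i * ?d ^ (m - i))"
  have "h = (\<Sum>i\<in>I'. Fract ([:c i:] * ?n ^ Suc i * ?d ^ (m - i)) (?d ^ Suc m))"
    unfolding h'
  proof (intro sum.cong refl)
    fix i assume "i \<in> I'"
    then show "Fract [:c i:] 1 * symm_ratio ^ Suc i = Fract ([:c i:] * ?n ^ Suc i * ?d ^ (m - i)) (?d ^ Suc m)"
      unfolding symm_ratio_eq by (intro Fract_power_common d0 m(2))
  qed
  then have hQ: "h = Fract Q (?d ^ Suc m)" unfolding Q_def by (simp only: Fract_sum_same[OF power_not_zero[OF d0]])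
  have "poly Q (1/3) = (\<Sum>i\<in>I'. if i = m then c m * poly ?n (1/3) ^ Suc m else 0)"
    unfolding Q_def poly_sum
  proof (intro sum.cong refl)
    fix i assume "i \<in> I'"
    then have "i \<noteq> m \<Longrightarrow> m - i \<noteq> 0" using m(2)[of i] by simp
    then show "poly ([:c i:] * ?n ^ Suc i * ?d ^ (m - i)) (1/3) = (if i = m then c m * poly ?n (1/3) ^ Suc m else 0)"
      by (auto simp: poly_power)
  qed
  also have "\<dots> = c m * poly ?n (1/3) ^ Suc m" using I' m(1) by simp
  finally have "poly Q (1/3) = c m * poly ?n (1/3) ^ Suc m" .
  moreover have "poly ?n (1/3) \<noteq> 0" by (simp add: power2_eq_square)
  moreover have "c m \<noteq> 0" using m(1) by (simp add: I'_def)
  ultimately have Q: "poly Q (1/3) \<noteq> 0" by (metis no_zero_divisors power_not_zero)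
  have "regular_at (1/3) h"
    unfolding h_def eq[symmetric]
  proof (rule isolated_pole_not_difference[OF l], unfold eq)
    fix n :: nat assume n: "n > 0"
    have rs: "regular_at x symm_ratio" if "x - (1/3) \<noteq> 0" "x + 1/3 \<noteq> 0" for x :: 'k
    proof -
      have "poly ?d x = (x - 1/3) * (x + 1/3)" unfolding poly_mult by simp
      then have "poly ?d x \<noteq> 0" using that by simp
      then show ?thesis unfolding symm_ratio_eq regular_at_def by blast
    qed
    \<comment> \<open>The other pole -1/3 is off the orbit of 1/3: otherwise 2/3 would be an even
      integer.\<close>
    have "1/3 + 2 * of_nat n + 1/3 \<noteq> (0 :: 'k)"
    proof
      assume "1/3 + 2 * of_nat n + 1/3 = (0 :: 'k)"
      then have "of_nat (2 + 6 * n) = (0 :: 'k)" by (simp add: field_simps)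
      then show False by (simp only: of_nat_eq_0_iff)
    qed
    moreover have "1/3 - 2 * of_nat n + 1/3 \<noteq> (0 :: 'k)"
    proof
      assume "1/3 - 2 * of_nat n + 1/3 = (0 :: 'k)"
      then have "of_nat (6 * n) = (of_nat 2 :: 'k)" by (simp add: field_simps)
      then have "6 * n = 2" by (simp only: of_nat_eq_iff)
      then show False by presburger
    qed
    ultimately show "regular_at (1/3 + 2 * of_nat n) (\<Sum>i\<in>I. Fract [:c i:] 1 * symm_ratio ^ Suc i)
      \<and> regular_at (1/3 - 2 * of_nat n) (\<Sum>i\<in>I. Fract [:c i:] 1 * symm_ratio ^ Suc i)"
      using n by (intro conjI regular_at_sum regular_at_mult regular_at_embed regular_at_power rs) auto
  qed
  then obtain p r where h: "h = Fract p r" "poly r (1/3) \<noteq> 0" by (auto simp: regular_at_def)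
  then have "r \<noteq> 0" by auto
  then have "Q * r = p * ?d ^ Suc m" using h(1) hQ d0 by (metis eq_fract(1) power_not_zero)
  then have "poly (Q * r) (1/3) = poly (p * ?d ^ Suc m) (1/3)" by simp
  then show False using Q h(2) by (simp add: poly_power)
qed

text \<open>The local form of a theorem of Cauchon: a Weyl relation modulo the maximal ideal suffices
  for freeness.\<close>

locale weyl_residue = residue_ring R M
  for R M :: "'d::division_ring set" +
  fixes eps :: "'k::field_char_0 \<Rightarrow> 'd" and q z :: 'd
  assumes eps: "central_alg_map eps" and eps_R: "eps c \<in> R" and q_R: "q \<in> R"
    and z_R: "z \<in> R" and z_M: "z \<notin> M" and zq: "z * q \<approx> (q + 2) * z"
begin

lemma eps_hom: "eps 0 = 0" "eps 1 = 1" "eps (a + b) = eps a + eps b" "eps (a * b) = eps a * eps b"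
  and eps_central: "eps a * d = d * eps a"
  using eps unfolding central_alg_map_def by blast+

lemma eps_2: "eps 2 = 2"
  using eps_hom(3)[of 1 1] by (simp add: eps_hom)

definition eval_q :: "'k poly \<Rightarrow> 'd" where
  "eval_q p = fold_coeffs (\<lambda>a x. eps a + q * x) p 0"

lemma eval_q_0: "eval_q 0 = 0"
  by (simp add: eval_q_def)

lemma eval_q_pCons: "eval_q (pCons a p) = eps a + q * eval_q p"
  by (cases "p = 0"; cases "a = 0") (simp_all add: eval_q_def eps_hom)

lemma eval_q_const: "eval_q [:a:] = eps a"
  by (simp add: eval_q_pCons eval_q_0)

lemma eval_q_add: "eval_q (p + r) = eval_q p + eval_q r"
  by (induction p r rule: poly_induct2) (simp_all add: eval_q_pCons eval_q_0 eps_hom algebra_simps)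

lemma eval_q_smult: "eval_q (smult a p) = eps a * eval_q p"
proof (induction p)
  case (pCons b p)
  have "q * (eps a * x) = eps a * (q * x)" for x by (metis eps_central mult.assoc)
  then show ?case using pCons by (simp add: eval_q_pCons eps_hom distrib_left)
qed (simp add: eval_q_0)

lemma eval_q_mult: "eval_q (p * r) = eval_q p * eval_q r"
proof (induction p)
  case (pCons a p)
  then show ?case
    by (simp add: mult_pCons_left eval_q_add eval_q_smult eval_q_pCons eps_hom distrib_right mult.assoc)
qed (simp add: eval_q_0)

lemma eval_q_1: "eval_q 1 = 1"
  using eval_q_const[of 1] by (simp add: eps_hom one_pCons)

lemma eval_q_R: "eval_q p \<in> R"
  by (induction p) (auto simp: eval_q_0 zero_R eval_q_pCons intro: add_R mult_R eps_R q_R)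

lemma eval_q_diff: "eval_q (p - r) = eval_q p - eval_q r"
  using eval_q_add[of "p - r" r] by simp

lemma z_eval_q: "z * eval_q p \<approx> eval_q (poly_shift p) * z"
proof (induction p)
  case (pCons a p)
  have "z * eval_q (pCons a p) = eps a * z + z * q * eval_q p"
    by (simp add: eval_q_pCons distrib_left mult.assoc eps_central)
  also have "\<dots> \<approx> eps a * z + (q + 2) * z * eval_q p"
    by (intro cong_add cong_refl cong_mult_right eval_q_R zq)
  also have "(q + 2) * z * eval_q p = (q + 2) * (z * eval_q p)" by (rule mult.assoc)
  also have "eps a * z + \<dots> \<approx> eps a * z + (q + 2) * (eval_q (poly_shift p) * z)"
  proof (intro cong_add cong_refl cong_mult_left pCons)
    show "q + 2 \<in> R" using add_R[OF q_R eps_R[of 2]] by (simp add: eps_2)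
  qed
  also have "\<dots> = eval_q (poly_shift (pCons a p)) * z"
    unfolding poly_shift_simps eval_q_add eval_q_mult
    by (simp add: eval_q_pCons eval_q_0 eps_hom eps_2 distrib_right mult.assoc add.commute[of 2])
  finally show ?case .
qed (simp add: eval_q_0 poly_shift_simps)

lemma eps_notin_M: "c \<noteq> 0 \<Longrightarrow> eps c \<notin> M"
proof
  assume "c \<noteq> 0" "eps c \<in> M"
  then have "eps (inverse c * c) \<in> M" unfolding eps_hom by (intro mult_RM eps_R)
  then show False using \<open>c \<noteq> 0\<close> one_M by (simp add: eps_hom)
qed

text \<open>Multiplication by \<open>z\<close> carries a value p(q) in \<open>M\<close> to p(q + 2)
  in \<open>M\<close>. Their difference comes from a polynomial of smaller degree, so a
  counterexample of least degree is invariant under the shift, hence constant, and nonzero constants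
  are not in \<open>M\<close>.\<close>

lemma eval_q_notin_M: "p \<noteq> 0 \<Longrightarrow> eval_q p \<notin> M"
proof (induction "degree p" arbitrary: p rule: less_induct)
  case less
  show ?case
  proof
    assume pM: "eval_q p \<in> M"
    then have "z * eval_q p \<in> M" by (rule mult_RM[OF z_R])
    then have "eval_q (poly_shift p) * z \<in> M" using cong_M[OF z_eval_q] by blast
    then have "eval_q (poly_shift p) \<in> M" using mult_notin_M[OF eval_q_R z_R _ z_M] by blast
    then have dM: "eval_q (poly_shift p - p) \<in> M" unfolding eval_q_diff using pM by (rule diff_M)
    have "poly_shift p = p"
    proof (rule ccontr)
      assume ne: "poly_shift p \<noteq> p"
      have "coeff (poly_shift p - p) (degree p) = 0"
        using lead_coeff_poly_shift[of p] by (simp add: degree_poly_shift)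
      moreover have "degree (poly_shift p - p) \<le> degree p"
        by (rule degree_diff_le) (simp_all add: degree_poly_shift)
      ultimately have "degree (poly_shift p - p) < degree p"
        using ne by (metis eq_zero_or_degree_less le_eq_less_or_eq leading_coeff_0_iff right_minus_eq)
      then show False using less.hyps[of "poly_shift p - p"] ne dM by simp
    qed
    then obtain c where c: "p = [:c:]" using poly_shift_fixed by blast
    then show False using less.prems pM eps_notin_M by (auto simp: eval_q_const)
  qed
qed

sublocale eval: fract_lift_hom eval_q
  by unfold_locales (use eval_q_add eval_q_mult eval_q_1 eval_q_notin_M zero_M in \<open>auto, metis\<close>)

lemma z_eval_fract: "z * fract_lift eval_q a \<approx> fract_lift eval_q (fract_shift a) * z"
proof (cases a)
  case (Fract p r)
  let ?p = "eval_q p" and ?r = "eval_q r" and ?p' = "eval_q (poly_shift p)" and ?r' = "eval_q (poly_shift r)"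
  have nz: "?r \<noteq> 0" "?r' \<noteq> 0" "?r \<notin> M" "?r' \<notin> M"
    using eval_q_notin_M Fract(2) poly_shift_eq_0 eval.h_nonzero by blast+
  have iR: "inverse ?r \<in> R" "inverse ?r' \<in> R" using inverse_R[OF eval_q_R] nz by blast+
  have "z * inverse ?r = inverse ?r' * (?r' * z) * inverse ?r" using nz by (simp flip: mult.assoc)
  also have "\<dots> \<approx> inverse ?r' * (z * ?r) * inverse ?r"
    by (intro cong_mult_right cong_mult_left iR cong_sym[OF z_eval_q])
  also have "\<dots> = inverse ?r' * z" using nz by (simp add: mult.assoc)
  finally have 1: "z * inverse ?r \<approx> inverse ?r' * z" .
  have "z * (?p * inverse ?r) = z * ?p * inverse ?r" by (simp add: mult.assoc)
  also have "\<dots> \<approx> ?p' * z * inverse ?r" by (intro cong_mult_right iR z_eval_q)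
  also have "?p' * z * inverse ?r = ?p' * (z * inverse ?r)" by (rule mult.assoc)
  also have "\<dots> \<approx> ?p' * (inverse ?r' * z)" by (intro cong_mult_left eval_q_R 1)
  finally show ?thesis
    using Fract by (simp add: eval.fract_lift_Fract fract_shift_Fract poly_shift_eq_0 mult.assoc)
qed

lemma eval_fract_R: "fract_lift eval_q a \<in> R"
proof (cases a)
  case (Fract p r)
  then show ?thesis by (simp add: eval.fract_lift_Fract mult_R eval_q_R inverse_R eval_q_notin_M)
qed

sublocale skew_residue R M "fract_lift eval_q" fract_shift "\<lambda>c. Fract [:c:] 1" z symm_ratio "Fract [:0, 1:] 1"
proof unfold_locales
  show "of_nat n \<noteq> (0 :: 'k poly fract)" if "n > 0" for n
    using that by (simp add: of_nat_fract Zero_fract_def eq_fract)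
  show "fract_shift (Fract [:0, 1:] 1) = Fract [:0, 1 :: 'k:] 1 + 2"
  proof -
    have two: "(2 :: 'k poly fract) = Fract [:2:] 1"
      using of_nat_fract[of 2, where 'a = "'k poly"] by (simp add: of_nat_poly numeral_poly)
    show ?thesis unfolding two by (simp add: fract_shift.fract_lift_embed poly_shift_simps)
  qed
  show "Fract [:0:] 1 = (0 :: 'k poly fract)" by (simp add: Zero_fract_def)
  show "fract_shift (Fract [:c:] 1) = Fract [:c:] 1" for c :: 'k
    by (simp add: fract_shift.fract_lift_embed poly_shift_simps)
  show "z * fract_lift eval_q a - fract_lift eval_q (fract_shift a) * z \<in> M" for a
    using z_eval_fract by (simp add: cong_def)
qed (rule eval.fract_lift_1 eval.fract_lift_add eval.fract_lift_mult eval_fract_R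
   fract_shift.fract_lift_1 fract_shift.fract_lift_add fract_shift.fract_lift_mult
   fract_shift_fixed fract_shift_antifixed symm_ratio_no_difference z_R z_M | assumption)+

lemma q_notin_M: "q + eps c \<notin> M"
  using eval_q_notin_M[of "[:c, 1:]"] by (simp add: eval_q_pCons eval_q_0 eps_hom add.commute)

lemma eval_symm_ratio:
  "fract_lift eval_q symm_ratio = (q - eps (1/3)) * inverse (q + eps (1/3)) + inverse (q - eps (1/3)) * (q + eps (1/3))"
proof -
  have m: "eps (- (1/3)) = - eps (1/3)"
    using eps_hom(3)[of "1/3" "- (1/3)"] by (simp add: eps_hom eq_neg_iff_add_eq_0 add.commute)
  have e: "eval_q [:- (1/3), 1:] = q - eps (1/3)" "eval_q [:1/3, 1:] = q + eps (1/3)"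
    unfolding eval_q_pCons eval_q_0 m by (simp_all add: eps_hom add.commute)
  have i: "inverse cross_ratio = Fract [:1/3, 1 :: 'k:] [:- (1/3), 1:]" by (simp add: cross_ratio_def)
  have "(q + eps (1/3)) * inverse (q - eps (1/3)) = inverse (q - eps (1/3)) * (q + eps (1/3))"
    using eval.h_commute_inverse[of "[:- (1/3), 1:]" "[:1/3, 1:]"] by (simp add: e)
  then show ?thesis unfolding symm_ratio_def eval.fract_lift_add i
    by (simp add: cross_ratio_def eval.fract_lift_Fract e)
qed

theorem weyl_pair_free:
  assumes S: "S \<in> R" "S \<approx> (q - eps (1/3)) * inverse (q + eps (1/3)) + inverse (q - eps (1/3)) * (q + eps (1/3))"
    and T: "T \<approx> inverse (1 + z) * (1 - z) * S * ((1 + z) * inverse (1 - z))"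
  shows "free_on_pair eps S T"
  unfolding free_on_pair_def
proof (intro ballI impI)
  fix p :: "bool list \<Rightarrow> 'k"
  assume p: "p \<in> free_alg" and rel: "fa_eval eps (\<lambda>b. if b then S else T) p = 0"
  have S': "S \<approx> fract_lift eval_q symm_ratio" using S(2) by (simp add: eval_symm_ratio)
  have T': "T \<approx> cayley True * S * cayley False" using T by (simp add: cayley_eq)
  have "T \<in> R" using cong_R[OF T'] S(1) mult_R cayley_R by blast
  moreover have "T \<approx> cayley True * fract_lift eval_q symm_ratio * cayley False"
    using T' cong_mult_right[OF cayley_R cong_mult_left[OF cayley_R S']] by (rule cong_trans)
  moreover have "(\<lambda>c. fract_lift eval_q (Fract [:c:] 1)) = eps"
    by (simp add: fun_eq_iff eval.fract_lift_embed eval_q_const)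
  ultimately show "p = (\<lambda>_. 0)"
    using cayley_conjugates_free[OF p S(1) S', of T] rel by simp
qed

end

section \<open>Valuations\<close>

text \<open>A valuation with the sign of a degree: sums are bounded by the maximum, the valuation
  ring is \<open>deg_le 0\<close> and its maximal ideal \<open>deg_le (- 1)\<close>. The value at 0
  is arbitrary, hence the premises that exclude it.\<close>

locale division_valuation =
  fixes val :: "'d::division_ring \<Rightarrow> int"
  assumes val_mult: "x \<noteq> 0 \<Longrightarrow> y \<noteq> 0 \<Longrightarrow> val (x * y) = val x + val y"
    and val_add: "x \<noteq> 0 \<Longrightarrow> y \<noteq> 0 \<Longrightarrow> x + y \<noteq> 0 \<Longrightarrow> val (x + y) \<le> max (val x) (val y)"
begin

definition deg_le :: "int \<Rightarrow> 'd set" where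
  "deg_le n = {x. x = 0 \<or> val x \<le> n}"

lemma val_1: "val 1 = 0"
  using val_mult[of 1 1] by simp

lemma val_minus: "val (- x) = val x"
proof (cases "x = 0")
  case False
  have "val (- 1) = 0" using val_mult[of "- 1" "- 1"] val_1 by simp
  then show ?thesis using val_mult[of "- 1" x] False by simp
qed simp

lemma val_inverse: "x \<noteq> 0 \<Longrightarrow> val (inverse x) = - val x"
  using val_mult[of x "inverse x"] val_1 by simp

lemma deg_le_add: "x \<in> deg_le n \<Longrightarrow> y \<in> deg_le n \<Longrightarrow> x + y \<in> deg_le n"
  using val_add[of x y] by (cases "x = 0"; cases "y = 0"; cases "x + y = 0") (auto simp: deg_le_def)

lemma deg_le_minus: "x \<in> deg_le n \<Longrightarrow> - x \<in> deg_le n"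
  by (auto simp: deg_le_def val_minus)

lemma deg_le_diff: "x \<in> deg_le n \<Longrightarrow> y \<in> deg_le n \<Longrightarrow> x - y \<in> deg_le n"
  using deg_le_add[of x n "- y"] deg_le_minus by simp

lemma deg_le_mult: "x \<in> deg_le m \<Longrightarrow> y \<in> deg_le n \<Longrightarrow> m + n = k \<Longrightarrow> x * y \<in> deg_le k"
  using val_mult[of x y] by (cases "x = 0"; cases "y = 0") (simp_all add: deg_le_def)

lemma deg_le_mono: "x \<in> deg_le m \<Longrightarrow> m \<le> n \<Longrightarrow> x \<in> deg_le n"
  by (auto simp: deg_le_def)

lemma deg_le_0: "0 \<in> deg_le n"
  by (simp add: deg_le_def)

sublocale residue_ring "deg_le 0" "deg_le (- 1)"
proof
  show "1 \<in> deg_le 0" "1 \<notin> deg_le (- 1)" by (simp_all add: deg_le_def val_1)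
  show "deg_le (- 1) \<subseteq> deg_le 0" by (auto intro: deg_le_mono)
next
  fix x assume "x \<in> deg_le 0" "x \<notin> deg_le (- 1)"
  then show "inverse x \<in> deg_le 0" by (auto simp: deg_le_def val_inverse)
qed (simp_all add: deg_le_0 deg_le_add deg_le_minus deg_le_mult)

notation cong (infix "\<approx>" 50)

end

text \<open>The value of \<open>a * inverse b\<close> is \<open>dg a - dg b\<close>. Independence of
  the representative and the laws for sums and products all follow by clearing denominators with the
  Ore condition.\<close>

lemma ore_valuation_exists:
  fixes U :: "'d::division_ring set" and dg :: "'d \<Rightarrow> nat"
  assumes U: "1 \<in> U" "\<And>a b. a \<in> U \<Longrightarrow> b \<in> U \<Longrightarrow> a + b \<in> U \<and> a * b \<in> U"
    and dg_mult: "\<And>a b. a \<in> U \<Longrightarrow> b \<in> U \<Longrightarrow> a \<noteq> 0 \<Longrightarrow> b \<noteq> 0 \<Longrightarrow> dg (a * b) = dg a + dg b"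
    and dg_add: "\<And>a b. a \<in> U \<Longrightarrow> b \<in> U \<Longrightarrow> a + b \<noteq> 0 \<Longrightarrow> a \<noteq> 0 \<Longrightarrow> b \<noteq> 0 \<Longrightarrow> dg (a + b) \<le> max (dg a) (dg b)"
    and frac: "\<And>d. \<exists>a\<in>U. \<exists>b\<in>U. b \<noteq> 0 \<and> d = a * inverse b"
  shows "\<exists>val. division_valuation val \<and> (\<forall>a\<in>U. a \<noteq> 0 \<longrightarrow> val a = int (dg a))"
proof -
  \<comment> \<open>The Ore condition is contained in \<open>frac\<close>: write
    \<open>inverse b * d\<close> as a fraction and clear denominators.\<close>
  have ore: "\<exists>e\<in>U. \<exists>g\<in>U. g \<noteq> 0 \<and> d * g = b * e" if "b \<noteq> 0" for b d
  proof -
    obtain e g where eg: "e \<in> U" "g \<in> U" "g \<noteq> 0" "inverse b * d = e * inverse g" using frac by blast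
    have "b * (inverse b * d) * g = b * (e * inverse g) * g" by (simp add: eg(4))
    then have "d * g = b * e" using that eg(3) by (simp add: mult.assoc[symmetric]) (simp add: mult.assoc)
    then show ?thesis using eg by blast
  qed
  have unique: "int (dg a) - int (dg b) = int (dg c) - int (dg d)"
    if "a \<in> U" "b \<in> U" "c \<in> U" "d \<in> U" "b \<noteq> 0" "d \<noteq> 0" "a \<noteq> 0" and eq: "a * inverse b = c * inverse d" for a b c d
  proof -
    obtain e g where eg: "e \<in> U" "g \<in> U" "g \<noteq> 0" "d * g = b * e" using ore[OF \<open>b \<noteq> 0\<close>] by blast
    have e0: "e \<noteq> 0" using eg that by auto
    have c0: "c \<noteq> 0" using eq that by auto
    have "inverse b * (b * e) = e" "inverse d * (d * g) = g"
      using \<open>b \<noteq> 0\<close> \<open>d \<noteq> 0\<close> by (simp_all flip: mult.assoc)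
    moreover have "a * inverse b * (b * e) = c * inverse d * (d * g)" by (simp only: eq eg(4))
    ultimately have "a * e = c * g" by (simp only: mult.assoc)
    then have "dg a + dg e = dg c + dg g" using dg_mult[of a e] dg_mult[of c g] eg that e0 c0 by simp
    moreover have "dg d + dg g = dg b + dg e" using dg_mult[of d g] dg_mult[of b e] eg that e0 by simp
    ultimately show ?thesis by simp
  qed
  define val where "val x = (SOME n. \<exists>a\<in>U. \<exists>b\<in>U. b \<noteq> 0 \<and> x = a * inverse b \<and> n = int (dg a) - int (dg b))" for x
  have val: "val (a * inverse b) = int (dg a) - int (dg b)" if "a \<in> U" "b \<in> U" "a \<noteq> 0" "b \<noteq> 0" for a b
    unfolding val_def
  proof (rule some_equality)
    fix n assume "\<exists>a'\<in>U. \<exists>b'\<in>U. b' \<noteq> 0 \<and> a * inverse b = a' * inverse b' \<and> n = int (dg a') - int (dg b')"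
    then obtain c d where "c \<in> U" "d \<in> U" "d \<noteq> 0" "a * inverse b = c * inverse d" "n = int (dg c) - int (dg d)"
      by blast
    then show "n = int (dg a) - int (dg b)" using unique[of a b c d] that by simp
  qed (use that in blast)
  have "division_valuation val"
  proof
    fix x y :: 'd assume x0: "x \<noteq> 0" and y0: "y \<noteq> 0"
    obtain a b where ab: "a \<in> U" "b \<in> U" "b \<noteq> 0" "x = a * inverse b" using frac by blast
    obtain c d where cd: "c \<in> U" "d \<in> U" "d \<noteq> 0" "y = c * inverse d" using frac by blast
    have a0: "a \<noteq> 0" and c0: "c \<noteq> 0" using x0 y0 ab cd by auto
    {
      obtain e g where eg: "e \<in> U" "g \<in> U" "g \<noteq> 0" "c * g = b * e" using ore[OF ab(3)] by blast
      have e0: "e \<noteq> 0" using eg ab c0 by auto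
      have "inverse b * c = e * inverse g"
      proof -
        have "inverse b * (c * g) * inverse g = inverse b * (b * e) * inverse g" by (simp add: eg(4))
        then show ?thesis using ab(3) eg(3) by (simp add: mult.assoc) (simp add: mult.assoc[symmetric])
      qed
      then have "x * y = a * (e * inverse g) * inverse d"
        unfolding ab(4) cd(4) by (metis mult.assoc)
      also have "\<dots> = (a * e) * inverse (d * g)"
        using eg(3) cd(3) by (simp add: nonzero_inverse_mult_distrib mult.assoc)
      finally have "val (x * y) = int (dg (a * e)) - int (dg (d * g))"
        using val[of "a * e" "d * g"] U ab cd eg a0 e0 by simp
      moreover have "dg c + dg g = dg b + dg e"
        using dg_mult[of c g] dg_mult[of b e] eg ab cd e0 c0 by simp
      ultimately show "val (x * y) = val x + val y"
        unfolding ab(4) cd(4) using val ab(1-3) cd(1-3) eg a0 c0 e0 by (simp add: dg_mult)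
    }
    assume xy0: "x + y \<noteq> 0"
    obtain e g where eg: "e \<in> U" "g \<in> U" "g \<noteq> 0" "d * g = b * e" using ore[OF ab(3)] by blast
    have e0: "e \<noteq> 0" using eg ab cd by auto
    have x: "x = (a * e) * inverse (b * e)"
      using ab(3,4) e0 by (simp add: nonzero_inverse_mult_distrib mult.assoc) (simp add: mult.assoc[symmetric])
    have y: "y = (c * g) * inverse (b * e)"
      unfolding eg(4)[symmetric] using cd(3,4) eg(3)
      by (simp add: nonzero_inverse_mult_distrib mult.assoc) (simp add: mult.assoc[symmetric])
    have xy: "x + y = (a * e + c * g) * inverse (b * e)" by (simp only: x y distrib_right)
    have m: "a * e \<in> U" "c * g \<in> U" "b * e \<in> U" "a * e + c * g \<in> U" using U ab cd eg by simp_all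
    have nz: "a * e \<noteq> 0" "c * g \<noteq> 0" "b * e \<noteq> 0" "a * e + c * g \<noteq> 0"
      using a0 c0 e0 ab eg xy xy0 by auto
    have "val x = int (dg (a * e)) - int (dg (b * e))" "val y = int (dg (c * g)) - int (dg (b * e))"
      "val (x + y) = int (dg (a * e + c * g)) - int (dg (b * e))"
      unfolding xy unfolding x y by (intro val m nz)+
    then show "val (x + y) \<le> max (val x) (val y)"
      using dg_add[OF m(1,2) nz(4,1,2)] by linarith
  qed
  moreover have "val a = int (dg a)" if "a \<in> U" "a \<noteq> 0" for a
    using val[of a 1] U(1) that dg_mult[of 1 1] by simp
  ultimately show ?thesis by blast
qed

section \<open>The pair modulo the maximal ideal\<close>

text \<open>\<open>a\<close> and \<open>b\<close> stand for the images of \<open>u\<close> and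
  \<open>v\<close>. A product of \<open>w\<close> with either has degree up to 3, so the bound 2 on
  the commutators says that \<open>w\<close> is central to leading order.\<close>

locale valued_triple = division_valuation val
  for val :: "'d::division_ring \<Rightarrow> int" +
  fixes eps :: "'k::field_char_0 \<Rightarrow> 'd" and a b w :: 'd
  assumes eps: "central_alg_map eps" and eps_deg: "eps c \<in> deg_le 0"
    and a_deg: "a \<in> deg_le 1" and b_deg: "b \<in> deg_le 1" and b_val: "b \<noteq> 0" "val b = 1"
    and w_val: "w \<noteq> 0" "val w = 2" and w_eq: "b * a - a * b = w"
    and wa: "w * a - a * w \<in> deg_le 2" and wb: "w * b - b * w \<in> deg_le 2"
begin

definition h :: 'd where "h = eps (1/2) * (a * b + b * a)"
definition q :: 'd where "q = h * inverse w"
definition z :: 'd where "z = b ^ 2 * inverse w"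

lemma eps_hom: "eps 0 = 0" "eps 1 = 1" "eps (c + d) = eps c + eps d" "eps (c * d) = eps c * eps d"
  and eps_central: "eps c * x = x * eps c"
  using eps unfolding central_alg_map_def by blast+

lemma w_deg: "w \<in> deg_le 2" "inverse w \<in> deg_le (- 2)"
  using w_val by (auto simp: deg_le_def val_inverse)

lemma w_cancel: "w * inverse w = 1" "inverse w * w = 1" "w * (inverse w * x) = x" "inverse w * (w * x) = x"
  using w_val by (simp_all flip: mult.assoc)

lemma half: "eps (1/2) + eps (1/2) = 1"
  using eps_hom(3)[of "1/2" "1/2"] by (simp add: eps_hom)

text \<open>The commutator with \<open>w\<close> is a derivation, so the property of raising degrees
  by at most 1 instead of 2 passes to products.\<close>

lemma w_mult_comm:
  assumes "w * x - x * w \<in> deg_le (m + 1)" "w * y - y * w \<in> deg_le (n + 1)" "x \<in> deg_le m" "y \<in> deg_le n"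
    "m + n + 1 = k"
  shows "w * (x * y) - x * y * w \<in> deg_le k"
proof -
  have "w * (x * y) - x * y * w = (w * x - x * w) * y + x * (w * y - y * w)" by (simp add: algebra_simps)
  also have "\<dots> \<in> deg_le k" by (rule deg_le_add; rule deg_le_mult[OF assms(1,4)] deg_le_mult[OF assms(3,2)]) (use assms(5) in simp_all)
  finally show ?thesis .
qed

lemma wb2: "w * b ^ 2 - b ^ 2 * w \<in> deg_le 3"
  unfolding power2_eq_square by (rule w_mult_comm[of _ 1 _ 1]) (use wb b_deg in simp_all)

lemma wh: "w * h - h * w \<in> deg_le 3"
proof -
  have 1: "w * (a * b) - a * b * w \<in> deg_le 3" by (rule w_mult_comm[of _ 1 _ 1]) (use wa wb a_deg b_deg in simp_all)
  have 2: "w * (b * a) - b * a * w \<in> deg_le 3" by (rule w_mult_comm[of _ 1 _ 1]) (use wa wb a_deg b_deg in simp_all)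
  have "w * h = eps (1/2) * (w * (a * b + b * a))" unfolding h_def by (metis eps_central mult.assoc)
  then have "w * h - h * w = eps (1/2) * ((w * (a * b) - a * b * w) + (w * (b * a) - b * a * w))"
    by (simp add: h_def algebra_simps)
  also have "\<dots> \<in> deg_le 3" by (rule deg_le_mult[OF eps_deg deg_le_add[OF 1 2]]) simp
  finally show ?thesis .
qed

lemma b2_deg: "b ^ 2 \<in> deg_le 2"
  unfolding power2_eq_square by (rule deg_le_mult[OF b_deg b_deg]) simp

lemma h_deg: "h \<in> deg_le 2"
  unfolding h_def
proof (rule deg_le_mult[OF eps_deg])
  show "a * b + b * a \<in> deg_le 2"
    by (rule deg_le_add; rule deg_le_mult[OF a_deg b_deg] deg_le_mult[OF b_deg a_deg]) simp_all
qed simp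

lemma q_deg: "q \<in> deg_le 0"
  unfolding q_def by (rule deg_le_mult[OF h_deg w_deg(2)]) simp

lemma z_deg: "z \<in> deg_le 0" "z \<notin> deg_le (- 1)"
proof -
  have b2: "b ^ 2 \<noteq> 0" "val (b ^ 2) = 2" using b_val val_mult[of b b] by (simp_all add: power2_eq_square)
  have "z \<noteq> 0" "val z = 0" using b2 w_val val_mult[of "b ^ 2" "inverse w"] by (simp_all add: z_def val_inverse)
  then show "z \<in> deg_le 0" "z \<notin> deg_le (- 1)" by (simp_all add: deg_le_def)
qed

lemma inverse_w_comm:
  assumes "w * x - x * w \<in> deg_le 3"
  shows "inverse w * x - x * inverse w \<in> deg_le (- 1)"
proof -
  have "inverse w * x - x * inverse w = inverse w * (- (w * x - x * w)) * inverse w"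
    by (simp add: algebra_simps w_cancel)
  also have "\<dots> \<in> deg_le (- 1)"
    by (rule deg_le_mult[OF deg_le_mult[OF w_deg(2) deg_le_minus[OF assms] refl] w_deg(2)]) simp
  finally show ?thesis .
qed

text \<open>The commutator of \<open>b\<close> with \<open>h\<close> is half of bw + wb, so that of
  \<open>b ^ 2\<close> with \<open>h\<close> is 2 b^2 w to leading order, and division by
  \<open>w ^ 2\<close> gives 2 z. All errors are commutators with \<open>w\<close> and lose a
  degree.\<close>

lemma zq: "z * q \<approx> (q + 2) * z"
proof -
  let ?i = "inverse w"
  have c: "b * h - h * b = eps (1/2) * (b * w + w * b)"
  proof -
    have "b * h = eps (1/2) * (b * (a * b + b * a))" unfolding h_def by (metis eps_central mult.assoc)
    then have "b * h - h * b = eps (1/2) * (b * (b * a - a * b) + (b * a - a * b) * b)"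
      by (simp add: h_def algebra_simps)
    then show ?thesis by (simp only: w_eq)
  qed
  have "b ^ 2 * h - h * b ^ 2 = b * (b * h - h * b) + (b * h - h * b) * b"
    by (simp add: power2_eq_square algebra_simps)
  also have "\<dots> = eps (1/2) * (b * (b * w + w * b)) + eps (1/2) * ((b * w + w * b) * b)"
    unfolding c by (simp only: mult.assoc[symmetric] eps_central[of _ b, symmetric])
  finally have "b ^ 2 * h - h * b ^ 2 - (eps (1/2) + eps (1/2)) * (2 * (b ^ 2 * w))
      = (eps (1/2) + eps (1/2)) * (b * (w * b - b * w)) + eps (1/2) * (w * b ^ 2 - b ^ 2 * w)"
    by (simp add: power2_eq_square algebra_simps mult_2 mult_2_right)
  then have e: "b ^ 2 * h - h * b ^ 2 - 2 * (b ^ 2 * w)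
      = b * (w * b - b * w) + eps (1/2) * (w * b ^ 2 - b ^ 2 * w)"
    by (simp only: half mult_1)
  have d3: "b ^ 2 * h - h * b ^ 2 - 2 * (b ^ 2 * w) \<in> deg_le 3"
    unfolding e by (rule deg_le_add; rule deg_le_mult[OF b_deg wb] deg_le_mult[OF eps_deg wb2]) simp_all
  \<comment> \<open>The first two terms are the cost of moving \<open>inverse w\<close> past
    \<open>h\<close> and past \<open>b ^ 2\<close>.\<close>
  have "z * q - (q + 2) * z = b ^ 2 * (?i * h - h * ?i) * ?i - h * (?i * b ^ 2 - b ^ 2 * ?i) * ?i
      + (b ^ 2 * h - h * b ^ 2 - 2 * (b ^ 2 * w)) * (?i * ?i)"
    by (simp add: z_def q_def algebra_simps w_cancel)
  also have "\<dots> \<in> deg_le (- 1)"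
  proof (intro deg_le_add deg_le_diff)
    show "b ^ 2 * (?i * h - h * ?i) * ?i \<in> deg_le (- 1)"
      by (rule deg_le_mult[OF deg_le_mult[OF b2_deg inverse_w_comm[OF wh] refl] w_deg(2)]) simp
    show "h * (?i * b ^ 2 - b ^ 2 * ?i) * ?i \<in> deg_le (- 1)"
      by (rule deg_le_mult[OF deg_le_mult[OF h_deg inverse_w_comm[OF wb2] refl] w_deg(2)]) simp
    show "(b ^ 2 * h - h * b ^ 2 - 2 * (b ^ 2 * w)) * (?i * ?i) \<in> deg_le (- 1)"
      by (rule deg_le_mult[OF d3 deg_le_mult[OF w_deg(2) w_deg(2) refl]]) simp
  qed
  finally show ?thesis by (simp add: cong_def)
qed

sublocale weyl_residue "deg_le 0" "deg_le (- 1)" eps q z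
  by unfold_locales (use eps eps_deg q_deg z_deg zq in auto)

text \<open>\<open>w\<close> has degree 2 and lies outside the valuation ring, so commuting with it
  in the residue ring is expressed by a degree bound: conjugation by \<open>w\<close> fixes
  \<open>x\<close> modulo the maximal ideal, as \<open>w_conj_cong\<close> shows.\<close>

definition w_invariant :: "'d \<Rightarrow> bool" where
  "w_invariant x \<longleftrightarrow> x \<in> deg_le 0 \<and> w * x - x * w \<in> deg_le 1"

lemma w_invariant_mult: "w_invariant x \<Longrightarrow> w_invariant y \<Longrightarrow> w_invariant (x * y)"
  unfolding w_invariant_def using w_mult_comm[of x 0 y 0 1] by (simp add: mult_R)

lemma w_invariant_add: "w_invariant x \<Longrightarrow> w_invariant y \<Longrightarrow> w_invariant (x + y)"
  unfolding w_invariant_def using deg_le_add[of "w * x - x * w" 1 "w * y - y * w"]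
  by (simp add: add_R algebra_simps)

lemma w_invariant_diff: "w_invariant x \<Longrightarrow> w_invariant y \<Longrightarrow> w_invariant (x - y)"
  unfolding w_invariant_def using deg_le_diff[of "w * x - x * w" 1 "w * y - y * w"]
  by (simp add: diff_R algebra_simps)

lemma w_invariant_inverse:
  assumes "w_invariant x" "x \<notin> deg_le (- 1)"
  shows "w_invariant (inverse x)"
proof -
  have x: "x \<in> deg_le 0" "w * x - x * w \<in> deg_le 1" using assms by (simp_all add: w_invariant_def)
  have i: "inverse x \<in> deg_le 0" using inverse_R x(1) assms(2) by blast
  have "x \<noteq> 0" using assms(2) zero_M by auto
  then have c: "x * inverse x = 1" "inverse x * (x * y) = y" for y by (simp_all flip: mult.assoc)
  have "w * inverse x - inverse x * w = inverse x * (- (w * x - x * w)) * inverse x"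
    by (simp add: algebra_simps c)
  also have "\<dots> \<in> deg_le 1"
    by (rule deg_le_mult[OF deg_le_mult[OF i deg_le_minus[OF x(2)] refl] i]) simp
  finally show ?thesis using i by (simp add: w_invariant_def)
qed

lemma w_invariant_eps: "w_invariant (eps c)"
  unfolding w_invariant_def using eps_deg eps_central[of c w] zero_M by (auto simp: deg_le_def)

lemma w_invariant_q: "w_invariant q" and w_invariant_z: "w_invariant z"
proof -
  have *: "w_invariant (x * inverse w)" if "x \<in> deg_le 2" "w * x - x * w \<in> deg_le 3" for x
  proof -
    have "w * (x * inverse w) - x * inverse w * w = (w * x - x * w) * inverse w"
      by (simp add: algebra_simps w_cancel)
    then show ?thesis using deg_le_mult[OF that(2) w_deg(2)] deg_le_mult[OF that(1) w_deg(2)]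
      by (simp add: w_invariant_def)
  qed
  show "w_invariant q" unfolding q_def by (rule *[OF h_deg wh])
  show "w_invariant z" unfolding z_def by (rule *[OF b2_deg wb2])
qed

lemma w_conj_cong:
  assumes "w_invariant x"
  shows "w * x * inverse w \<approx> x" "inverse w * x * w \<approx> x"
proof -
  have x: "w * x - x * w \<in> deg_le 1" using assms by (simp add: w_invariant_def)
  have "w * x * inverse w - x = (w * x - x * w) * inverse w"
    by (simp add: algebra_simps w_cancel)
  then show "w * x * inverse w \<approx> x" using deg_le_mult[OF x w_deg(2)] by (simp add: cong_def)
  have "inverse w * x * w - x = inverse w * (- (w * x - x * w))"
    by (simp add: algebra_simps w_cancel)
  then show "inverse w * x * w \<approx> x" using deg_le_mult[OF w_deg(2) deg_le_minus[OF x]] by (simp add: cong_def)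
qed

lemma inverse_mult: "x \<noteq> 0 \<Longrightarrow> y \<noteq> 0 \<Longrightarrow> inverse (x * y) = inverse y * inverse x" for x y :: 'd
  by (rule nonzero_inverse_mult_distrib)

text \<open>The cubic expressions in \<open>S\<close> are \<open>w * x * w * w\<close> with x = q -
  1/3 or q + 1/3, and the factors of \<open>T\<close> are \<open>(1 + z) * w\<close> and
  \<open>(1 - z) * w\<close>. In \<open>S\<close> and \<open>T\<close> the factors \<open>w\<close>
  then cancel up to conjugation by \<open>w\<close>, which is invisible modulo the maximal
  ideal.\<close>

theorem triple_free:
  defines "V \<equiv> eps (1/2) * w * (a * b + b * a) * w"
  defines "S \<equiv> (V - eps (1/3) * w ^ 3) * inverse (V + eps (1/3) * w ^ 3)
             + inverse (V - eps (1/3) * w ^ 3) * (V + eps (1/3) * w ^ 3)"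
  defines "T \<equiv> inverse (w + b ^ 2) * (w - b ^ 2) * S * (w + b ^ 2) * inverse (w - b ^ 2)"
  shows "free_on_pair eps S T"
proof -
  let ?i = "inverse w"
  let ?m = "q - eps (1/3)" and ?p = "q + eps (1/3)"
  have e3: "eps (- (1/3)) = - eps (1/3)"
    using eps_hom(3)[of "1/3" "- (1/3)"] by (simp add: eps_hom eq_neg_iff_add_eq_0 add.commute)
  have mp: "?m \<notin> deg_le (- 1)" "?p \<notin> deg_le (- 1)"
    using q_notin_M[of "1/3"] q_notin_M[of "- (1/3)"] by (simp_all add: e3)
  then have mp0: "?m \<noteq> 0" "?p \<noteq> 0" using zero_M by auto
  have inv: "w_invariant ?m" "w_invariant ?p"
    by (intro w_invariant_diff w_invariant_add w_invariant_q w_invariant_eps)+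
  have cw: "x * (eps c * y) = eps c * (x * y)" for c x y by (metis eps_central mult.assoc)
  have Vw: "V = w * q * w * w"
    unfolding V_def q_def h_def by (simp add: mult.assoc w_cancel cw)
  have V1: "V - eps (1/3) * w ^ 3 = w * ?m * w * w"
    unfolding Vw by (simp add: power3_eq_cube algebra_simps cw)
  have V2: "V + eps (1/3) * w ^ 3 = w * ?p * w * w"
    unfolding Vw by (simp add: power3_eq_cube algebra_simps cw)
  let ?r = "?m * inverse ?p" and ?r' = "inverse ?m * ?p"
  have ir: "w_invariant ?r" "w_invariant ?r'"
    by (intro w_invariant_mult w_invariant_inverse inv mp)+
  have S_eq: "S = w * ?r * ?i + ?i * (?i * ?r' * w) * w"
    unfolding S_def V1 V2 using mp0 w_val
    by (simp add: inverse_mult mult.assoc w_cancel)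
  have "?i * (?i * ?r' * w) * w \<approx> ?i * ?r' * w"
  proof -
    have "?i * (?i * ?r' * w - ?r') * w \<in> deg_le (- 1)"
      by (rule deg_le_mult[OF deg_le_mult[OF w_deg(2) _ refl] w_deg(1)])
         (use w_conj_cong(2)[OF ir(2)] in \<open>simp_all add: cong_def\<close>)
    then show ?thesis by (simp add: cong_def algebra_simps)
  qed
  also have "\<dots> \<approx> ?r'" by (rule w_conj_cong(2)[OF ir(2)])
  finally have S: "S \<approx> ?r + ?r'" unfolding S_eq by (intro cong_add w_conj_cong(1) ir)
  have S_R: "S \<in> deg_le 0" using cong_R[OF S] ir by (simp add: w_invariant_def add_R)
  have C: "w + b ^ 2 = (1 + z) * w" "w - b ^ 2 = (1 - z) * w"
    by (simp_all add: z_def algebra_simps w_cancel)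
  have z0: "1 + z \<noteq> 0" "1 - z \<noteq> 0" using z_notin zero_M by auto
  let ?u = "inverse (1 + z) * (1 - z)" and ?v = "(1 + z) * inverse (1 - z)"
  have one: "w_invariant 1" using w_invariant_eps[of 1] by (simp add: eps_hom)
  have iu: "w_invariant ?u"
    by (intro w_invariant_mult w_invariant_inverse w_invariant_add w_invariant_diff one w_invariant_z z_notin)
  have "T = (?i * ?u * w) * S * ?v"
    unfolding T_def C using z0 w_val by (simp add: inverse_mult mult.assoc w_cancel)
  also have "\<dots> \<approx> ?u * S * ?v"
  proof (intro cong_mult_right w_conj_cong iu S_R)
    show "?v \<in> deg_le 0" using cayley_R[of False] by (simp add: cayley_eq)
  qed
  finally have "T \<approx> ?u * S * ?v" .
  then show ?thesis by (intro weyl_pair_free S_R S)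
qed

end

section \<open>Independence of u, v, [v, u] and symmetry under the involution\<close>

lemma lie_gen_subset_span:
  assumes lie: "lie_algebra scale br" and w: "br v u \<in> module.span scale {u, v}"
  shows "lie_gen scale br {u, v} \<subseteq> module.span scale {u, v}"
proof -
  interpret vector_space scale using lie by (simp add: lie_algebra_def)
  note lin = lie_bracket_lin[OF lie] and self = lie_bracket_self[OF lie]
  have uv: "br x y \<in> span {u, v}" if "x \<in> {u, v}" "y \<in> {u, v}" for x y
    using that w self lie_bracket_antisym[OF lie, of u v] by (auto simp: span_zero span_neg)
  have 1: "br x y \<in> span {u, v}" if "x \<in> {u, v}" "y \<in> span {u, v}" for x y
    using that(2)
    by (rule span_induct) (use that(1) uv in \<open>auto simp: subspace_def lin span_zero span_add span_scale\<close>)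
  have 2: "br x y \<in> span {u, v}" if "x \<in> span {u, v}" "y \<in> span {u, v}" for x y
    using that(1)
    by (rule span_induct) (use that(2) 1 in \<open>auto simp: subspace_def lin span_zero span_add span_scale\<close>)
  show ?thesis
  proof
    fix x assume "x \<in> lie_gen scale br {u, v}"
    then show "x \<in> span {u, v}"
      by induction (auto intro: span_base span_zero span_add span_scale 2)
  qed
qed

text \<open>If \<open>br v u\<close> lay in the span of \<open>u\<close> and \<open>v\<close>, that
  span would be closed under the bracket and contain the generated subalgebra, which would have
  dimension at most two. Proportional \<open>u\<close> and \<open>v\<close> would have zero
  bracket.\<close>

lemma generators_independent:
  assumes lie: "lie_algebra scale br" and dim: "dim_ge3 scale (lie_gen scale br {u, v})"
  shows "\<not> module.dependent scale {u, v, br v u}" "u \<noteq> v" "br v u \<noteq> u" "br v u \<noteq> v"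
proof -
  interpret vector_space scale using lie by (simp add: lie_algebra_def)
  have w: "br v u \<notin> span {u, v}"
  proof
    assume "br v u \<in> span {u, v}"
    then have sub: "lie_gen scale br {u, v} \<subseteq> span {u, v}" by (rule lie_gen_subset_span[OF lie])
    obtain X where X: "X \<subseteq> lie_gen scale br {u, v}" "card X = 3" "independent X"
      using dim unfolding dim_ge3_def by blast
    have "card X \<le> card {u, v}"
      using independent_span_bound[of "{u, v}" X] X sub by auto
    also have "\<dots> \<le> 2" by (simp add: card_insert_if)
    finally show False using X(2) by simp
  qed
  note lin = lie_bracket_lin[OF lie] and self = lie_bracket_self[OF lie]
  have w0: "br v u \<noteq> 0" using w span_zero by auto
  have u0: "u \<noteq> 0"
  proof
    assume "u = 0"
    then show False using w0 lin by simp
  qed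
  have vu: "v \<notin> span {u}"
  proof
    assume "v \<in> span {u}"
    then obtain c where "v = scale c u" by (auto simp: span_singleton)
    then show False using w0 lin self by simp
  qed
  have uv: "u \<notin> span {v}"
  proof
    assume "u \<in> span {v}"
    then obtain c where "u = scale c v" by (auto simp: span_singleton)
    then show False using w0 lin self by simp
  qed
  have v0: "v \<noteq> 0" using vu span_zero by auto
  show ne: "u \<noteq> v" using vu span_base by auto
  show ne': "br v u \<noteq> u" "br v u \<noteq> v" using w span_base by auto
  have "independent {v}" using v0 by simp
  then have "independent {u, v}" using uv ne by (simp add: independent_insert)
  then have "independent (insert (br v u) {u, v})" using w ne' by (simp add: independent_insert)
  then show "independent {u, v, br v u}" by (simp add: insert_commute)
qed

text \<open>The involution fixes \<open>V\<close> and negates \<open>w ^ 3\<close>, hence exchanges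
  \<open>P\<close> and \<open>Q\<close> and with them the two summands of \<open>S\<close>. It
  exchanges \<open>X\<close> and \<open>Y\<close> up to sign, and the four signs in \<open>T\<close>
  cancel.\<close>

lemma star_pair_symmetric:
  fixes f :: "'l \<Rightarrow> 'd::division_ring" and eps :: "'k::field_char_0 \<Rightarrow> 'd" and u v :: 'l and w :: 'd
  assumes star: "principal_involution eps f star" and w: "star w = - w"
  defines "V \<equiv> eps (1/2) * w * (f u * f v + f v * f u) * w"
  defines "S \<equiv> (V - eps (1/3) * w ^ 3) * inverse (V + eps (1/3) * w ^ 3)
             + inverse (V - eps (1/3) * w ^ 3) * (V + eps (1/3) * w ^ 3)"
  defines "T \<equiv> inverse (w + f v ^ 2) * (w - f v ^ 2) * S * (w + f v ^ 2) * inverse (w - f v ^ 2)"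
  shows "star S = S \<and> star T = T"
proof -
  have add: "star (x + y) = star x + star y" and mult: "star (x * y) = star y * star x"
    and scal: "star (eps c * x) = eps c * star x" and star2: "star (star x) = x" and fl: "star (f l) = - f l" for x y c l
    using star unfolding principal_involution_def by blast+
  have zero: "star 0 = 0" using add[of 0 0] by simp
  have one: "star 1 = 1" using mult[of "star 1" 1] star2[of 1] by simp
  have neg: "star (- x) = - star x" for x using add[of x "- x"] by (simp add: zero eq_neg_iff_add_eq_0 add.commute)
  have diff: "star (x - y) = star x - star y" for x y using add[of x "- y"] by (simp add: neg)
  have inv: "star (inverse x) = inverse (star x)" for x
  proof (cases "x = 0")
    case False
    then have "star (inverse x) * star x = 1" using mult[of x "inverse x"] one by simp
    then show ?thesis by (metis inverse_unique inverse_inverse_eq)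
  qed (simp add: zero)
  have V: "star V = V"
    unfolding V_def mult.assoc scal by (simp add: mult add fl w mult.assoc add.commute)
  have w3: "star (eps (1/3) * w ^ 3) = - (eps (1/3) * w ^ 3)"
    unfolding scal by (simp add: power3_eq_cube mult w mult.assoc)
  have A: "star (V - eps (1/3) * w ^ 3) = V + eps (1/3) * w ^ 3" "star (V + eps (1/3) * w ^ 3) = V - eps (1/3) * w ^ 3"
    by (simp_all add: diff add V w3)
  define P Q where "P = V - eps (1/3) * w ^ 3" and "Q = V + eps (1/3) * w ^ 3"
  have PQ: "star P = Q" "star Q = P" using A by (simp_all only: P_def Q_def)
  have S: "star S = S"
    unfolding S_def P_def[symmetric] Q_def[symmetric] add mult inv PQ by (rule add.commute)
  have v2: "star (f v ^ 2) = f v ^ 2" by (simp add: power2_eq_square mult fl)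
  have C: "star (w + f v ^ 2) = - (w - f v ^ 2)" "star (w - f v ^ 2) = - (w + f v ^ 2)"
    by (simp_all add: add diff v2 w)
  define X Y where "X = w + f v ^ 2" and "Y = w - f v ^ 2"
  have XY: "star X = - Y" "star Y = - X" using C by (simp_all only: X_def Y_def)
  have "star T = T"
    unfolding T_def X_def[symmetric] Y_def[symmetric] mult inv XY S by (simp add: mult.assoc)
  with S show ?thesis by blast
qed

theorem mainTheorem11:
  fixes scale :: "'k::field_char_0 \<Rightarrow> 'l::ab_group_add \<Rightarrow> 'l"
    and br :: "'l \<Rightarrow> 'l \<Rightarrow> 'l"
    and eps :: "'k \<Rightarrow> 'd::division_ring"
    and f :: "'l \<Rightarrow> 'd"
    and u v :: 'l
    and w V S T :: 'd
  assumes lie: "lie_algebra scale br"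
    and ore: "is_ore_fraction_ring_uea scale br eps f"
    and dim: "dim_ge3 scale (lie_gen scale br {u, v})"
    and w_def: "w = f (br v u)"
    and V_def: "V = eps (1/2) * w * (f u * f v + f v * f u) * w"
    and S_def: "S = (V - eps (1/3) * w ^ 3) * inverse (V + eps (1/3) * w ^ 3)
             + inverse (V - eps (1/3) * w ^ 3) * (V + eps (1/3) * w ^ 3)"
    and T_def: "T = inverse (w + f v ^ 2) * (w - f v ^ 2) * S * (w + f v ^ 2) * inverse (w - f v ^ 2)"
  shows "free_on_pair eps S T \<and>
         (\<forall>star. principal_involution eps f star \<longrightarrow> star S = S \<and> star T = T)"
proof
  interpret vector_space scale using lie by (simp add: lie_algebra_def)
  note gen = generators_independent[OF lie dim]
  define B where "B = extend_basis {u, v, br v u}"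
  define wt :: "'l \<Rightarrow> nat" where "wt x = (if x = u \<or> x = v then 1 else 2)" for x
  have B: "independent B" "span B = UNIV" "{u, v, br v u} \<subseteq> B"
    unfolding B_def using gen(1)
    by (simp_all add: independent_extend_basis span_extend_basis extend_basis_superset del: insert_subset)
  \<comment> \<open>No weight exceeds 2, the least possible sum of two weights, so the condition on
    brackets holds in every Lie algebra.\<close>
  have all: "{d \<in> B. wt d \<le> n} = B" if "n \<ge> 2" for n using that by (auto simp: wt_def)
  interpret L: lie_weighted_basis scale br eps f B wt
  proof
    fix b c assume "b \<in> B" "c \<in> B"
    have "wt b + wt c \<ge> 2" by (simp add: wt_def)
    then show "br b c \<in> span {d \<in> B. wt d \<le> wt b + wt c}" by (simp add: all B(2))
  qed (use lie ore B in auto)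
  obtain U dg where U: "\<forall>c\<in>free_alg. fa_eval eps f c \<in> U" "1 \<in> U" "\<forall>a\<in>U. \<forall>b\<in>U. a + b \<in> U \<and> a * b \<in> U"
    and dg_mult: "\<forall>a\<in>U. \<forall>b\<in>U. a \<noteq> 0 \<longrightarrow> b \<noteq> 0 \<longrightarrow> dg (a * b) = dg a + (dg b :: nat)"
    and dg_add: "\<forall>a\<in>U. \<forall>b\<in>U. a + b \<noteq> 0 \<longrightarrow> a \<noteq> 0 \<longrightarrow> b \<noteq> 0 \<longrightarrow> dg (a + b) \<le> max (dg a) (dg b)"
    and dg_basis: "\<forall>b\<in>B. f b \<noteq> 0 \<and> dg (f b) = wt b"
    and dg_le: "\<forall>x n. f x \<noteq> 0 \<longrightarrow> x \<in> span {b \<in> B. wt b \<le> n} \<longrightarrow> dg (f x) \<le> n"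
    using L.uea_degree_exists by blast
  have frac: "\<exists>a\<in>U. \<exists>b\<in>U. b \<noteq> 0 \<and> d = a * inverse b" for d
    using ore U(1) unfolding is_ore_fraction_ring_uea_def by meson
  obtain val where val: "division_valuation val" "\<forall>a\<in>U. a \<noteq> 0 \<longrightarrow> val a = int (dg a)"
    using ore_valuation_exists[of U dg] U(2,3) dg_mult dg_add frac by auto
  have f_U: "f x \<in> U" for x
  proof -
    have "fa_eval eps f (fa_word [x]) = f x"
      unfolding fa_eval_word_sum word_sum_word[OF L.eps_module] by simp
    then show ?thesis using U(1) free_alg_word by metis
  qed
  have eps_U: "eps c \<in> U" for c
  proof -
    have "fa_eval eps f (\<lambda>u. c * fa_word [] u) = eps c"
      unfolding fa_eval_word_sum word_sum_scale[OF L.eps_module free_alg_word] word_sum_word[OF L.eps_module] by simp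
    then show ?thesis using U(1) free_alg_scale[OF free_alg_word] by metis
  qed
  interpret val: division_valuation val by (rule val(1))
  have val_basis: "f b \<noteq> 0" "val (f b) = int (wt b)" if "b \<in> B" for b
    using that dg_basis val(2) f_U by auto
  have val_f: "f x \<in> val.deg_le 2" for x
    using dg_le val(2) f_U[of x] all[of 2] B(2) by (force simp: val.deg_le_def)
  interpret valued_triple val eps "f u" "f v" w
  proof
    show "central_alg_map eps" by (rule L.eps_map)
    \<comment> \<open>A nonzero scalar and its inverse both lie in \<open>U\<close>, where degrees
      are nonnegative, and their degrees add up to 0.\<close>
    show "eps c \<in> val.deg_le 0" for c
    proof (cases "c = 0")
      case False
      then have "eps c * eps (inverse c) = 1" by (simp add: L.eps_hom flip: L.eps_hom(4))
      moreover from this have "eps c \<noteq> 0" "eps (inverse c) \<noteq> 0" by auto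
      ultimately have "val (eps c) + val (eps (inverse c)) = 0" using val.val_mult val.val_1 by metis
      moreover have "val (eps c) \<ge> 0" "val (eps (inverse c)) \<ge> 0"
        using \<open>eps c \<noteq> 0\<close> \<open>eps (inverse c) \<noteq> 0\<close> val(2) eps_U by auto
      ultimately show ?thesis by (simp add: val.deg_le_def)
    qed (simp add: L.eps_hom val.deg_le_def)
    show "f u \<in> val.deg_le 1" "f v \<in> val.deg_le 1" "f v \<noteq> 0" "val (f v) = 1"
      using val_basis[of u] val_basis[of v] B(3) by (auto simp: val.deg_le_def wt_def)
    show "w \<noteq> 0" "val w = 2"
      using val_basis[of "br v u"] B(3) gen by (auto simp: w_def wt_def)
    show "f v * f u - f u * f v = w" by (simp add: w_def L.f_br)
    \<comment> \<open>These commutators are images of elements of \<open>L\<close>, so their degree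
      is at most 2 instead of 3.\<close>
    show "w * f u - f u * w \<in> val.deg_le 2" "w * f v - f v * w \<in> val.deg_le 2"
      unfolding w_def L.f_br[symmetric] by (rule val_f)+
  qed
  show "free_on_pair eps S T" unfolding T_def S_def V_def by (rule triple_free)
  show "\<forall>star. principal_involution eps f star \<longrightarrow> star S = S \<and> star T = T"
  proof (intro allI impI)
    fix star assume star: "principal_involution eps f star"
    then have "star w = - w" unfolding principal_involution_def w_def by blast
    from star_pair_symmetric[OF star this, of u v]
    show "star S = S \<and> star T = T" unfolding T_def S_def V_def .
  qed
qed

end
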